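(* Let $\Omega,\Omega_f,V,W,Q$ be as in the context. Assume that $\mathbb{C}_\Omega$ and $\mathbb{C}_f$ are strongly elliptic with constants $c_\Omega$ and $c_f$ respectively, such that $c_f>c_\Omega>0$, and let $\delta\mathbb{C}_f=\mathbb{C}_f-\mathbb{C}_\Omega$. Then the following problem is well-posed and has a unique solution: given $b\in L^2(\Omega)^3$, find $u\in V$, $w\in W$, $\lambda\in Q$ such that $$\begin{aligned}(\mathbb{C}_\Omega\nabla u,\nabla v)_\Omega+\langle\lambda,v|_{\Omega_f}\rangle&=(b,v)_\Omega&&\forall v\in V,\\ (\delta\mathbb{C}_f\nabla w,\nabla y)_{\Omega_f}-\langle\lambda,y\rangle&=0&&\forall y\in W,\\ \langle q,u|_{\Omega_f}-w\rangle&=0&&\forall q\in Q.\end{aligned}$$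
   Context: $\Omega\subset\mathbb{R}^3$ is a connected, bounded, Lipschitz domain; $\Omega_f\subset\Omega$ is a union of finitely many (possibly overlapping) connected Lipschitz domains; $\hat\Omega=\Omega\setminus\Omega_f$ is a connected Lipschitz domain. $B_e=\partial\Omega\cap\partial\Omega_f$. $V=\{v\in H^1(\Omega)^3: v|_{\partial\Omega}=0\}$ and $W=\{w\in H^1(\Omega_f)^3: w|_{B_e}=0\}$, with the $H^1$ norms. $Q=W'$ is the dual space of $W$ with the dual norm and $\langle\cdot,\cdot\rangle$ is the duality pairing between $Q$ and $W$. $(\cdot,\cdot)_A$ is the $L^2(A)$ scalar product, so $(\mathbb{C}\nabla u,\nabla v)_A=\int_A \mathbb{C}\nabla u:\nabla v$. $\mathbb{C}_\Omega$ (elastic matrix) and $\mathbb{C}_f$ (fibers) are constant symmetric fourth-order elasticity tensors (major and minor symmetries). Such a tensor $\mathbb{C}$ is strongly elliptic with constant $c>0$ if $\mathbb{C}A:A\ge c|A|^2$ for all symmetric $A\in\mathbb{R}^{3\times3}$. "Well-posed" means that for every $b$ there is exactly one solution and it depends continuously on $b$. *)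

theory Defs
  imports "HOL-Analysis.Analysis"
begin

subsection \<open>Lipschitz domains\<close>

text \<open>Near each boundary point the domain is, in suitable orthonormal coordinates, the strict
  subgraph of a Lipschitz function of the first two coordinates. The origin of the local coordinate
  system is immaterial, since \<open>\<gamma>\<close> may absorb a translation.\<close>

definition lipschitz_domain :: "(real^3) set \<Rightarrow> bool" where
  "lipschitz_domain D \<longleftrightarrow> open D \<and> connected D \<and> D \<noteq> {} \<and>
     (\<forall>p\<in>frontier D. \<exists>r>0. \<exists>(R :: real^3 \<Rightarrow> real^3) (\<gamma> :: real^2 \<Rightarrow> real) L.
        orthogonal_transformation R \<and> L-lipschitz_on UNIV \<gamma> \<and>
        D \<inter> ball p r = {x \<in> ball p r. R x $ 3 < \<gamma> (vector [R x $ 1, R x $ 2])})"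

subsection \<open>The spaces \<open>L\<^sup>2\<close> and \<open>H\<^sup>1\<close>\<close>

text \<open>Elements of function spaces are represented by functions on the whole space, of which only the
  values on \<open>A\<close>, up to null sets, matter. In particular the restriction of \<open>v\<close> to a
  subset is represented by \<open>v\<close> itself.\<close>

definition L2 :: "(real^3) set \<Rightarrow> (real^3 \<Rightarrow> 'b::real_normed_vector) set" where
  "L2 A = {f. f \<in> borel_measurable (lebesgue_on A) \<and>
              integrable (lebesgue_on A) (\<lambda>x. (norm (f x))\<^sup>2)}"

definition L2_norm :: "(real^3) set \<Rightarrow> (real^3 \<Rightarrow> 'b::real_normed_vector) \<Rightarrow> real" where
  "L2_norm A f = sqrt (LINT x|lebesgue_on A. (norm (f x))\<^sup>2)"

definition L2_inner ::
  "(real^3) set \<Rightarrow> (real^3 \<Rightarrow> 'b::real_inner) \<Rightarrow> (real^3 \<Rightarrow> 'b) \<Rightarrow> real" where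
  "L2_inner A f g = (LINT x|lebesgue_on A. f x \<bullet> g x)"

definition C1 :: "(real^3 \<Rightarrow> 'b::real_normed_vector) \<Rightarrow> bool" where
  "C1 \<phi> \<longleftrightarrow> (\<forall>x. \<phi> differentiable (at x)) \<and>
             (\<forall>v. continuous_on UNIV (\<lambda>x. frechet_derivative \<phi> (at x) v))"

definition partial_deriv :: "3 \<Rightarrow> (real^3 \<Rightarrow> real) \<Rightarrow> real^3 \<Rightarrow> real" where
  "partial_deriv j \<phi> x = frechet_derivative \<phi> (at x) (axis j 1)"

text \<open>As in Gilbarg and Trudinger, first-order weak derivatives are tested against compactly
  supported \<open>C\<^sup>1\<close> functions.\<close>

definition test_function :: "(real^3) set \<Rightarrow> (real^3 \<Rightarrow> real) \<Rightarrow> bool" where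
  "test_function A \<phi> \<longleftrightarrow> C1 \<phi> \<and> (\<exists>K. compact K \<and> K \<subseteq> A \<and> (\<forall>x. x \<notin> K \<longrightarrow> \<phi> x = 0))"

definition has_weak_gradient ::
  "(real^3) set \<Rightarrow> (real^3 \<Rightarrow> real^3) \<Rightarrow> (real^3 \<Rightarrow> real^3^3) \<Rightarrow> bool" where
  "has_weak_gradient A u G \<longleftrightarrow> (\<forall>i j \<phi>. test_function A \<phi> \<longrightarrow>
     (LINT x|lebesgue_on A. u x $ i * partial_deriv j \<phi> x)
       = - (LINT x|lebesgue_on A. G x $ i $ j * \<phi> x))"

definition H1 :: "(real^3) set \<Rightarrow> (real^3 \<Rightarrow> real^3) set" where
  "H1 A = {u \<in> L2 A. \<exists>G\<in>L2 A. has_weak_gradient A u G}"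

definition wgrad :: "(real^3) set \<Rightarrow> (real^3 \<Rightarrow> real^3) \<Rightarrow> real^3 \<Rightarrow> real^3^3" where
  "wgrad A u = (SOME G. G \<in> L2 A \<and> has_weak_gradient A u G)"

definition H1_norm :: "(real^3) set \<Rightarrow> (real^3 \<Rightarrow> real^3) \<Rightarrow> real" where
  "H1_norm A u = sqrt ((L2_norm A u)\<^sup>2 + (L2_norm A (wgrad A u))\<^sup>2)"

subsection \<open>Traces\<close>

text \<open>Surface measure is the two-dimensional Hausdorff measure. The factor \<open>pi / 4\<close>
  normalises it to area. The Hausdorff outer measure is a metric outer measure, hence countably
  additive on Borel sets, so that \<open>measure_of\<close> does not collapse to the zero measure.\<close>

definition hausdorff2_pre :: "real \<Rightarrow> (real^3) set \<Rightarrow> ennreal" where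
  "hausdorff2_pre \<delta> A =
     (INF C\<in>{C :: nat \<Rightarrow> (real^3) set. A \<subseteq> (\<Union>i. C i) \<and> (\<forall>i. bounded (C i) \<and> diameter (C i) \<le> \<delta>)}.
        (\<Sum>i. ennreal (pi / 4 * (diameter (C i))\<^sup>2)))"

definition hausdorff2 :: "(real^3) set \<Rightarrow> ennreal" where
  "hausdorff2 A = (SUP \<delta>\<in>{0<..}. hausdorff2_pre \<delta> A)"

definition surface_measure :: "(real^3) measure" where
  "surface_measure = measure_of UNIV (sets borel) hausdorff2"

text \<open>The trace operator from \<open>H\<^sup>1(D)\<close> to \<open>L\<^sup>2(\<Gamma>)\<close>, for a bounded Lipschitz domain
  \<open>D\<close> and \<open>\<Gamma> \<subseteq> frontier D\<close>, is the continuous extension of the restriction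
  \<open>\<phi> \<mapsto> \<phi>|\<Gamma>\<close> from the dense subspace of functions that are \<open>C\<^sup>1\<close> up to the boundary;
  \<open>g\<close> is the trace of \<open>u\<close>.\<close>

definition has_trace ::
  "(real^3) set \<Rightarrow> (real^3) set \<Rightarrow> (real^3 \<Rightarrow> real^3) \<Rightarrow> (real^3 \<Rightarrow> real^3) \<Rightarrow> bool" where
  "has_trace D \<Gamma> u g \<longleftrightarrow> g \<in> borel_measurable borel \<and>
     (\<exists>\<phi> :: nat \<Rightarrow> real^3 \<Rightarrow> real^3. (\<forall>n. C1 (\<phi> n)) \<and>
        (\<lambda>n. H1_norm D (\<lambda>x. \<phi> n x - u x)) \<longlonglongrightarrow> 0 \<and>
        (\<lambda>n. \<integral>\<^sup>+x\<in>\<Gamma>. ennreal ((norm (\<phi> n x - g x))\<^sup>2) \<partial>surface_measure) \<longlonglongrightarrow> 0)"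

subsection \<open>The spaces \<open>V\<close>, \<open>W\<close> and \<open>Q\<close>\<close>

definition V_space :: "(real^3) set \<Rightarrow> (real^3 \<Rightarrow> real^3) set" where
  "V_space \<Omega> = {v \<in> H1 \<Omega>. has_trace \<Omega> (frontier \<Omega>) v (\<lambda>_. 0)}"

text \<open>\<open>\<D>\<close> is the finite family of Lipschitz domains whose union is the fiber region. The union
  itself need not be a Lipschitz domain (two members may touch from opposite sides), so the trace on
  \<open>B\<^sub>e\<close> is taken from each member; these parts cover \<open>B\<^sub>e\<close>, because
  \<open>frontier (\<Union>\<D>) \<subseteq> (\<Union>D\<in>\<D>. frontier D)\<close>.\<close>

definition B_ext :: "(real^3) set \<Rightarrow> (real^3) set set \<Rightarrow> (real^3) set" where
  "B_ext \<Omega> \<D> = frontier \<Omega> \<inter> frontier (\<Union>\<D>)"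

definition W_space :: "(real^3) set \<Rightarrow> (real^3) set set \<Rightarrow> (real^3 \<Rightarrow> real^3) set" where
  "W_space \<Omega> \<D> = {w \<in> H1 (\<Union>\<D>). \<forall>D\<in>\<D>. has_trace D (B_ext \<Omega> \<D> \<inter> frontier D) w (\<lambda>_. 0)}"

text \<open>A functional on \<open>W\<close> is represented by a function of which only the values on \<open>W\<close> matter.
  Boundedness makes it invariant under changes on null sets.\<close>

definition Q_space ::
  "(real^3) set \<Rightarrow> (real^3) set set \<Rightarrow> ((real^3 \<Rightarrow> real^3) \<Rightarrow> real) set" where
  "Q_space \<Omega> \<D> = {q.
     (\<forall>w\<in>W_space \<Omega> \<D>. \<forall>y\<in>W_space \<Omega> \<D>. q (\<lambda>x. w x + y x) = q w + q y) \<and>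
     (\<forall>a. \<forall>w\<in>W_space \<Omega> \<D>. q (\<lambda>x. a *\<^sub>R w x) = a * q w) \<and>
     (\<exists>K. \<forall>w\<in>W_space \<Omega> \<D>. \<bar>q w\<bar> \<le> K * H1_norm (\<Union>\<D>) w)}"

definition Q_norm ::
  "(real^3) set \<Rightarrow> (real^3) set set \<Rightarrow> ((real^3 \<Rightarrow> real^3) \<Rightarrow> real) \<Rightarrow> real" where
  "Q_norm \<Omega> \<D> q = (SUP w\<in>{w \<in> W_space \<Omega> \<D>. H1_norm (\<Union>\<D>) w \<le> 1}. \<bar>q w\<bar>)"

subsection \<open>Elasticity tensors\<close>

type_synonym tensor4 = "real^3^3^3^3"

definition tensor_apply :: "tensor4 \<Rightarrow> real^3^3 \<Rightarrow> real^3^3" where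
  "tensor_apply C A = (\<chi> i j. \<Sum>k\<in>UNIV. \<Sum>l\<in>UNIV. C $ i $ j $ k $ l * A $ k $ l)"

definition elasticity_tensor :: "tensor4 \<Rightarrow> bool" where
  "elasticity_tensor C \<longleftrightarrow> (\<forall>i j k l.
     C $ i $ j $ k $ l = C $ k $ l $ i $ j \<and>
     C $ i $ j $ k $ l = C $ j $ i $ k $ l \<and>
     C $ i $ j $ k $ l = C $ i $ j $ l $ k)"

text \<open>The inner product and norm of \<open>real^3^3\<close> are the double contraction \<open>A:B\<close> and the
  Frobenius norm.\<close>

definition strongly_elliptic :: "tensor4 \<Rightarrow> real \<Rightarrow> bool" where
  "strongly_elliptic C c \<longleftrightarrow> c > 0 \<and>
     (\<forall>A. transpose A = A \<longrightarrow> tensor_apply C A \<bullet> A \<ge> c * (norm A)\<^sup>2)"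

subsection \<open>The variational problem\<close>

definition is_solution ::
  "(real^3) set \<Rightarrow> (real^3) set set \<Rightarrow> tensor4 \<Rightarrow> tensor4 \<Rightarrow> (real^3 \<Rightarrow> real^3) \<Rightarrow>
   (real^3 \<Rightarrow> real^3) \<Rightarrow> (real^3 \<Rightarrow> real^3) \<Rightarrow> ((real^3 \<Rightarrow> real^3) \<Rightarrow> real) \<Rightarrow> bool" where
  "is_solution \<Omega> \<D> C\<^sub>\<Omega> \<delta>C b u w l \<longleftrightarrow>
     u \<in> V_space \<Omega> \<and> w \<in> W_space \<Omega> \<D> \<and> l \<in> Q_space \<Omega> \<D> \<and>
     (\<forall>v\<in>V_space \<Omega>.
        L2_inner \<Omega> (\<lambda>x. tensor_apply C\<^sub>\<Omega> (wgrad \<Omega> u x)) (wgrad \<Omega> v) + l v = L2_inner \<Omega> b v) \<and>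
     (\<forall>y\<in>W_space \<Omega> \<D>.
        L2_inner (\<Union>\<D>) (\<lambda>x. tensor_apply \<delta>C (wgrad (\<Union>\<D>) w x)) (wgrad (\<Union>\<D>) y) - l y = 0) \<and>
     (\<forall>q\<in>Q_space \<Omega> \<D>. q (\<lambda>x. u x - w x) = 0)"

text \<open>Uniqueness is equality in \<open>V \<times> W \<times> Q\<close>, that is, up to the identifications made by the
  representation of these spaces.\<close>

definition well_posed ::
  "(real^3) set \<Rightarrow> (real^3) set set \<Rightarrow> tensor4 \<Rightarrow> tensor4 \<Rightarrow> bool" where
  "well_posed \<Omega> \<D> C\<^sub>\<Omega> \<delta>C \<longleftrightarrow>
     (\<forall>b\<in>L2 \<Omega>. \<exists>u w l. is_solution \<Omega> \<D> C\<^sub>\<Omega> \<delta>C b u w l) \<and>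
     (\<forall>b\<in>L2 \<Omega>. \<forall>u w l u' w' l'.
        is_solution \<Omega> \<D> C\<^sub>\<Omega> \<delta>C b u w l \<and> is_solution \<Omega> \<D> C\<^sub>\<Omega> \<delta>C b u' w' l' \<longrightarrow>
        (AE x in lebesgue_on \<Omega>. u x = u' x) \<and> (AE x in lebesgue_on (\<Union>\<D>). w x = w' x) \<and>
        (\<forall>y\<in>W_space \<Omega> \<D>. l y = l' y)) \<and>
     (\<forall>b\<in>L2 \<Omega>. \<forall>\<epsilon>>0. \<exists>\<delta>>0. \<forall>b'\<in>L2 \<Omega>. L2_norm \<Omega> (\<lambda>x. b' x - b x) < \<delta> \<longrightarrow>
        (\<forall>u w l u' w' l'.
          is_solution \<Omega> \<D> C\<^sub>\<Omega> \<delta>C b u w l \<and> is_solution \<Omega> \<D> C\<^sub>\<Omega> \<delta>C b' u' w' l' \<longrightarrow>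
          H1_norm \<Omega> (\<lambda>x. u' x - u x) < \<epsilon> \<and> H1_norm (\<Union>\<D>) (\<lambda>x. w' x - w x) < \<epsilon> \<and>
          Q_norm \<Omega> \<D> (\<lambda>y. l' y - l y) < \<epsilon>))"

end

(*
  The third equation, tested with the H1 inner product against u - w, forces w to be the restriction of u, and
  the second equation then determines the multiplier as the functional y |-> (dC grad u, grad y) on W.
  Substituting it into the first equation leaves a single problem on V for the form
  (C_Omega grad u, grad v)_Omega + (dC grad u, grad v)_{Omega_f}, in which the two tensors add up to C_f on
  the fibers; no extension of functions from the fibers to Omega is needed, only that restriction maps V to W.
  The form is symmetric, and by ellipticity of C_Omega and C_f, Korn's first inequality and Poincare's
  inequality it is coercive on V, so Riesz representation in the complete space V gives the result.

  Both inequalities hold because a function in V extended by zero has a weak gradient on the whole space. This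
  rests on the bound of the integral of a derivative over Omega by the surface integral of the function, which
  is obtained near a boundary point by translating the domain: the symmetric difference of the domain and
  its translate lies in a thin layer around a Lipschitz graph. Korn's inequality then follows by shifting
  difference quotients from one factor to the other.
*)
theory Submission imports Defs begin

section \<open>Spaces of functions with a semi-inner product\<close>

text \<open>A zero trace is known only through \<open>C1\<close> functions that converge in
  \<open>H1\<close> and whose boundary values tend to 0 in \<open>L2\<close> of Hausdorff measure.
  So no exact divergence theorem is required: bounding the integral of a derivative by the boundary
  integral up to some constant suffices. Accordingly, Hausdorff measure is compared with volume from
  one side only, by counting balls over the members of a cover. Elements of the spaces are
  functions, not classes, so the forms are merely semidefinite, and Riesz representation is proved
  for such forms. \<open>wgrad\<close> is a choice fixed only up to null sets; handling it takes the
  fundamental lemma, which rests on density of test functions in \<open>L2\<close>. The constant 2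
  in Korn's inequality comes from the sign of the integral of grad u : (grad u)^T, which on the
  whole space is the integral of the squared divergence. Second derivatives being absent, this is
  proved for difference quotients and then passed to the limit.\<close>

lemma quadratic_nonneg_imp_zero:
  fixes a b :: real
  assumes "\<And>t. 0 \<le> 2 * t * a + t\<^sup>2 * b"
  shows "a = 0"
proof (rule ccontr)
  assume "a \<noteq> 0"
  have b: "0 \<le> b" using assms[of 1] assms[of "-1"] by simp
  \<comment> \<open>At t = -s the polynomial equals -s^2 (b + 2); the summand 1 in the denominator
    covers b = 0.\<close>
  define s where "s = a / (b + 1)"
  have a: "a = s * (b + 1)" using b by (simp add: s_def)
  have "0 \<le> 2 * (- s) * a + (- s)\<^sup>2 * b" by (rule assms)
  also have "\<dots> = - (s\<^sup>2 * (b + 2))"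
    by (simp add: a algebra_simps power2_eq_square)
  also have "\<dots> < 0" using b \<open>a \<noteq> 0\<close> a by simp
  finally show False by simp
qed

text \<open>Definiteness is absent because functions that agree almost everywhere remain different
  elements. The structure is instantiated with \<open>L2\<close>, \<open>H1\<close> and the energy
  form on \<open>V\<close>, which then share Cauchy-Schwarz, the triangle inequality and
  continuity.\<close>

locale form_space =
  fixes S :: "('a \<Rightarrow> 'b::real_vector) set" and B :: "('a \<Rightarrow> 'b) \<Rightarrow> ('a \<Rightarrow> 'b) \<Rightarrow> real"
  assumes zero_in: "(\<lambda>x. 0) \<in> S"
    and add_in: "f \<in> S \<Longrightarrow> g \<in> S \<Longrightarrow> (\<lambda>x. f x + g x) \<in> S"
    and scale_in: "f \<in> S \<Longrightarrow> (\<lambda>x. c *\<^sub>R f x) \<in> S"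
    and form_add: "f \<in> S \<Longrightarrow> g \<in> S \<Longrightarrow> h \<in> S \<Longrightarrow> B (\<lambda>x. f x + g x) h = B f h + B g h"
    and form_scale: "f \<in> S \<Longrightarrow> h \<in> S \<Longrightarrow> B (\<lambda>x. c *\<^sub>R f x) h = c * B f h"
    and form_sym: "f \<in> S \<Longrightarrow> g \<in> S \<Longrightarrow> B f g = B g f"
    and form_nonneg: "f \<in> S \<Longrightarrow> 0 \<le> B f f"
begin

definition nrm :: "('a \<Rightarrow> 'b) \<Rightarrow> real" where
  "nrm f = sqrt (B f f)"

lemma nrm_nonneg: "f \<in> S \<Longrightarrow> 0 \<le> nrm f"
  by (simp add: nrm_def form_nonneg)

lemma nrm_power2: "f \<in> S \<Longrightarrow> (nrm f)\<^sup>2 = B f f"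
  by (simp add: nrm_def form_nonneg)

lemma diff_in: "f \<in> S \<Longrightarrow> g \<in> S \<Longrightarrow> (\<lambda>x. f x - g x) \<in> S"
  using add_in[of f "\<lambda>x. (-1) *\<^sub>R g x"] scale_in[of g "-1"] by simp

lemma form_add_right:
  "f \<in> S \<Longrightarrow> g \<in> S \<Longrightarrow> h \<in> S \<Longrightarrow> B h (\<lambda>x. f x + g x) = B h f + B h g"
  using form_add[of f g h] form_sym[of h] add_in[of f g] by simp

lemma form_scale_right: "f \<in> S \<Longrightarrow> h \<in> S \<Longrightarrow> B h (\<lambda>x. c *\<^sub>R f x) = c * B h f"
  using form_scale[of f h c] form_sym[of h] scale_in[of f c] by simp

lemma form_diff: "f \<in> S \<Longrightarrow> g \<in> S \<Longrightarrow> h \<in> S \<Longrightarrow> B (\<lambda>x. f x - g x) h = B f h - B g h"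
  using form_add[of f "\<lambda>x. (-1) *\<^sub>R g x" h] form_scale[of g h "-1"] scale_in[of g "-1"] by simp

lemma form_diff_right:
  "f \<in> S \<Longrightarrow> g \<in> S \<Longrightarrow> h \<in> S \<Longrightarrow> B h (\<lambda>x. f x - g x) = B h f - B h g"
  using form_diff[of f g h] form_sym[of h] diff_in[of f g] by simp

lemma form_expand:
  assumes "f \<in> S" "g \<in> S"
  shows "B (\<lambda>x. f x + t *\<^sub>R g x) (\<lambda>x. f x + t *\<^sub>R g x) = B f f + 2 * t * B f g + t\<^sup>2 * B g g"
  using assms scale_in[of g t] add_in[of f "\<lambda>x. t *\<^sub>R g x"] form_sym[of f g]
  by (simp add: form_add form_add_right form_scale form_scale_right algebra_simps power2_eq_square)

lemma form_diff_expand: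
  assumes "f \<in> S" "g \<in> S"
  shows "B (\<lambda>x. f x - g x) (\<lambda>x. f x - g x) = B f f - 2 * B f g + B g g"
  using form_expand[OF assms, of "-1"] by simp

lemma form_Cauchy_Schwarz:
  assumes "f \<in> S" "g \<in> S"
  shows "\<bar>B f g\<bar> \<le> nrm f * nrm g"
proof -
  have q: "0 \<le> B f f + 2 * t * B f g + t\<^sup>2 * B g g" for t
    using form_nonneg[OF add_in[OF assms(1) scale_in[OF assms(2), of t]]] form_expand[OF assms] by simp
  have "(B f g)\<^sup>2 \<le> B f f * B g g"
  proof (cases "B g g = 0")
    case True
    have "B f g = 0"
    proof (rule ccontr)
      assume n: "B f g \<noteq> 0"
      \<comment> \<open>For degenerate \<open>g\<close> the polynomial in t is affine, and this t
        gives it the value -1.\<close>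
      show False using q[of "- (B f f + 1) / (2 * B f g)"] True n by (simp add: field_simps)
    qed
    then show ?thesis using True by simp
  next
    case False
    then have p: "B g g > 0" using form_nonneg[OF assms(2)] by simp
    show ?thesis using q[of "- B f g / B g g"] p
      by (simp add: field_simps power2_eq_square)
  qed
  then have "sqrt ((B f g)\<^sup>2) \<le> sqrt (B f f * B g g)" by (rule real_sqrt_le_mono)
  then show ?thesis by (simp add: nrm_def real_sqrt_mult)
qed

lemma nrm_triangle:
  assumes "f \<in> S" "g \<in> S"
  shows "nrm (\<lambda>x. f x + g x) \<le> nrm f + nrm g"
proof (rule power2_le_imp_le)
  have "(nrm (\<lambda>x. f x + g x))\<^sup>2 = B f f + 2 * B f g + B g g"
    using form_expand[OF assms, of 1] add_in[OF assms] by (simp add: nrm_power2)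
  also have "\<dots> \<le> (nrm f + nrm g)\<^sup>2"
    using form_Cauchy_Schwarz[OF assms] assms
    by (simp add: power2_sum nrm_power2)
  finally show "(nrm (\<lambda>x. f x + g x))\<^sup>2 \<le> (nrm f + nrm g)\<^sup>2" .
qed (simp add: nrm_nonneg assms)

lemma nrm_scale: "f \<in> S \<Longrightarrow> nrm (\<lambda>x. c *\<^sub>R f x) = \<bar>c\<bar> * nrm f"
proof -
  assume f: "f \<in> S"
  have "B (\<lambda>x. c *\<^sub>R f x) (\<lambda>x. c *\<^sub>R f x) = c\<^sup>2 * B f f"
    unfolding form_scale[OF f scale_in[OF f]] form_scale_right[OF f f] by (simp add: power2_eq_square)
  then show ?thesis by (simp add: nrm_def real_sqrt_mult)
qed

lemma nrm_minus_commute: "f \<in> S \<Longrightarrow> g \<in> S \<Longrightarrow> nrm (\<lambda>x. f x - g x) = nrm (\<lambda>x. g x - f x)"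
  using nrm_scale[OF diff_in, of f g "-1"] by simp

lemma nrm_triangle_diff:
  assumes "f \<in> S" "g \<in> S" "h \<in> S"
  shows "nrm (\<lambda>x. f x - g x) \<le> nrm (\<lambda>x. f x - h x) + nrm (\<lambda>x. h x - g x)"
  using nrm_triangle[OF diff_in[OF assms(1,3)] diff_in[OF assms(3,2)]] by simp

lemma nrm_reverse_triangle:
  assumes "f \<in> S" "g \<in> S"
  shows "\<bar>nrm f - nrm g\<bar> \<le> nrm (\<lambda>x. f x - g x)"
  using nrm_triangle[OF diff_in[OF assms] assms(2)] nrm_triangle[OF diff_in[OF assms(2,1)] assms(1)]
    nrm_minus_commute[OF assms] by simp

lemma form_tendsto:
  assumes "\<And>n. F n \<in> S" "f \<in> S" "g \<in> S" "(\<lambda>n. nrm (\<lambda>x. F n x - f x)) \<longlonglongrightarrow> 0"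
  shows "(\<lambda>n. B (F n) g) \<longlonglongrightarrow> B f g"
proof -
  have "(\<lambda>n. B (F n) g - B f g) \<longlonglongrightarrow> 0"
  proof (rule Lim_null_comparison)
    show "\<forall>\<^sub>F n in sequentially. norm (B (F n) g - B f g) \<le> nrm (\<lambda>x. F n x - f x) * nrm g"
      using form_Cauchy_Schwarz[OF diff_in[OF assms(1,2)] assms(3)] assms by (simp add: form_diff)
    show "(\<lambda>n. nrm (\<lambda>x. F n x - f x) * nrm g) \<longlonglongrightarrow> 0"
      using tendsto_mult_right[OF assms(4), of "nrm g"] by simp
  qed
  then show ?thesis by (simp add: LIM_zero_iff)
qed

lemma nrm_tendsto:
  assumes "\<And>n. F n \<in> S" "f \<in> S" "(\<lambda>n. nrm (\<lambda>x. F n x - f x)) \<longlonglongrightarrow> 0"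
  shows "(\<lambda>n. nrm (F n)) \<longlonglongrightarrow> nrm f"
proof -
  have "(\<lambda>n. nrm (F n) - nrm f) \<longlonglongrightarrow> 0"
    using nrm_reverse_triangle[OF assms(1,2)] by (intro Lim_null_comparison[OF _ assms(3)]) auto
  then show ?thesis by (simp add: LIM_zero_iff)
qed

text \<open>Riesz representation: the functional is represented by the minimiser of \<open>B v v - 2 * l v\<close>;
  minimising sequences are Cauchy by the parallelogram law.\<close>

lemma riesz_representation:
  assumes complete: "\<And>F. \<lbrakk>\<And>n. F n \<in> S;
        \<And>e. e > 0 \<Longrightarrow> \<exists>N. \<forall>m\<ge>N. \<forall>n\<ge>N. nrm (\<lambda>x. F m x - F n x) < e\<rbrakk> \<Longrightarrow>
        \<exists>f\<in>S. (\<lambda>n. nrm (\<lambda>x. F n x - f x)) \<longlonglongrightarrow> 0"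
    and l_add: "\<And>f g. f \<in> S \<Longrightarrow> g \<in> S \<Longrightarrow> l (\<lambda>x. f x + g x) = l f + l g"
    and l_scale: "\<And>f c. f \<in> S \<Longrightarrow> l (\<lambda>x. c *\<^sub>R f x) = c * l f"
    and l_bound: "\<And>f. f \<in> S \<Longrightarrow> \<bar>l f\<bar> \<le> K * nrm f"
  shows "\<exists>u\<in>S. \<forall>v\<in>S. B u v = l v"
proof -
  define J where "J = (\<lambda>v. B v v - 2 * l v)"
  have J_lower: "- K\<^sup>2 \<le> J v" if "v \<in> S" for v
  proof -
    have "- K\<^sup>2 \<le> (nrm v)\<^sup>2 - 2 * (K * nrm v)"
      using zero_le_power2[of "nrm v - K"] by (simp add: power2_diff algebra_simps)
    also have "\<dots> \<le> J v" using l_bound[OF that] that by (simp add: J_def nrm_power2)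
    finally show ?thesis .
  qed
  have bdd: "bdd_below (J ` S)" using J_lower by (auto intro!: bdd_belowI)
  define m where "m = Inf (J ` S)"
  have m_le: "m \<le> J v" if "v \<in> S" for v
    unfolding m_def using bdd that by (auto intro: cInf_lower)
  have "\<exists>f\<in>S. J f < m + inverse (real (Suc n))" for n
  proof -
    have "m < m + inverse (real (Suc n))" by simp
    then show ?thesis unfolding m_def using zero_in bdd
      by (subst (asm) cInf_less_iff) auto
  qed
  then obtain F where F: "\<And>n. F n \<in> S" and JF: "\<And>n. J (F n) < m + inverse (real (Suc n))"
    by metis
  have l_diff: "l (\<lambda>x. f x - g x) = l f - l g" if "f \<in> S" "g \<in> S" for f g
    using l_add[OF that(1) scale_in[OF that(2), of "-1"]] l_scale[OF that(2), of "-1"] by simp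
  have para: "B (\<lambda>x. f x - g x) (\<lambda>x. f x - g x) \<le> 2 * (J f - m) + 2 * (J g - m)"
    if fg: "f \<in> S" "g \<in> S" for f g
  proof -
    have fg': "(\<lambda>x. f x + g x) \<in> S" by (simp add: add_in fg)
    \<comment> \<open>The midpoint again lies in \<open>S\<close>; its value of \<open>J\<close> is
      the mean of \<open>J f\<close> and \<open>J g\<close> minus a quarter of the squared
      distance.\<close>
    have "m \<le> J (\<lambda>x. (1/2) *\<^sub>R (f x + g x))"
      by (intro m_le scale_in[OF fg'])
    also have "\<dots> = (1/4) * (B f f + 2 * B f g + B g g) - (l f + l g)"
      unfolding J_def l_scale[OF fg'] l_add[OF fg] form_scale[OF fg' scale_in[OF fg']]
        form_scale_right[OF fg' fg'] using form_expand[OF fg, of 1] by (simp add: field_simps)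
    finally show ?thesis
      using form_diff_expand[OF fg] by (simp add: J_def field_simps)
  qed
  have "\<exists>f\<in>S. (\<lambda>n. nrm (\<lambda>x. F n x - f x)) \<longlonglongrightarrow> 0"
  proof (rule complete[OF F])
    fix e :: real assume e: "e > 0"
    obtain N where N: "inverse (real (Suc N)) < e\<^sup>2 / 4"
      using reals_Archimedean[of "e\<^sup>2 / 4"] e by auto
    have "nrm (\<lambda>x. F m x - F n x) < e" if "m \<ge> N" "n \<ge> N" for m n
    proof -
      have le: "inverse (real (Suc k)) \<le> inverse (real (Suc N))" if "k \<ge> N" for k
        using that by (intro le_imp_inverse_le) auto
      have arith: "d < c" if "d \<le> 2 * (a - q) + 2 * (b - q)" "a < q + x" "b < q + y" "x \<le> z" "y \<le> z" "z < c / 4"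
        for a b c d q x y z :: real using that by (simp add: field_simps)
      have "(nrm (\<lambda>x. F m x - F n x))\<^sup>2 < e\<^sup>2"
        unfolding nrm_power2[OF diff_in[OF F F]]
        by (rule arith[OF para[OF F F, of m n] JF[of m] JF[of n] le[OF that(1)] le[OF that(2)] N])
      then show ?thesis using e by (meson less_imp_le power2_less_imp_less)
    qed
    then show "\<exists>N. \<forall>m\<ge>N. \<forall>n\<ge>N. nrm (\<lambda>x. F m x - F n x) < e" by blast
  qed
  then obtain u where u: "u \<in> S" and lim: "(\<lambda>n. nrm (\<lambda>x. F n x - u x)) \<longlonglongrightarrow> 0" by blast
  have "(\<lambda>n. l (F n) - l u) \<longlonglongrightarrow> 0"
  proof (rule Lim_null_comparison)
    show "\<forall>\<^sub>F n in sequentially. norm (l (F n) - l u) \<le> K * nrm (\<lambda>x. F n x - u x)"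
      using l_bound[OF diff_in[OF F u]] by (simp add: l_diff F u)
    show "(\<lambda>n. K * nrm (\<lambda>x. F n x - u x)) \<longlonglongrightarrow> 0"
      using tendsto_mult_left[OF lim, of K] by simp
  qed
  then have l_lim: "(\<lambda>n. l (F n)) \<longlonglongrightarrow> l u" by (simp add: LIM_zero_iff)
  have "(\<lambda>n. (nrm (F n))\<^sup>2 - 2 * l (F n)) \<longlonglongrightarrow> (nrm u)\<^sup>2 - 2 * l u"
    by (intro tendsto_intros nrm_tendsto[OF F u lim] l_lim)
  then have "(\<lambda>n. J (F n)) \<longlonglongrightarrow> J u" by (simp add: J_def nrm_power2 F u)
  moreover have "(\<lambda>n. m + inverse (real (Suc n))) \<longlonglongrightarrow> m + 0"
    by (intro tendsto_intros LIMSEQ_inverse_real_of_nat)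
  ultimately have Ju: "J u \<le> m"
    using JF by (intro LIMSEQ_le[of "\<lambda>n. J (F n)" _ "\<lambda>n. m + inverse (real (Suc n))"])
      (auto intro: less_imp_le)
  have "B u v = l v" if v: "v \<in> S" for v
  proof -
    have "B u v - l v = 0"
    \<comment> \<open>First variation: \<open>u\<close> minimises \<open>J\<close>, and along u + t
      v the increase of \<open>J\<close> is a quadratic polynomial whose linear coefficient is twice
      the defect.\<close>
    proof (rule quadratic_nonneg_imp_zero)
      fix t :: real
      have "J u \<le> J (\<lambda>x. u x + t *\<^sub>R v x)"
        using Ju m_le[OF add_in[OF u scale_in[OF v, of t]]] by simp
      also have "\<dots> = J u + 2 * t * (B u v - l v) + t\<^sup>2 * B v v"
        unfolding J_def form_expand[OF u v] l_add[OF u scale_in[OF v]] l_scale[OF v]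
        by (simp add: algebra_simps)
      finally show "0 \<le> 2 * t * (B u v - l v) + t\<^sup>2 * B v v" by simp
    qed
    then show ?thesis by simp
  qed
  then show ?thesis using u by blast
qed

end

section \<open>The space \<open>L\<^sup>2\<close>\<close>

lemma L2_zero: "(\<lambda>x. 0) \<in> L2 A"
  by (simp add: L2_def)

lemma L2_measurable: "f \<in> L2 A \<Longrightarrow> f \<in> borel_measurable (lebesgue_on A)"
  by (simp add: L2_def)

lemma L2_integrable: "f \<in> L2 A \<Longrightarrow> integrable (lebesgue_on A) (\<lambda>x. (norm (f x))\<^sup>2)"
  by (simp add: L2_def)

lemma norm_add_power2_le:
  fixes a b :: "'b::real_normed_vector"
  shows "(norm (a + b))\<^sup>2 \<le> 2 * (norm a)\<^sup>2 + 2 * (norm b)\<^sup>2"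
proof -
  have "(norm (a + b))\<^sup>2 \<le> (norm a + norm b)\<^sup>2" by (simp add: norm_triangle_ineq power_mono)
  also have "\<dots> \<le> 2 * (norm a)\<^sup>2 + 2 * (norm b)\<^sup>2"
    using zero_le_power2[of "norm a - norm b"] by (simp add: power2_sum power2_diff)
  finally show ?thesis .
qed

lemma L2_bound:
  fixes f :: "real^3 \<Rightarrow> 'b::euclidean_space"
  assumes "f \<in> borel_measurable (lebesgue_on A)" "integrable (lebesgue_on A) g"
    and "\<And>x. x \<in> A \<Longrightarrow> (norm (f x))\<^sup>2 \<le> g x"
  shows "f \<in> L2 A"
proof -
  have "integrable (lebesgue_on A) (\<lambda>x. (norm (f x))\<^sup>2)"
    using assms(1,3) by (intro Bochner_Integration.integrable_bound[OF assms(2)] borel_measurable_power borel_measurable_norm AE_I2) fastforce+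
  then show ?thesis using assms by (simp add: L2_def)
qed

lemma L2_add:
  fixes f g :: "real^3 \<Rightarrow> 'b::euclidean_space"
  assumes "f \<in> L2 A" "g \<in> L2 A"
  shows "(\<lambda>x. f x + g x) \<in> L2 A"
  using assms
  by (intro L2_bound[of _ _ "\<lambda>x. 2 * (norm (f x))\<^sup>2 + 2 * (norm (g x))\<^sup>2"])
    (auto simp: L2_def norm_add_power2_le)

lemma L2_scale:
  fixes f :: "real^3 \<Rightarrow> 'b::euclidean_space"
  shows "f \<in> L2 A \<Longrightarrow> (\<lambda>x. c *\<^sub>R f x) \<in> L2 A"
  by (auto simp: L2_def power_mult_distrib)

lemma L2_inner_integrable:
  fixes f g :: "real^3 \<Rightarrow> 'b::euclidean_space"
  assumes "f \<in> L2 A" "g \<in> L2 A"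
  shows "integrable (lebesgue_on A) (\<lambda>x. f x \<bullet> g x)"
proof (rule Bochner_Integration.integrable_bound)
  show "integrable (lebesgue_on A) (\<lambda>x. (norm (f x))\<^sup>2 + (norm (g x))\<^sup>2)"
    using assms by (simp add: L2_def)
  show "(\<lambda>x. f x \<bullet> g x) \<in> borel_measurable (lebesgue_on A)"
    using assms by (intro borel_measurable_inner L2_measurable)
  have "\<bar>f x \<bullet> g x\<bar> \<le> (norm (f x))\<^sup>2 + (norm (g x))\<^sup>2" for x
  proof -
    have "\<bar>f x \<bullet> g x\<bar> \<le> norm (f x) * norm (g x)" by (rule Cauchy_Schwarz_ineq2)
    moreover have "2 * (norm (f x) * norm (g x)) \<le> (norm (f x))\<^sup>2 + (norm (g x))\<^sup>2"
      using zero_le_power2[of "norm (f x) - norm (g x)"] by (simp add: power2_diff)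
    moreover have "0 \<le> norm (f x) * norm (g x)" by simp
    ultimately show ?thesis by linarith
  qed
  then show "AE x in lebesgue_on A. norm (f x \<bullet> g x) \<le> norm ((norm (f x))\<^sup>2 + (norm (g x))\<^sup>2)"
    by simp
qed

interpretation L2: form_space "L2 A :: (real^3 \<Rightarrow> 'b::euclidean_space) set" "L2_inner A" for A
proof
  show "L2_inner A (\<lambda>x. f x + g x) h = L2_inner A f h + L2_inner A g h"
    if "f \<in> L2 A" "g \<in> L2 A" "h \<in> L2 A" for f g h :: "real^3 \<Rightarrow> 'b"
    using that by (simp add: L2_inner_def inner_add_left L2_inner_integrable)
  show "L2_inner A (\<lambda>x. c *\<^sub>R f x) h = c * L2_inner A f h" for f h :: "real^3 \<Rightarrow> 'b" and c
    by (simp add: L2_inner_def)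
  show "L2_inner A f g = L2_inner A g f" for f g :: "real^3 \<Rightarrow> 'b"
    by (simp add: L2_inner_def inner_commute)
  show "0 \<le> L2_inner A f f" for f :: "real^3 \<Rightarrow> 'b"
    by (simp add: L2_inner_def)
qed (auto intro: L2_add L2_scale L2_zero)

lemma L2_nrm_eq: "L2.nrm A f = L2_norm A f"
  by (simp add: L2.nrm_def L2_norm_def L2_inner_def power2_norm_eq_inner)

lemmas L2_diff = L2.diff_in
lemmas L2_Cauchy_Schwarz = L2.form_Cauchy_Schwarz[unfolded L2_nrm_eq]
lemmas L2_norm_scale = L2.nrm_scale[unfolded L2_nrm_eq]
lemmas L2_norm_power2 = L2.nrm_power2[unfolded L2_nrm_eq]
lemmas L2_inner_tendsto = L2.form_tendsto[unfolded L2_nrm_eq]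
lemmas L2_norm_tendsto = L2.nrm_tendsto[unfolded L2_nrm_eq]

lemma L2_norm_nonneg: "0 \<le> L2_norm A f"
  by (simp add: L2_norm_def)

lemma L2_norm_cong_AE:
  fixes f g :: "real^3 \<Rightarrow> 'b::euclidean_space"
  assumes "f \<in> L2 A" "g \<in> L2 A" "AE x in lebesgue_on A. f x = g x"
  shows "L2_norm A f = L2_norm A g"
proof -
  have "(LINT x|lebesgue_on A. (norm (f x))\<^sup>2) = (LINT x|lebesgue_on A. (norm (g x))\<^sup>2)"
    using assms by (intro integral_cong_AE borel_measurable_power borel_measurable_norm) (auto simp: L2_def)
  then show ?thesis by (simp add: L2_norm_def)
qed

lemma L2_inner_cong_AE:
  fixes f g :: "real^3 \<Rightarrow> 'b::euclidean_space"
  assumes "f \<in> L2 A" "f' \<in> L2 A" "g \<in> L2 A" "g' \<in> L2 A"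
    "AE x in lebesgue_on A. f x = f' x" "AE x in lebesgue_on A. g x = g' x"
  shows "L2_inner A f g = L2_inner A f' g'"
  unfolding L2_inner_def
  using assms by (intro integral_cong_AE borel_measurable_inner) (auto simp: L2_def)

lemma L2_norm_eq_0_AE:
  fixes f :: "real^3 \<Rightarrow> 'b::euclidean_space"
  assumes "f \<in> L2 A" "L2_norm A f = 0"
  shows "AE x in lebesgue_on A. f x = 0"
  using assms integral_nonneg_eq_0_iff_AE[of "lebesgue_on A" "\<lambda>x. (norm (f x))\<^sup>2"]
  by (simp add: L2_def L2_norm_def)

lemma sets_lebesgue_on_subset:
  assumes "A \<in> sets lebesgue" "B \<in> sets lebesgue" "B \<subseteq> A"
  shows "B \<in> sets (lebesgue_on A)" "lebesgue_on B = restrict_space (lebesgue_on A) B"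
  using assms by (auto simp: sets_restrict_space_iff restrict_restrict_space Int_absorb1)

lemma lebesgue_on_integral_indicator:
  fixes f :: "real^3 \<Rightarrow> 'b::{banach,second_countable_topology}"
  assumes "A \<in> sets lebesgue" "B \<in> sets lebesgue" "B \<subseteq> A"
  shows "(LINT x|lebesgue_on B. f x) = (LINT x|lebesgue_on A. indicator B x *\<^sub>R f x)"
    and "integrable (lebesgue_on B) f \<longleftrightarrow> integrable (lebesgue_on A) (\<lambda>x. indicator B x *\<^sub>R f x)"
  using sets_lebesgue_on_subset[OF assms] assms
  by (simp_all add: integral_restrict_space integrable_restrict_space Int_absorb2)

lemma L2_mono:
  fixes f :: "real^3 \<Rightarrow> 'b::euclidean_space"
  assumes "A \<in> sets lebesgue" "B \<in> sets lebesgue" "B \<subseteq> A" "f \<in> L2 A"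
  shows "f \<in> L2 B" "L2_norm B f \<le> L2_norm A f"
proof -
  have "integrable (lebesgue_on A) (\<lambda>x. indicator B x *\<^sub>R (norm (f x))\<^sup>2)"
    using assms by (intro integrable_mult_indicator sets_lebesgue_on_subset) (auto simp: L2_def)
  note int = this
  show "f \<in> L2 B"
    using assms int lebesgue_on_integral_indicator(2)[OF assms(1-3), of "\<lambda>x. (norm (f x))\<^sup>2"]
    by (auto simp: L2_def intro: measurable_restrict_mono)
  have "(LINT x|lebesgue_on B. (norm (f x))\<^sup>2) \<le> (LINT x|lebesgue_on A. (norm (f x))\<^sup>2)"
    unfolding lebesgue_on_integral_indicator(1)[OF assms(1-3)]
    using int assms by (intro integral_mono) (auto simp: L2_def indicator_def)
  then show "L2_norm B f \<le> L2_norm A f" by (simp add: L2_norm_def)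
qed

lemma L2_extend:
  fixes f :: "real^3 \<Rightarrow> 'b::euclidean_space"
  assumes "A \<in> sets lebesgue"
  shows "f \<in> L2 A \<longleftrightarrow> (\<lambda>x. indicator A x *\<^sub>R f x) \<in> L2 UNIV"
    and "L2_norm UNIV (\<lambda>x. indicator A x *\<^sub>R f x) = L2_norm A f"
proof -
  have eq: "(norm (indicator A x *\<^sub>R f x))\<^sup>2 = indicator A x *\<^sub>R (norm (f x))\<^sup>2" for x
    by (simp split: split_indicator)
  show "f \<in> L2 A \<longleftrightarrow> (\<lambda>x. indicator A x *\<^sub>R f x) \<in> L2 UNIV"
    using assms lebesgue_on_integral_indicator(2)[of UNIV A "\<lambda>x. (norm (f x))\<^sup>2"]
    by (simp add: L2_def eq lebesgue_on_UNIV_eq borel_measurable_restrict_space_iff del: norm_scaleR)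
  show "L2_norm UNIV (\<lambda>x. indicator A x *\<^sub>R f x) = L2_norm A f"
    using assms lebesgue_on_integral_indicator(1)[of UNIV A "\<lambda>x. (norm (f x))\<^sup>2"]
    by (simp add: L2_norm_def eq del: norm_scaleR)
qed

lemma L2_component:
  fixes f :: "real^3 \<Rightarrow> 'b::euclidean_space"
  assumes "f \<in> L2 A"
  shows "(\<lambda>x. f x \<bullet> b) \<in> L2 A" "L2_norm A (\<lambda>x. f x \<bullet> b) \<le> norm b * L2_norm A f"
proof -
  have le: "(norm (f x \<bullet> b))\<^sup>2 \<le> (norm b)\<^sup>2 * (norm (f x))\<^sup>2" for x
    using power_mono[OF Cauchy_Schwarz_ineq2[of "f x" b], of 2] by (simp add: power_mult_distrib mult.commute)
  show L2: "(\<lambda>x. f x \<bullet> b) \<in> L2 A"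
    using assms le by (intro L2_bound[of _ _ "\<lambda>x. (norm b)\<^sup>2 * (norm (f x))\<^sup>2"]) (auto simp: L2_def)
  have "(LINT x|lebesgue_on A. (norm (f x \<bullet> b))\<^sup>2) \<le> (LINT x|lebesgue_on A. (norm b)\<^sup>2 * (norm (f x))\<^sup>2)"
    using L2 assms le by (intro integral_mono) (auto simp: L2_def)
  then have "L2_norm A (\<lambda>x. f x \<bullet> b) \<le> sqrt ((norm b)\<^sup>2 * (LINT x|lebesgue_on A. (norm (f x))\<^sup>2))"
    by (simp add: L2_norm_def)
  then show "L2_norm A (\<lambda>x. f x \<bullet> b) \<le> norm b * L2_norm A f"
    by (simp add: L2_norm_def real_sqrt_mult)
qed

section \<open>Continuously differentiable functions\<close>

lemma C1_I:
  assumes "\<And>x. (f has_derivative f' x) (at x)" "\<And>v. continuous_on UNIV (\<lambda>x. f' x v)"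
  shows "C1 f"
proof -
  have "frechet_derivative f (at x) = f' x" for x using assms(1) frechet_derivative_at by metis
  then show ?thesis using assms by (auto simp: C1_def differentiable_def)
qed

lemma C1_has_derivative: "C1 f \<Longrightarrow> (f has_derivative frechet_derivative f (at x)) (at x)"
  using frechet_derivative_works by (auto simp: C1_def)

lemma C1_continuous_deriv: "C1 f \<Longrightarrow> continuous_on UNIV (\<lambda>x. frechet_derivative f (at x) v)"
  by (auto simp: C1_def)

lemma C1_continuous: "C1 f \<Longrightarrow> continuous_on UNIV f"
  by (auto simp: C1_def intro: differentiable_imp_continuous_within continuous_at_imp_continuous_on)

lemma frechet_derivative_eq: "(f has_derivative f') (at x) \<Longrightarrow> frechet_derivative f (at x) = f'"
  using frechet_derivative_at by metis

lemma C1_const: "C1 (\<lambda>x. c)"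
  by (rule C1_I[of _ "\<lambda>x v. 0"]) auto

lemma C1_add:
  assumes "C1 f" "C1 g" shows "C1 (\<lambda>x. f x + g x)"
  by (rule C1_I) (auto intro!: derivative_eq_intros continuous_intros C1_has_derivative C1_continuous_deriv assms)

lemma C1_bounded_linear:
  assumes "C1 f" "bounded_linear T" shows "C1 (\<lambda>x. T (f x))"
proof (rule C1_I)
  show "((\<lambda>x. T (f x)) has_derivative (\<lambda>v. T (frechet_derivative f (at x) v))) (at x)" for x
    by (rule bounded_linear.has_derivative[OF assms(2) C1_has_derivative[OF assms(1)]])
  show "continuous_on UNIV (\<lambda>x. T (frechet_derivative f (at x) v))" for v
    by (rule bounded_linear.continuous_on[OF assms(2) C1_continuous_deriv[OF assms(1)]])
qed

lemma C1_diff: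
  assumes "C1 f" "C1 g" shows "C1 (\<lambda>x. f x - g x)"
  by (rule C1_I) (auto intro!: derivative_eq_intros continuous_intros C1_has_derivative C1_continuous_deriv assms)

lemma
  fixes f g :: "real^3 \<Rightarrow> real"
  assumes "C1 f" "C1 g"
  shows C1_mult: "C1 (\<lambda>x. f x * g x)"
    and frechet_derivative_mult: "frechet_derivative (\<lambda>x. f x * g x) (at x) v =
      f x * frechet_derivative g (at x) v + frechet_derivative f (at x) v * g x"
proof -
  have d: "((\<lambda>x. f x * g x) has_derivative
     (\<lambda>v. f x * frechet_derivative g (at x) v + frechet_derivative f (at x) v * g x)) (at x)" for x
    by (rule has_derivative_mult[OF C1_has_derivative[OF assms(1)] C1_has_derivative[OF assms(2)]])
  show "C1 (\<lambda>x. f x * g x)"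
    by (rule C1_I[OF d]) (intro continuous_intros C1_continuous_deriv C1_continuous assms)
  show "frechet_derivative (\<lambda>x. f x * g x) (at x) v =
      f x * frechet_derivative g (at x) v + frechet_derivative f (at x) v * g x"
    by (simp add: frechet_derivative_eq[OF d])
qed

lemma C1_real_compose:
  fixes f :: "real^3 \<Rightarrow> real"
  assumes "C1 f" "\<And>t. (g has_real_derivative g' t) (at t)" "continuous_on UNIV g'"
  shows "C1 (\<lambda>x. g (f x))"
proof (rule C1_I)
  show "((\<lambda>x. g (f x)) has_derivative (\<lambda>v. g' (f x) * frechet_derivative f (at x) v)) (at x)" for x
    using has_derivative_compose[OF C1_has_derivative[OF assms(1)] assms(2)[unfolded has_field_derivative_def], of x]
    by simp
  show "continuous_on UNIV (\<lambda>x. g' (f x) * frechet_derivative f (at x) v)" for v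
    by (intro continuous_intros C1_continuous_deriv assms continuous_on_compose2[OF assms(3)] C1_continuous) auto
qed

lemma C1_translate:
  fixes f :: "real^3 \<Rightarrow> 'b::real_normed_vector"
  assumes "C1 f"
  shows "C1 (\<lambda>x. f (x + a))"
    and "frechet_derivative (\<lambda>x. f (x + a)) (at x) = frechet_derivative f (at (x + a))"
proof -
  have d: "((\<lambda>x. f (x + a)) has_derivative frechet_derivative f (at (x + a))) (at x)" for x
    by (rule has_derivative_compose[where f="\<lambda>x. x + a" and f'="\<lambda>x. x", OF _ C1_has_derivative[OF assms]])
      (auto intro!: derivative_eq_intros)
  show "C1 (\<lambda>x. f (x + a))"
    by (rule C1_I[OF d], rule continuous_on_compose2[OF C1_continuous_deriv[OF assms]]) (auto intro!: continuous_intros)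
  show "frechet_derivative (\<lambda>x. f (x + a)) (at x) = frechet_derivative f (at (x + a))"
    by (rule frechet_derivative_eq[OF d])
qed

lemma C1_component:
  fixes f :: "real^3 \<Rightarrow> real^'n"
  assumes "C1 f"
  shows "C1 (\<lambda>x. f x $ i)"
    and "frechet_derivative (\<lambda>x. f x $ i) (at x) v = frechet_derivative f (at x) v $ i"
  using C1_bounded_linear[OF assms bounded_linear_vec_nth]
    frechet_derivative_eq[OF bounded_linear.has_derivative[OF bounded_linear_vec_nth C1_has_derivative[OF assms]]]
  by auto

lemma C1_polynomial:
  fixes p :: "real^3 \<Rightarrow> real"
  assumes "real_polynomial_function p"
  shows "C1 p"
  using assms
proof (induction rule: real_polynomial_function.induct)
  case (linear f)
  then show ?case
    by (intro C1_I[of _ "\<lambda>x. f"]) (auto intro: bounded_linear_imp_has_derivative)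
qed (auto intro: C1_const C1_add C1_mult)

text \<open>Squaring removes the corner of the positive part: at 0 the difference quotient is itself
  \<open>max 0 h\<close>, which tends to 0. This supplies a \<open>C1\<close> building block for
  cutoffs.\<close>

lemma pos_part_power2_deriv: "((\<lambda>t::real. (max 0 t)\<^sup>2) has_real_derivative 2 * max 0 t) (at t)"
proof -
  consider "t < 0" | "t > 0" | "t = 0" by linarith
  then show ?thesis
  proof cases
    case 1
    have "((\<lambda>t::real. 0) has_real_derivative 2 * max 0 t) (at t)" using 1 by simp
    then show ?thesis
      by (rule has_field_derivative_transform_within_open[of _ _ _ "{..<0}"]) (use 1 in auto)
  next
    case 2
    have "((\<lambda>t::real. t\<^sup>2) has_real_derivative 2 * max 0 t) (at t)"
      using 2 by (auto intro!: derivative_eq_intros)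
    then show ?thesis
      by (rule has_field_derivative_transform_within_open[of _ _ _ "{0<..}"]) (use 2 in auto)
  next
    case 3
    have "(\<lambda>h::real. max 0 h) \<midarrow>0\<rightarrow> max 0 0" by (intro tendsto_intros)
    moreover have "\<forall>\<^sub>F h in at 0. max 0 h = (max 0 h)\<^sup>2 / (h::real)"
      by (auto simp: max_def power2_eq_square eventually_at_filter)
    ultimately have "(\<lambda>h::real. (max 0 h)\<^sup>2 / h) \<midarrow>0\<rightarrow> 0"
      using Lim_transform_eventually by fastforce
    then show ?thesis using 3 by (simp add: DERIV_def)
  qed
qed

text \<open>The quotient P / (P + Q), where \<open>P\<close> vanishes outside the large ball and
  \<open>Q\<close> on the small one. Both are squared positive parts of expressions in the squared
  distance, and r < R prevents them from vanishing together.\<close>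

lemma C1_cutoff:
  fixes p :: "real^3"
  assumes "0 \<le> r" "r < R"
  obtains \<eta> :: "real^3 \<Rightarrow> real" where "C1 \<eta>" "\<And>x. 0 \<le> \<eta> x" "\<And>x. \<eta> x \<le> 1"
    "\<And>x. x \<in> cball p r \<Longrightarrow> \<eta> x = 1" "\<And>x. x \<notin> cball p R \<Longrightarrow> \<eta> x = 0"
proof -
  define q where "q = (\<lambda>x. (x - p) \<bullet> (x - p))"
  have q: "q x = (dist p x)\<^sup>2" for x
    by (simp add: q_def dist_norm norm_minus_commute power2_norm_eq_inner[symmetric])
  have Cq: "C1 q" unfolding q_def
    by (rule C1_I[of _ "\<lambda>x v. 2 * ((x - p) \<bullet> v)"])
      (auto intro!: derivative_eq_intros continuous_intros simp: inner_commute)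
  define P where "P = (\<lambda>x. (max 0 (R\<^sup>2 - q x))\<^sup>2)"
  define Q where "Q = (\<lambda>x. (max 0 (q x - r\<^sup>2))\<^sup>2)"
  have CP: "C1 P" "C1 Q" unfolding P_def Q_def
    by (intro C1_real_compose[OF _ pos_part_power2_deriv] C1_diff C1_const Cq continuous_intros)+
  have rR: "r\<^sup>2 < R\<^sup>2" using assms by (intro power_strict_mono) auto
  have PQ: "0 < P x + Q x" for x
  proof -
    have "0 < P x \<or> 0 < Q x" unfolding P_def Q_def using rR by auto
    moreover have "0 \<le> P x" "0 \<le> Q x" by (auto simp: P_def Q_def)
    ultimately show ?thesis by linarith
  qed
  have inv: "C1 (\<lambda>x. inverse (P x + Q x))"
  proof (rule C1_I)
    show "((\<lambda>x. inverse (P x + Q x)) has_derivative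
       (\<lambda>v. - (inverse (P x + Q x) * (frechet_derivative P (at x) v + frechet_derivative Q (at x) v) * inverse (P x + Q x)))) (at x)" for x
      using PQ[of x] by (auto intro!: derivative_eq_intros C1_has_derivative CP)
    show "continuous_on UNIV (\<lambda>x. - (inverse (P x + Q x) * (frechet_derivative P (at x) v + frechet_derivative Q (at x) v) * inverse (P x + Q x)))" for v
      using PQ by (intro continuous_intros C1_continuous_deriv CP C1_continuous) (auto simp: less_le)
  qed
  define \<eta> where "\<eta> = (\<lambda>x. P x * inverse (P x + Q x))"
  show ?thesis
  proof
    show "C1 \<eta>" unfolding \<eta>_def by (intro C1_mult CP inv)
    show "0 \<le> \<eta> x" "\<eta> x \<le> 1" for x
      using PQ[of x] by (auto simp: \<eta>_def P_def Q_def divide_simps)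
    show "\<eta> x = 1" if "x \<in> cball p r" for x
    proof -
      have "q x \<le> r\<^sup>2" using that by (simp add: q power_mono)
      then have "Q x = 0" by (simp add: Q_def)
      then show ?thesis using PQ[of x] by (simp add: \<eta>_def)
    qed
    show "\<eta> x = 0" if "x \<notin> cball p R" for x
    proof -
      have "R\<^sup>2 \<le> q x" using that assms by (simp add: q power_mono)
      then show ?thesis by (simp add: \<eta>_def P_def)
    qed
  qed
qed

section \<open>Test functions\<close>

lemma test_function_C1: "test_function A \<psi> \<Longrightarrow> C1 \<psi>"
  by (simp add: test_function_def)

lemma test_function_mono: "test_function A \<psi> \<Longrightarrow> A \<subseteq> B \<Longrightarrow> test_function B \<psi>"
  by (force simp: test_function_def)

lemma test_function_mult:
  assumes "test_function A \<psi>" "C1 f"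
  shows "test_function A (\<lambda>x. f x * \<psi> x)" "test_function A (\<lambda>x. \<psi> x * f x)"
  using assms by (auto simp: test_function_def intro!: C1_mult)

lemma test_function_ball:
  fixes \<eta> :: "real^3 \<Rightarrow> real"
  assumes "C1 \<eta>" "\<And>x. x \<notin> cball p R \<Longrightarrow> \<eta> x = 0" "cball p R \<subseteq> A"
  shows "test_function A \<eta>"
  using assms unfolding test_function_def by (intro conjI exI[of _ "cball p R"]) auto

lemma test_function_translate:
  assumes "test_function UNIV \<psi>"
  shows "test_function UNIV (\<lambda>x. \<psi> (x + a))"
proof -
  obtain K where K: "compact K" "\<And>x. x \<notin> K \<Longrightarrow> \<psi> x = 0"
    using assms by (auto simp: test_function_def)
  have "\<psi> (x + a) = 0" if "x \<notin> (\<lambda>y. y - a) ` K" for x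
  proof -
    have "x + a \<notin> K" using that by (metis add_diff_cancel_right' imageI)
    then show ?thesis by (rule K)
  qed
  then show ?thesis using assms K C1_translate(1)[OF test_function_C1[OF assms]]
    unfolding test_function_def by (intro conjI exI[of _ "(\<lambda>y. y - a) ` K"]) (auto intro!: compact_continuous_image continuous_intros)
qed

lemma compact_support_bounded:
  fixes f :: "real^3 \<Rightarrow> 'b::real_normed_vector"
  assumes "continuous_on UNIV f" "compact K" "\<And>x. x \<notin> K \<Longrightarrow> f x = 0"
  obtains M where "0 \<le> M" "\<And>x. norm (f x) \<le> M"
proof -
  have "compact (f ` K)" using assms by (auto intro!: compact_continuous_image elim: continuous_on_subset)
  then obtain M where M: "\<And>x. x \<in> K \<Longrightarrow> norm (f x) \<le> M"
    by (metis (no_types, opaque_lifting) bounded_iff compact_imp_bounded image_eqI)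
  show ?thesis
    by (rule that[of "max 0 M"]) (use M assms(3) in \<open>fastforce simp: le_max_iff_disj\<close>)+
qed

lemma frechet_derivative_outside_support:
  assumes "C1 f" "closed K" "\<And>x. x \<notin> K \<Longrightarrow> f x = 0" "x \<notin> K"
  shows "frechet_derivative f (at x) v = 0"
proof -
  have "((\<lambda>x. 0) has_derivative (\<lambda>x. 0)) (at x)" by simp
  then have "(f has_derivative (\<lambda>x. 0)) (at x)"
    by (rule has_derivative_transform_within_open[of _ _ _ _ "- K"]) (use assms in auto)
  then show ?thesis by (simp add: frechet_derivative_eq)
qed

lemma continuous_compact_support_L2:
  fixes f :: "real^3 \<Rightarrow> 'b::euclidean_space"
  assumes "continuous_on UNIV f" "compact K" "\<And>x. x \<notin> K \<Longrightarrow> f x = 0"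
  shows "f \<in> L2 UNIV" "integrable lebesgue f"
proof -
  obtain M where M: "\<And>x. norm (f x) \<le> M" using compact_support_bounded[OF assms] by blast
  have m: "f \<in> borel_measurable lebesgue" by (simp add: assms(1) borel_measurable_continuous_onI measurable_completion)
  have K: "K \<in> lmeasurable" using assms(2) by (rule lmeasurable_compact)
  have "integrable lebesgue (\<lambda>x. M\<^sup>2 * indicator K x)" "integrable lebesgue (\<lambda>x. M * indicator K x)"
    using K by (auto intro!: integrable_mult_right integrable_real_indicator simp: fmeasurable_def)
  note i = this
  show "f \<in> L2 UNIV"
    using m i(1) M assms(3)
    by (intro L2_bound[of _ _ "\<lambda>x. M\<^sup>2 * indicator K x"]) (auto simp: lebesgue_on_UNIV_eq indicator_def power_mono)
  have "norm (f x) \<le> norm (M * indicator K x)" for x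
    using M[of x] norm_ge_zero[of "f x"] assms(3)[of x] by (cases "x \<in> K") auto
  then show "integrable lebesgue f"
    by (intro Bochner_Integration.integrable_bound[OF i(2) m]) auto
qed

lemma test_function_L2:
  assumes "test_function UNIV \<psi>"
  shows "\<psi> \<in> L2 UNIV" "(\<lambda>x. frechet_derivative \<psi> (at x) v) \<in> L2 UNIV"
proof -
  obtain K where K: "compact K" "\<And>x. x \<notin> K \<Longrightarrow> \<psi> x = 0" and C: "C1 \<psi>"
    using assms by (auto simp: test_function_def)
  show "\<psi> \<in> L2 UNIV" by (rule continuous_compact_support_L2[OF C1_continuous[OF C] K])
  show "(\<lambda>x. frechet_derivative \<psi> (at x) v) \<in> L2 UNIV"
    by (rule continuous_compact_support_L2[OF C1_continuous_deriv[OF C] K(1)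
          frechet_derivative_outside_support[OF C compact_imp_closed[OF K(1)] K(2)]])
qed

section \<open>Density of test functions\<close>

text \<open>The limit inherits the bound by \<open>h\<close> almost everywhere, so the squared error
  is dominated by 4 |h|^2 and ordinary dominated convergence applies to it.\<close>

lemma L2_dominated_convergence:
  fixes f :: "real^3 \<Rightarrow> 'b::euclidean_space" and h :: "real^3 \<Rightarrow> 'c::euclidean_space"
  assumes "\<And>n. F n \<in> borel_measurable (lebesgue_on A)" "f \<in> borel_measurable (lebesgue_on A)" "h \<in> L2 A"
    and "\<And>n x. norm (F n x) \<le> norm (h x)"
    and "AE x in lebesgue_on A. (\<lambda>n. F n x) \<longlonglongrightarrow> f x"
  shows "\<And>n. F n \<in> L2 A" "f \<in> L2 A" "(\<lambda>n. L2_norm A (\<lambda>x. F n x - f x)) \<longlonglongrightarrow> 0"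
proof -
  have i: "integrable (lebesgue_on A) (\<lambda>x. (norm (h x))\<^sup>2)" using assms(3) by (simp add: L2_def)
  show F: "F n \<in> L2 A" for n
    using assms by (intro L2_bound[OF _ i] power_mono) auto
  have fh: "AE x in lebesgue_on A. norm (f x) \<le> norm (h x)"
    using assms(5) by eventually_elim (rule LIMSEQ_le_const2[OF tendsto_norm], auto intro: assms(4))
  have "integrable (lebesgue_on A) (\<lambda>x. (norm (f x))\<^sup>2)"
    using assms(2) fh by (intro Bochner_Integration.integrable_bound[OF i] borel_measurable_power borel_measurable_norm)
      (auto elim!: eventually_mono intro!: power_mono)
  then show f: "f \<in> L2 A" using assms(2) by (simp add: L2_def)
  have "(\<lambda>n. LINT x|lebesgue_on A. (norm (F n x - f x))\<^sup>2) \<longlonglongrightarrow> (LINT x|lebesgue_on A. (0::real))"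
  proof (rule integral_dominated_convergence[where w="\<lambda>x. 4 * (norm (h x))\<^sup>2"])
    show "AE x in lebesgue_on A. (\<lambda>n. (norm (F n x - f x))\<^sup>2) \<longlonglongrightarrow> 0"
      using assms(5)
    proof eventually_elim
      case (elim x)
      have "(\<lambda>n. (norm (F n x - f x))\<^sup>2) \<longlonglongrightarrow> (norm (f x - f x))\<^sup>2" by (intro tendsto_intros elim)
      then show ?case by simp
    qed
    show "AE x in lebesgue_on A. norm ((norm (F n x - f x))\<^sup>2) \<le> 4 * (norm (h x))\<^sup>2" for n
      using fh
    proof eventually_elim
      case (elim x)
      have "norm (F n x - f x) \<le> 2 * norm (h x)"
        using elim assms(4)[of n x] norm_triangle_ineq4[of "F n x" "f x"] by linarith
      then have "(norm (F n x - f x))\<^sup>2 \<le> (2 * norm (h x))\<^sup>2" by (intro power_mono) auto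
      then show ?case by (simp add: power_mult_distrib)
    qed
    show "integrable (lebesgue_on A) (\<lambda>x. 4 * (norm (h x))\<^sup>2)" using i by simp
    show "(\<lambda>x. (norm (F n x - f x))\<^sup>2) \<in> borel_measurable (lebesgue_on A)" for n
      using assms(1)[of n] assms(2) by measurable
  qed auto
  then show "(\<lambda>n. L2_norm A (\<lambda>x. F n x - f x)) \<longlonglongrightarrow> 0"
    using tendsto_real_sqrt[of _ 0] unfolding L2_norm_def by fastforce
qed

text \<open>A bounded function is \<open>M * \<theta> \<circ> g\<close> with \<open>g\<close> unbounded and \<open>\<theta>\<close> a bounded \<open>C\<^sup>1\<close> function,
  and \<open>g\<close> is an almost everywhere limit of polynomials.\<close>

lemma bounded_measurable_C1_approx:
  fixes f \<eta> :: "real^3 \<Rightarrow> real"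
  assumes f: "f \<in> borel_measurable lebesgue" and M: "\<And>x. \<bar>f x\<bar> < M" and \<eta>: "C1 \<eta>"
  obtains \<psi> where "\<And>n::nat. C1 (\<psi> n)" "\<And>n x. \<bar>\<psi> n x\<bar> \<le> M * \<bar>\<eta> x\<bar>"
    "AE x in lebesgue. (\<lambda>n. \<psi> n x) \<longlonglongrightarrow> f x * \<eta> x"
proof -
  have M0: "M > 0" using M[of 0] by linarith
  \<comment> \<open>A \<open>C1\<close> bijection from the line onto (-1, 1) with inverse y / sqrt
    (1 - y^2). Composing with it restores the uniform bound that polynomial approximation alone
    would lose.\<close>
  define \<theta> where "\<theta> = (\<lambda>t::real. t / sqrt (1 + t\<^sup>2))"
  define \<theta>' where "\<theta>' = (\<lambda>t::real. (sqrt (1 + t\<^sup>2) - t * (t / sqrt (1 + t\<^sup>2))) / (1 + t\<^sup>2))"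
  have pos: "1 + t\<^sup>2 > 0" "1 + t\<^sup>2 \<noteq> 0" for t :: real
    using zero_le_power2[of t] by linarith+
  have \<theta>1: "(\<theta> has_real_derivative \<theta>' t) (at t)" for t
    unfolding \<theta>_def \<theta>'_def using pos[of t] less_imp_le[OF pos(1)[of t]]
    by (auto intro!: derivative_eq_intros simp: power2_eq_square field_simps)
  have \<theta>2: "continuous_on UNIV \<theta>'" unfolding \<theta>'_def
    by (intro continuous_intros) (use pos in auto)
  have \<theta>3: "\<bar>\<theta> t\<bar> \<le> 1" for t
    using real_sqrt_le_mono[of "t\<^sup>2" "1 + t\<^sup>2"] pos[of t] by (simp add: \<theta>_def abs_divide divide_le_eq)
  have \<theta>4: "\<theta> (y / sqrt (1 - y\<^sup>2)) = y" if "\<bar>y\<bar> < 1" for y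
  proof -
    have y: "1 - y\<^sup>2 > 0" using that by (simp add: abs_square_less_1)
    have "1 + (y / sqrt (1 - y\<^sup>2))\<^sup>2 = inverse (1 - y\<^sup>2)"
      using y by (simp add: power_divide field_simps)
    then show ?thesis using y by (simp add: \<theta>_def real_sqrt_inverse)
  qed
  \<comment> \<open>The inverse of \<theta> applied to f / M; the strict bound \<open>M\<close>
    keeps the root positive.\<close>
  define g where "g = (\<lambda>x. (f x / M) / sqrt (1 - (f x / M)\<^sup>2))"
  have \<theta>g: "M * \<theta> (g x) = f x" for x
    using \<theta>4[of "f x / M"] M[of x] M0 by (simp add: g_def)
  have "g \<in> borel_measurable lebesgue" unfolding g_def using f by measurable
  then have "g measurable_on UNIV"
    by (subst measurable_on_iff_borel_measurable) (auto simp: lebesgue_on_UNIV_eq)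
  then obtain N h where N: "negligible N" and h: "\<And>n. continuous_on UNIV (h n)"
    and lim: "\<And>x. x \<notin> N \<Longrightarrow> (\<lambda>n. h n x) \<longlonglongrightarrow> g x"
    by (auto simp: measurable_on_def)
  \<comment> \<open>Stone-Weierstrass on balls growing with n and with error shrinking in n: every
    point lies in all late balls, so the pointwise limit of \<open>h\<close> is kept.\<close>
  have "\<exists>p. real_polynomial_function p \<and> (\<forall>x\<in>cball 0 (real n). \<bar>h n x - p x\<bar> < inverse (real (Suc n)))" for n
  proof -
    obtain p where "real_polynomial_function p" "\<And>x. x \<in> cball 0 (real n) \<Longrightarrow> \<bar>h n x - p x\<bar> < inverse (real (Suc n))"
      by (rule Stone_Weierstrass_real_polynomial_function[of "cball 0 (real n)" "h n" "inverse (real (Suc n))"])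
        (auto intro: continuous_on_subset[OF h])
    then show ?thesis by blast
  qed
  then obtain p where p: "\<And>n. real_polynomial_function (p n)"
    and hp: "\<And>n x. x \<in> cball 0 (real n) \<Longrightarrow> \<bar>h n x - p n x\<bar> < inverse (real (Suc n))"
    by metis
  have plim: "(\<lambda>n. p n x) \<longlonglongrightarrow> g x" if "x \<notin> N" for x
  proof -
    have "(\<lambda>n. h n x - p n x) \<longlonglongrightarrow> 0"
    proof (rule Lim_null_comparison[OF _ LIMSEQ_inverse_real_of_nat])
      obtain k :: nat where "norm x \<le> k" using real_arch_simple by blast
      then show "\<forall>\<^sub>F n in sequentially. norm (h n x - p n x) \<le> inverse (real (Suc n))"
        by (intro eventually_sequentiallyI[of k], unfold real_norm_def, intro less_imp_le hp) auto
    qed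
    from tendsto_diff[OF lim[OF that] this] show ?thesis by simp
  qed
  define \<psi> where "\<psi> = (\<lambda>n x. M * \<theta> (p n x) * \<eta> x)"
  have "AE x in lebesgue. x \<notin> N"
    using N by (intro AE_not_in) (simp add: negligible_iff_null_sets)
  then have "AE x in lebesgue. (\<lambda>n. \<psi> n x) \<longlonglongrightarrow> f x * \<eta> x"
  proof eventually_elim
    case (elim x)
    have "isCont \<theta> (g x)" using \<theta>1 by (rule DERIV_isCont)
    from isCont_tendsto_compose[OF this plim[OF elim]]
    have "(\<lambda>n. M * \<theta> (p n x) * \<eta> x) \<longlonglongrightarrow> M * \<theta> (g x) * \<eta> x" by (intro tendsto_intros)
    then show ?case by (simp add: \<psi>_def \<theta>g)
  qed
  moreover have "C1 (\<psi> n)" for n unfolding \<psi>_def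
    by (intro C1_mult C1_const \<eta> C1_real_compose[OF _ \<theta>1 \<theta>2] C1_polynomial p)
  moreover have "\<bar>\<psi> n x\<bar> \<le> M * \<bar>\<eta> x\<bar>" for n x
    using mult_right_mono[OF mult_left_mono[OF \<theta>3[of "p n x"], of M], of "\<bar>\<eta> x\<bar>"] M0
    by (simp add: \<psi>_def abs_mult)
  ultimately show ?thesis using that by blast
qed

text \<open>Two approximations: first \<open>f\<close> is truncated in value and multiplied by a
  cutoff, then the truncated function is replaced by bounded \<open>C1\<close> functions while the
  same cutoff keeps the support compact and provides the dominating function.\<close>

lemma L2_test_function_dense:
  fixes f :: "real^3 \<Rightarrow> real"
  assumes f: "f \<in> L2 UNIV" and e: "0 < e"
  obtains \<psi> where "test_function UNIV \<psi>" "L2_norm UNIV (\<lambda>x. \<psi> x - f x) < e"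
proof -
  have mf: "f \<in> borel_measurable lebesgue" using f by (simp add: L2_def lebesgue_on_UNIV_eq)
  have "\<exists>\<eta>. C1 \<eta> \<and> (\<forall>x. 0 \<le> \<eta> x \<and> \<eta> x \<le> 1) \<and> (\<forall>x\<in>cball 0 (real k). \<eta> x = (1::real)) \<and>
     (\<forall>x. x \<notin> cball (0::real^3) (real k + 1) \<longrightarrow> \<eta> x = 0)" for k :: nat
    using C1_cutoff[of "real k" "real k + 1" 0] by (smt (verit) of_nat_0_le_iff)
  then obtain \<eta> :: "nat \<Rightarrow> real^3 \<Rightarrow> real" where \<eta>: "\<And>k. C1 (\<eta> k)" "\<And>k x. 0 \<le> \<eta> k x" "\<And>k x. \<eta> k x \<le> 1"
    "\<And>k x. x \<in> cball 0 (real k) \<Longrightarrow> \<eta> k x = 1" "\<And>k x. x \<notin> cball 0 (real k + 1) \<Longrightarrow> \<eta> k x = 0"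
    by metis
  define c where "c = (\<lambda>(k::nat) x. max (- real k) (min (real k) (f x)))"
  have mc: "(\<lambda>x. c k x) \<in> borel_measurable lebesgue" for k unfolding c_def using mf by measurable
  have m\<eta>: "\<eta> k \<in> borel_measurable lebesgue" for k
    by (simp add: C1_continuous[OF \<eta>(1)] borel_measurable_continuous_onI measurable_completion)
  have c_le: "\<bar>c k x * \<eta> k x\<bar> \<le> \<bar>f x\<bar>" for k x
  proof -
    have "\<bar>c k x\<bar> \<le> \<bar>f x\<bar>" by (auto simp: c_def)
    then show ?thesis using mult_mono[of "\<bar>c k x\<bar>" "\<bar>f x\<bar>" "\<bar>\<eta> k x\<bar>" 1] \<eta>(2,3)[of k x] by (simp add: abs_mult)
  qed
  have lim: "(\<lambda>k. c k x * \<eta> k x) \<longlonglongrightarrow> f x" for x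
  proof (rule tendsto_eventually)
    obtain k1 :: nat where k1: "norm x \<le> k1" using real_arch_simple by blast
    obtain k2 :: nat where k2: "\<bar>f x\<bar> \<le> k2" using real_arch_simple by blast
    show "\<forall>\<^sub>F k in sequentially. c k x * \<eta> k x = f x"
    proof (rule eventually_sequentiallyI[of "max k1 k2"])
      fix k assume "max k1 k2 \<le> k"
      then have "norm x \<le> k" "\<bar>f x\<bar> \<le> k" using k1 k2 by auto
      then show "c k x * \<eta> k x = f x" using \<eta>(4)[of x k] by (auto simp: c_def)
    qed
  qed
  have tr: "c k \<in> borel_measurable (lebesgue_on UNIV)" "\<eta> k \<in> borel_measurable (lebesgue_on UNIV)"
    "(\<lambda>x. c k x * \<eta> k x) \<in> borel_measurable (lebesgue_on UNIV)" for k
    using mc m\<eta> by (auto simp: lebesgue_on_UNIV_eq)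
  have L: "(\<lambda>x. c k x * \<eta> k x) \<in> L2 UNIV" "(\<lambda>k. L2_norm UNIV (\<lambda>x. c k x * \<eta> k x - f x)) \<longlonglongrightarrow> 0" for k
    using L2_dominated_convergence[of "\<lambda>k x. c k x * \<eta> k x" UNIV f f] tr f c_le lim
    by (auto simp: L2_measurable)
  then obtain k where k: "L2_norm UNIV (\<lambda>x. c k x * \<eta> k x - f x) < e / 2"
    using order_tendstoD(2)[OF L(2), of "e / 2"] e eventually_happens[of _ sequentially] by fastforce
  \<comment> \<open>The truncation is bounded by k non-strictly, whereas the approximation lemma
    asks for a strict bound.\<close>
  define M where "M = real k + 1"
  obtain \<psi> where \<psi>: "\<And>n::nat. C1 (\<psi> n)" "\<And>n x. \<bar>\<psi> n x\<bar> \<le> M * \<bar>\<eta> k x\<bar>"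
    "AE x in lebesgue. (\<lambda>n. \<psi> n x) \<longlonglongrightarrow> c k x * \<eta> k x"
    by (rule bounded_measurable_C1_approx[OF mc _ \<eta>(1), of k M k]) (auto simp: c_def M_def)
  have t\<eta>: "test_function UNIV (\<lambda>x. M * \<eta> k x)"
    by (rule test_function_mult(1)[OF test_function_ball[where p=0 and R="real k + 1", OF \<eta>(1) \<eta>(5)] C1_const]) auto
  have t: "test_function UNIV (\<psi> n)" for n
  proof (rule test_function_ball[OF \<psi>(1)])
    show "\<psi> n x = 0" if "x \<notin> cball 0 (real k + 1)" for x
      using \<psi>(2)[of n x] \<eta>(5)[OF that] by simp
  qed auto
  have "(\<lambda>n. L2_norm UNIV (\<lambda>x. \<psi> n x - c k x * \<eta> k x)) \<longlonglongrightarrow> 0"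
  proof (rule L2_dominated_convergence(3))
    show "(\<lambda>x. M * \<eta> k x) \<in> L2 UNIV" by (rule test_function_L2[OF t\<eta>])
    show "\<psi> n \<in> borel_measurable (lebesgue_on UNIV)" for n
      by (rule L2_measurable[OF test_function_L2(1)[OF t]])
    show "AE x in lebesgue_on UNIV. (\<lambda>n. \<psi> n x) \<longlonglongrightarrow> c k x * \<eta> k x"
      unfolding lebesgue_on_UNIV_eq by (rule \<psi>(3))
  qed (use \<psi>(2) tr in \<open>auto simp: lebesgue_on_UNIV_eq abs_mult M_def\<close>)
  then obtain n where n: "L2_norm UNIV (\<lambda>x. \<psi> n x - c k x * \<eta> k x) < e / 2"
    using order_tendstoD(2)[of _ 0 sequentially "e / 2"] e eventually_happens[of _ sequentially] by fastforce
  have "L2_norm UNIV (\<lambda>x. \<psi> n x - f x) < e"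
    using L2.nrm_triangle_diff[OF test_function_L2(1)[OF t] f L(1), of n k] k n unfolding L2_nrm_eq by linarith
  then show ?thesis using that t by blast
qed

lemma L2_test_function_seq:
  fixes f :: "real^3 \<Rightarrow> real"
  assumes "f \<in> L2 UNIV"
  obtains \<psi> where "\<And>n. test_function UNIV (\<psi> n)" "(\<lambda>n. L2_norm UNIV (\<lambda>x. \<psi> n x - f x)) \<longlonglongrightarrow> 0"
proof -
  have "\<exists>\<psi>. test_function UNIV \<psi> \<and> L2_norm UNIV (\<lambda>x. \<psi> x - f x) < inverse (real (Suc n))" for n
    using L2_test_function_dense[OF assms, of "inverse (real (Suc n))"]
    by (metis inverse_positive_iff_positive of_nat_0_less_iff zero_less_Suc)
  then obtain \<psi> where \<psi>: "\<And>n. test_function UNIV (\<psi> n)" "\<And>n. L2_norm UNIV (\<lambda>x. \<psi> n x - f x) < inverse (real (Suc n))"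
    by metis
  have "(\<lambda>n. L2_norm UNIV (\<lambda>x. \<psi> n x - f x)) \<longlonglongrightarrow> 0"
    using less_imp_le[OF \<psi>(2)]
    by (intro Lim_null_comparison[OF _ LIMSEQ_inverse_real_of_nat] always_eventually) (simp add: L2_norm_nonneg)
  then show ?thesis using that \<psi> by blast
qed

text \<open>Test functions converging to \<open>f\<close> itself turn the hypothesis into vanishing
  of the inner product of \<open>f\<close> with \<open>f\<close>.\<close>

lemma L2_orthogonal_test_functions:
  fixes f :: "real^3 \<Rightarrow> real"
  assumes "f \<in> L2 UNIV" "\<And>\<psi>. test_function UNIV \<psi> \<Longrightarrow> L2_inner UNIV \<psi> f = 0"
  shows "AE x in lebesgue. f x = 0"
proof -
  obtain \<psi> where \<psi>: "\<And>n. test_function UNIV (\<psi> n)" "(\<lambda>n. L2_norm UNIV (\<lambda>x. \<psi> n x - f x)) \<longlonglongrightarrow> 0"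
    using L2_test_function_seq[OF assms(1)] by blast
  have "(\<lambda>n. L2_inner UNIV (\<psi> n) f) \<longlonglongrightarrow> L2_inner UNIV f f"
    by (rule L2_inner_tendsto[OF test_function_L2(1)[OF \<psi>(1)] assms(1,1) \<psi>(2)])
  then have "L2_inner UNIV f f = 0" by (simp add: assms(2)[OF \<psi>(1)] LIMSEQ_const_iff)
  then have "L2_norm UNIV f = 0" using L2_norm_power2[OF assms(1)] by simp
  from L2_norm_eq_0_AE[OF assms(1) this] show ?thesis by (simp only: lebesgue_on_UNIV_eq)
qed

text \<open>Reduction to the whole space: near a point of \<open>A\<close>, multiplying by a cutoff
  \<eta> supported in \<open>A\<close> makes every test function admissible, so \<eta> f extended by
  zero is orthogonal to all of them. Hence \<open>f\<close> vanishes almost everywhere near each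
  point, and locally negligible sets are negligible.\<close>

lemma fundamental_lemma:
  fixes f :: "real^3 \<Rightarrow> real"
  assumes A: "open A" and f: "f \<in> L2 A"
    and orth: "\<And>\<psi>. test_function A \<psi> \<Longrightarrow> (LINT x|lebesgue_on A. f x * \<psi> x) = 0"
  shows "AE x in lebesgue_on A. f x = 0"
proof -
  have sA: "A \<in> sets lebesgue" using A by auto
  define S where "S = {x \<in> A. f x \<noteq> 0}"
  have "negligible S"
  proof (subst locally_negligible_alt, intro ballI)
    fix p assume p: "p \<in> S"
    then obtain R where R: "R > 0" "cball p R \<subseteq> A" using A open_contains_cball S_def by blast
    obtain \<eta> where \<eta>: "C1 \<eta>" "\<And>x. 0 \<le> \<eta> x" "\<And>x. \<eta> x \<le> (1::real)"
      "\<And>x. x \<in> cball p (R/2) \<Longrightarrow> \<eta> x = 1" "\<And>x. x \<notin> cball p R \<Longrightarrow> \<eta> x = 0"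
      by (rule C1_cutoff[of "R/2" R p]) (use R in auto)
    define F where "F = (\<lambda>x. indicator A x *\<^sub>R (f x * \<eta> x))"
    have "(\<lambda>x. f x * \<eta> x) \<in> L2 A"
    proof (rule L2_bound[OF _ L2_integrable[OF f]])
      have "\<eta> \<in> borel_measurable (lebesgue_on A)"
        by (simp add: C1_continuous[OF \<eta>(1)] borel_measurable_continuous_onI measurable_completion measurable_restrict_space1)
      then show "(\<lambda>x. f x * \<eta> x) \<in> borel_measurable (lebesgue_on A)"
        using L2_measurable[OF f] by measurable
      show "(norm (f x * \<eta> x))\<^sup>2 \<le> (norm (f x))\<^sup>2" for x
        using mult_left_mono[OF \<eta>(3)[of x], of "\<bar>f x\<bar>"] \<eta>(2)[of x] by (intro power_mono) (auto simp: abs_mult)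
    qed
    then have F: "F \<in> L2 UNIV" unfolding F_def by (rule L2_extend(1)[OF sA, THEN iffD1])
    have "AE x in lebesgue. F x = 0"
    proof (rule L2_orthogonal_test_functions[OF F])
      fix \<psi> :: "real^3 \<Rightarrow> real" assume t: "test_function UNIV \<psi>"
      have "test_function A (\<lambda>x. \<eta> x * \<psi> x)"
        by (rule test_function_mult(2)[OF test_function_ball[OF \<eta>(1,5) R(2)] test_function_C1[OF t]])
      from orth[OF this] have "(LINT x|lebesgue. indicator A x *\<^sub>R (f x * (\<eta> x * \<psi> x))) = 0"
        using lebesgue_on_integral_indicator(1)[of UNIV A "\<lambda>x. f x * (\<eta> x * \<psi> x)"] sA
        by (simp add: lebesgue_on_UNIV_eq)
      then show "L2_inner UNIV \<psi> F = 0" by (simp add: L2_inner_def F_def lebesgue_on_UNIV_eq ac_simps)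
    qed
    then have "AE x in lebesgue. x \<notin> S \<inter> ball p (R/2)"
    proof eventually_elim
      case (elim x)
      then show ?case using \<eta>(4)[of x] R by (auto simp: F_def S_def)
    qed
    then obtain N where "\<And>x. x \<in> space lebesgue - N \<Longrightarrow> x \<notin> S \<inter> ball p (R/2)" "N \<in> null_sets lebesgue"
      using AE_E3 by blast
    then have "negligible (S \<inter> ball p (R/2))"
      by (intro negligible_subset[of N "S \<inter> ball p (R/2)"]) (auto simp: negligible_iff_null_sets simp del: mem_ball)
    then show "\<exists>U. openin (top_of_set S) U \<and> p \<in> U \<and> negligible U"
      using p R by (intro exI[of _ "S \<inter> ball p (R/2)"]) auto
  qed
  then have "AE x in lebesgue. x \<notin> S" by (intro AE_not_in) (simp add: negligible_iff_null_sets)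
  then show ?thesis using sA by (auto simp: AE_restrict_space_iff S_def elim: eventually_mono)
qed

section \<open>Translations\<close>

lemma lebesgue_translate:
  fixes a :: "'a::euclidean_space"
  shows "(\<lambda>x. x + a) \<in> lebesgue \<rightarrow>\<^sub>M lebesgue" "distr lebesgue lebesgue (\<lambda>x. x + a) = lebesgue"
proof -
  have T: "(\<lambda>x. a + (\<Sum>j\<in>Basis. (1 * (x \<bullet> j)) *\<^sub>R j)) = (\<lambda>x. x + a)"
    by (simp add: euclidean_representation add.commute)
  show "(\<lambda>x. x + a) \<in> lebesgue \<rightarrow>\<^sub>M lebesgue"
    using lebesgue_affine_measurable[of "\<lambda>_. 1" a] unfolding T by simp
  show "distr lebesgue lebesgue (\<lambda>x. x + a) = lebesgue"
    using lebesgue_affine_euclidean[of "\<lambda>_. 1" a] unfolding T by (simp add: density_1)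
qed

lemma measurable_translate:
  "f \<in> borel_measurable lebesgue \<Longrightarrow> (\<lambda>x. f (x + a)) \<in> borel_measurable lebesgue" for a :: "'a::euclidean_space"
  by (rule measurable_compose[OF lebesgue_translate(1)])

lemma integral_translate:
  fixes f :: "'a::euclidean_space \<Rightarrow> 'b::{banach,second_countable_topology}"
  assumes "f \<in> borel_measurable lebesgue"
  shows "(LINT x|lebesgue. f (x + a)) = (LINT x|lebesgue. f x)"
    and "integrable lebesgue (\<lambda>x. f (x + a)) \<longleftrightarrow> integrable lebesgue f"
  using integral_distr[OF lebesgue_translate(1) assms, of a] integrable_distr_eq[OF lebesgue_translate(1) assms, of a]
  by (simp_all add: lebesgue_translate(2))

lemma L2_translate:
  fixes f :: "real^3 \<Rightarrow> 'b::euclidean_space"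
  assumes "f \<in> L2 UNIV"
  shows "(\<lambda>x. f (x + a)) \<in> L2 UNIV" "L2_norm UNIV (\<lambda>x. f (x + a)) = L2_norm UNIV f"
proof -
  have m: "f \<in> borel_measurable lebesgue" using assms by (simp add: L2_def lebesgue_on_UNIV_eq)
  then have m2: "(\<lambda>x. (norm (f x))\<^sup>2) \<in> borel_measurable lebesgue" by measurable
  show "(\<lambda>x. f (x + a)) \<in> L2 UNIV"
    using assms integral_translate(2)[OF m2] measurable_translate[OF m] by (simp add: L2_def lebesgue_on_UNIV_eq)
  show "L2_norm UNIV (\<lambda>x. f (x + a)) = L2_norm UNIV f"
    using integral_translate(1)[OF m2] by (simp add: L2_norm_def lebesgue_on_UNIV_eq)
qed

lemma L2_inner_translate:
  fixes f g :: "real^3 \<Rightarrow> 'b::euclidean_space"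
  assumes "f \<in> L2 UNIV" "g \<in> L2 UNIV"
  shows "L2_inner UNIV (\<lambda>x. f (x + a)) (\<lambda>x. g (x + a)) = L2_inner UNIV f g"
proof -
  have "(\<lambda>x. f x \<bullet> g x) \<in> borel_measurable lebesgue"
    using L2_inner_integrable[OF assms] by (auto simp only: lebesgue_on_UNIV_eq dest: borel_measurable_integrable)
  then show ?thesis using integral_translate(1)[of "\<lambda>x. f x \<bullet> g x" a]
    by (simp add: L2_inner_def lebesgue_on_UNIV_eq)
qed

section \<open>Differentiating integrals along translations\<close>

lemma C1_line_derivative:
  fixes f :: "real^3 \<Rightarrow> real"
  assumes "C1 f"
  shows "((\<lambda>s. f (x + s *\<^sub>R e)) has_real_derivative frechet_derivative f (at (x + s *\<^sub>R e)) e) (at s)"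
proof -
  have "((\<lambda>s. x + s *\<^sub>R e) has_derivative (\<lambda>h. h *\<^sub>R e)) (at s)"
    by (auto intro!: derivative_eq_intros)
  from has_derivative_compose[OF this C1_has_derivative[OF assms]]
  have d: "((\<lambda>s. f (x + s *\<^sub>R e)) has_derivative (\<lambda>h. frechet_derivative f (at (x + s *\<^sub>R e)) (h *\<^sub>R e))) (at s)" .
  have "frechet_derivative f (at y) (h *\<^sub>R e) = frechet_derivative f (at y) e * h" for y h
    using linear_scale[OF has_derivative_linear[OF C1_has_derivative[OF assms]]] by simp
  then show ?thesis using d by (simp add: has_field_derivative_def)
qed

lemma C1_line_lipschitz:
  fixes f :: "real^3 \<Rightarrow> real"
  assumes "C1 f" "\<And>y. \<bar>frechet_derivative f (at y) e\<bar> \<le> M"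
  shows "\<bar>f (x + s *\<^sub>R e) - f x\<bar> \<le> M * \<bar>s\<bar>"
  using field_differentiable_bound[of UNIV "\<lambda>s. f (x + s *\<^sub>R e)" "\<lambda>s. frechet_derivative f (at (x + s *\<^sub>R e)) e" M s 0]
    C1_line_derivative[OF assms(1)] assms(2) by (auto simp: has_field_derivative_at_within)

lemma test_function_bounds:
  assumes "test_function UNIV \<psi>"
  obtains \<rho> M where "0 \<le> \<rho>" "\<And>x. \<rho> < norm x \<Longrightarrow> \<psi> x = 0" "0 \<le> M" "\<And>x. \<bar>frechet_derivative \<psi> (at x) e\<bar> \<le> M"
proof -
  obtain K where K: "compact K" "\<And>x. x \<notin> K \<Longrightarrow> \<psi> x = 0" and C: "C1 \<psi>"
    using assms by (auto simp: test_function_def)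
  obtain M where "0 \<le> M" "\<And>x. norm (frechet_derivative \<psi> (at x) e) \<le> M"
    using compact_support_bounded[OF C1_continuous_deriv[OF C, of e] K(1)
          frechet_derivative_outside_support[OF C compact_imp_closed[OF K(1)] K(2)]] by blast
  moreover obtain \<rho> where "\<And>x. x \<in> K \<Longrightarrow> norm x \<le> \<rho>" using compact_imp_bounded[OF K(1)] by (auto simp: bounded_iff)
  ultimately show ?thesis using K(2) by (intro that[of "max 0 \<rho>" M]) fastforce+
qed

lemma L2_indicator:
  fixes S :: "(real^3) set"
  assumes "S \<in> lmeasurable"
  shows "(indicator S :: real^3 \<Rightarrow> real) \<in> L2 UNIV"
proof -
  have eq: "(norm (indicator S x :: real))\<^sup>2 = indicator S x" for x by (simp split: split_indicator)
  have "integrable lebesgue (indicator S :: real^3 \<Rightarrow> real)" "S \<in> sets lebesgue"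
    using assms by (auto intro!: integrable_real_indicator simp: fmeasurable_def)
  then show ?thesis unfolding L2_def mem_Collect_eq eq lebesgue_on_UNIV_eq by auto
qed

lemma L2_mult_integrable:
  fixes f g :: "real^3 \<Rightarrow> real"
  assumes "f \<in> L2 A" "g \<in> L2 A"
  shows "integrable (lebesgue_on A) (\<lambda>x. f x * g x)"
  using L2_inner_integrable[OF assms] by simp

lemma L2_mult_integrable_UNIV:
  fixes f g :: "real^3 \<Rightarrow> real"
  assumes "f \<in> L2 UNIV" "g \<in> L2 UNIV"
  shows "integrable lebesgue (\<lambda>x. f x * g x)"
  using L2_mult_integrable[OF assms] by (simp only: lebesgue_on_UNIV_eq)

text \<open>Dominated convergence of the difference quotients, which are bounded by the maximum
  \<open>M\<close> of the directional derivative. As \<open>U\<close> is only square integrable, the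
  dominating function must also be confined to a bounded set.\<close>

lemma L2_translate_test_deriv_0:
  fixes U \<psi> :: "real^3 \<Rightarrow> real"
  assumes U: "U \<in> L2 UNIV" and \<psi>: "test_function UNIV \<psi>"
  shows "((\<lambda>s. LINT x|lebesgue. U x * \<psi> (x + s *\<^sub>R e)) has_real_derivative
      (LINT x|lebesgue. U x * frechet_derivative \<psi> (at x) e)) (at 0)"
proof -
  note C = test_function_C1[OF \<psi>]
  obtain \<rho> M where \<rho>: "0 \<le> \<rho>" "\<And>x. \<rho> < norm x \<Longrightarrow> \<psi> x = 0"
    and M: "0 \<le> M" "\<And>x. \<bar>frechet_derivative \<psi> (at x) e\<bar> \<le> M"
    using test_function_bounds[OF \<psi>] by metis
  note L = test_function_L2[OF \<psi>]
  have int: "integrable lebesgue (\<lambda>x. U x * \<psi> (x + s *\<^sub>R e))" for s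
    by (rule L2_mult_integrable_UNIV[OF U L2_translate(1)[OF L(1)]])
  have "(\<lambda>h. ((LINT x|lebesgue. U x * \<psi> (x + (0 + h) *\<^sub>R e)) - (LINT x|lebesgue. U x * \<psi> (x + 0 *\<^sub>R e))) / h)
      \<midarrow>0\<rightarrow> (LINT x|lebesgue. U x * frechet_derivative \<psi> (at x) e)"
    unfolding tendsto_at_iff_sequentially
  proof (intro allI impI)
    fix X :: "nat \<Rightarrow> real" assume X: "\<forall>i. X i \<in> UNIV - {0}" "X \<longlonglongrightarrow> 0"
    obtain H where H: "\<And>n. \<bar>X n\<bar> \<le> H"
      using convergent_imp_Bseq[of X] X(2) by (auto simp: convergent_def Bseq_def)
    define D where "D = (\<lambda>n x. U x * ((\<psi> (x + X n *\<^sub>R e) - \<psi> x) / X n))"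
    \<comment> \<open>Contains the supports of all translates along the sequence, since the
      convergent \<open>X\<close> is bounded by \<open>H\<close>.\<close>
    define S where "S = cball (0::real^3) (\<rho> + H * norm e)"
    have "(\<lambda>n. LINT x|lebesgue. D n x) \<longlonglongrightarrow> (LINT x|lebesgue. U x * frechet_derivative \<psi> (at x) e)"
    proof (rule integral_dominated_convergence[where w="\<lambda>x. M * \<bar>U x * indicator S x\<bar>"])
      show "(\<lambda>x. U x * frechet_derivative \<psi> (at x) e) \<in> borel_measurable lebesgue"
        by (rule borel_measurable_integrable[OF L2_mult_integrable_UNIV[OF U L(2)]])
      show "D n \<in> borel_measurable lebesgue" for n
      proof -
        have "D n = (\<lambda>x. (U x * \<psi> (x + X n *\<^sub>R e) - U x * \<psi> (x + 0 *\<^sub>R e)) / X n)"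
          by (auto simp: D_def fun_eq_iff field_simps)
        then show ?thesis using borel_measurable_integrable[OF int, of "X n"] borel_measurable_integrable[OF int, of 0]
          by simp
      qed
      have "S \<in> lmeasurable" by (simp add: S_def)
      then show "integrable lebesgue (\<lambda>x. M * \<bar>U x * indicator S x\<bar>)"
        by (intro integrable_mult_right integrable_abs L2_mult_integrable_UNIV U L2_indicator)
      have "(\<lambda>n. D n x) \<longlonglongrightarrow> U x * frechet_derivative \<psi> (at x) e" for x
      proof -
        have "(\<lambda>h. (\<psi> (x + (0 + h) *\<^sub>R e) - \<psi> (x + 0 *\<^sub>R e)) / h) \<midarrow>0\<rightarrow> frechet_derivative \<psi> (at (x + 0 *\<^sub>R e)) e"
          using C1_line_derivative[OF C, of x e 0] unfolding DERIV_def .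
        then have "((\<lambda>h. (\<psi> (x + h *\<^sub>R e) - \<psi> x) / h) \<circ> X) \<longlonglongrightarrow> frechet_derivative \<psi> (at x) e"
          using X unfolding tendsto_at_iff_sequentially by simp
        then show ?thesis unfolding D_def by (intro tendsto_intros) (simp add: o_def)
      qed
      then show "AE x in lebesgue. (\<lambda>n. D n x) \<longlonglongrightarrow> U x * frechet_derivative \<psi> (at x) e" by simp
      have "norm (D n x) \<le> M * \<bar>U x * indicator S x\<bar>" for n x
      proof (cases "x \<in> S")
        case True
        have "\<bar>(\<psi> (x + X n *\<^sub>R e) - \<psi> x) / X n\<bar> \<le> M"
          using C1_line_lipschitz[OF C M(2), of x "X n"] X(1) by (simp add: divide_le_eq)
        then have "\<bar>U x\<bar> * \<bar>(\<psi> (x + X n *\<^sub>R e) - \<psi> x) / X n\<bar> \<le> \<bar>U x\<bar> * M"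
          by (intro mult_left_mono) auto
        then show ?thesis using True by (simp add: D_def abs_mult mult.commute)
      next
        case False
        have "\<bar>X n\<bar> * norm e \<le> H * norm e" by (intro mult_right_mono H) auto
        moreover have "0 \<le> H * norm e" using H[of 0] by (intro mult_nonneg_nonneg) auto
        moreover have "norm x \<le> norm (x + X n *\<^sub>R e) + \<bar>X n\<bar> * norm e"
          using norm_triangle_ineq4[of "x + X n *\<^sub>R e" "X n *\<^sub>R e"] by simp
        ultimately have "\<rho> < norm x" "\<rho> < norm (x + X n *\<^sub>R e)" using False by (auto simp: S_def)
        then show ?thesis using \<rho>(2) M(1) by (simp add: D_def)
      qed
      then show "AE x in lebesgue. norm (D n x) \<le> M * \<bar>U x * indicator S x\<bar>" for n by simp
    qed
    moreover have "(LINT x|lebesgue. D n x) =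
      ((LINT x|lebesgue. U x * \<psi> (x + (0 + X n) *\<^sub>R e)) - (LINT x|lebesgue. U x * \<psi> (x + 0 *\<^sub>R e))) / X n" for n
    proof -
      have "(LINT x|lebesgue. D n x) = (LINT x|lebesgue. (U x * \<psi> (x + X n *\<^sub>R e) - U x * \<psi> (x + 0 *\<^sub>R e)) / X n)"
        by (rule Bochner_Integration.integral_cong) (auto simp: D_def field_simps)
      also have "\<dots> = ((LINT x|lebesgue. U x * \<psi> (x + X n *\<^sub>R e)) - (LINT x|lebesgue. U x * \<psi> (x + 0 *\<^sub>R e))) / X n"
        using int[of "X n"] int[of 0] by simp
      finally show ?thesis by simp
    qed
    ultimately show "((\<lambda>h. ((LINT x|lebesgue. U x * \<psi> (x + (0 + h) *\<^sub>R e)) - (LINT x|lebesgue. U x * \<psi> (x + 0 *\<^sub>R e))) / h) \<circ> X)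
       \<longlonglongrightarrow> (LINT x|lebesgue. U x * frechet_derivative \<psi> (at x) e)"
      by (simp add: o_def)
  qed
  then show ?thesis unfolding DERIV_def .
qed

lemma L2_translate_test_deriv:
  fixes U \<psi> :: "real^3 \<Rightarrow> real"
  assumes U: "U \<in> L2 UNIV" and \<psi>: "test_function UNIV \<psi>"
  shows "((\<lambda>s. LINT x|lebesgue. U x * \<psi> (x + s *\<^sub>R e)) has_real_derivative
      (LINT x|lebesgue. U x * frechet_derivative \<psi> (at (x + s *\<^sub>R e)) e)) (at s)"
proof -
  have "((\<lambda>h. LINT x|lebesgue. U x * \<psi> (x + h *\<^sub>R e + s *\<^sub>R e)) has_real_derivative
      (LINT x|lebesgue. U x * frechet_derivative (\<lambda>x. \<psi> (x + s *\<^sub>R e)) (at x) e)) (at 0)"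
    by (rule L2_translate_test_deriv_0[OF U test_function_translate[OF \<psi>]])
  then have "((\<lambda>h. LINT x|lebesgue. U x * \<psi> (x + (h + s) *\<^sub>R e)) has_real_derivative
      (LINT x|lebesgue. U x * frechet_derivative \<psi> (at (x + s *\<^sub>R e)) e)) (at 0)"
    by (simp add: C1_translate(2)[OF test_function_C1[OF \<psi>]] scaleR_left_distrib add.assoc)
  then show ?thesis using DERIV_shift[of "\<lambda>s. LINT x|lebesgue. U x * \<psi> (x + s *\<^sub>R e)" _ 0 s] by simp
qed

text \<open>The integral of the translated function does not depend on the translation, and its
  derivative at 0 is the integral in question. The indicator of a large ball stands in for the
  constant 1, which is not in \<open>L2\<close>.\<close>

lemma integral_frechet_derivative_test_function:
  assumes "test_function UNIV \<psi>"
  shows "(LINT x|lebesgue. frechet_derivative \<psi> (at x) e) = 0"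
proof -
  note C = test_function_C1[OF assms]
  obtain \<rho> where \<rho>: "0 \<le> \<rho>" "\<And>x. \<rho> < norm x \<Longrightarrow> \<psi> x = 0"
    using test_function_bounds[OF assms] by metis
  define S where "S = cball (0::real^3) (\<rho> + norm e)"
  have zero: "\<psi> (x + s *\<^sub>R e) = 0" if "x \<notin> S" "\<bar>s\<bar> \<le> 1" for x s
  proof (rule \<rho>(2))
    have "norm x \<le> norm (x + s *\<^sub>R e) + \<bar>s\<bar> * norm e"
      using norm_triangle_ineq4[of "x + s *\<^sub>R e" "s *\<^sub>R e"] by simp
    moreover have "\<bar>s\<bar> * norm e \<le> 1 * norm e" using that by (intro mult_right_mono) auto
    ultimately show "\<rho> < norm (x + s *\<^sub>R e)" using that by (simp add: S_def)
  qed
  have d: "((\<lambda>s. LINT x|lebesgue. indicator S x * \<psi> (x + s *\<^sub>R e)) has_real_derivative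
      (LINT x|lebesgue. indicator S x * frechet_derivative \<psi> (at x) e)) (at 0)"
    by (rule L2_translate_test_deriv_0[OF L2_indicator assms]) (simp add: S_def)
  have m: "\<psi> \<in> borel_measurable lebesgue"
    using L2_measurable[OF test_function_L2(1)[OF assms]] by (simp only: lebesgue_on_UNIV_eq)
  \<comment> \<open>For small s the translated support stays inside \<open>S\<close>, so the
    indicator has no effect.\<close>
  have const: "(LINT x|lebesgue. indicator S x * \<psi> (x + s *\<^sub>R e)) = (LINT x|lebesgue. \<psi> x)" if "\<bar>s\<bar> < 1" for s
  proof -
    have "(LINT x|lebesgue. indicator S x * \<psi> (x + s *\<^sub>R e)) = (LINT x|lebesgue. \<psi> (x + s *\<^sub>R e))"
      using zero[of _ s] that by (intro Bochner_Integration.integral_cong) (auto split: split_indicator)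
    then show ?thesis by (simp add: integral_translate(1)[OF m])
  qed
  have "((\<lambda>s::real. LINT x|lebesgue. \<psi> x) has_real_derivative 0) (at 0)" by simp
  then have "((\<lambda>s. LINT x|lebesgue. indicator S x * \<psi> (x + s *\<^sub>R e)) has_real_derivative 0) (at 0)"
    by (rule has_field_derivative_transform_within_open[of _ _ _ "ball 0 1"]) (auto simp: const)
  from DERIV_unique[OF d this] have "(LINT x|lebesgue. indicator S x * frechet_derivative \<psi> (at x) e) = 0" .
  moreover have "frechet_derivative \<psi> (at x) e = 0" if "x \<notin> S" for x
    by (rule frechet_derivative_outside_support[OF C, of S]) (use zero[of _ 0] that in \<open>auto simp: S_def\<close>)
  then have "(LINT x|lebesgue. indicator S x * frechet_derivative \<psi> (at x) e) = (LINT x|lebesgue. frechet_derivative \<psi> (at x) e)"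
    by (intro Bochner_Integration.integral_cong) (auto split: split_indicator)
  ultimately show ?thesis by simp
qed

section \<open>Weak derivatives\<close>

text \<open>One scalar function and one direction: extension by zero and difference quotients act on
  single entries of the gradient, and \<open>has_weak_gradient\<close> is the conjunction of these
  relations over all entries.\<close>

definition weak_deriv :: "(real^3) set \<Rightarrow> real^3 \<Rightarrow> (real^3 \<Rightarrow> real) \<Rightarrow> (real^3 \<Rightarrow> real) \<Rightarrow> bool" where
  "weak_deriv A e f g \<longleftrightarrow> (\<forall>\<phi>. test_function A \<phi> \<longrightarrow>
     (LINT x|lebesgue_on A. f x * frechet_derivative \<phi> (at x) e) = - (LINT x|lebesgue_on A. g x * \<phi> x))"

lemma has_weak_gradient_iff:
  "has_weak_gradient A u G \<longleftrightarrow> (\<forall>i j. weak_deriv A (axis j 1) (\<lambda>x. u x $ i) (\<lambda>x. G x $ i $ j))"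
  by (auto simp: has_weak_gradient_def weak_deriv_def partial_deriv_def)

lemma test_function_L2_on:
  assumes "A \<in> sets lebesgue" "test_function A \<psi>"
  shows "\<psi> \<in> L2 A" "(\<lambda>x. frechet_derivative \<psi> (at x) v) \<in> L2 A"
  using test_function_L2[OF test_function_mono[OF assms(2) subset_UNIV]] L2_mono(1)[OF _ assms(1) subset_UNIV] by auto

lemma L2_real_scale: "f \<in> L2 A \<Longrightarrow> (\<lambda>x. c * f x) \<in> L2 A" for f :: "real^3 \<Rightarrow> real"
  using L2_scale[of f A c] by simp

lemma weak_deriv_add:
  assumes "A \<in> sets lebesgue" "f \<in> L2 A" "g \<in> L2 A" "f' \<in> L2 A" "g' \<in> L2 A"
    "weak_deriv A e f g" "weak_deriv A e f' g'"
  shows "weak_deriv A e (\<lambda>x. f x + f' x) (\<lambda>x. g x + g' x)"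
  using assms test_function_L2_on[OF assms(1)]
  by (auto simp: weak_deriv_def distrib_right L2_mult_integrable)

lemma weak_deriv_scale:
  "weak_deriv A e f g \<Longrightarrow> weak_deriv A e (\<lambda>x. c * f x) (\<lambda>x. c * g x)"
  by (auto simp: weak_deriv_def mult.assoc)

lemma integral_lebesgue_on_test:
  fixes f :: "real^3 \<Rightarrow> real"
  assumes "A \<in> sets lebesgue" "\<And>x. x \<notin> A \<Longrightarrow> f x = 0"
  shows "(LINT x|lebesgue_on A. f x) = (LINT x|lebesgue. f x)"
proof -
  have "(LINT x|lebesgue_on A. f x) = (LINT x|lebesgue_on UNIV. indicator A x *\<^sub>R f x)"
    by (rule lebesgue_on_integral_indicator(1)) (use assms in auto)
  also have "\<dots> = (LINT x|lebesgue. f x)" unfolding lebesgue_on_UNIV_eq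
    using assms(2) by (intro Bochner_Integration.integral_cong) (auto split: split_indicator)
  finally show ?thesis .
qed

lemma weak_deriv_mono:
  assumes "open A" "open B" "B \<subseteq> A" "weak_deriv A e f g"
  shows "weak_deriv B e f g"
  unfolding weak_deriv_def
proof (intro allI impI)
  fix \<phi> assume t: "test_function B \<phi>"
  note tA = test_function_mono[OF t assms(3)]
  obtain K where K: "compact K" "K \<subseteq> B" "\<And>x. x \<notin> K \<Longrightarrow> \<phi> x = 0" using t by (auto simp: test_function_def)
  have z: "\<phi> x = 0" "frechet_derivative \<phi> (at x) e = 0" if "x \<notin> B" for x
    using frechet_derivative_outside_support[OF test_function_C1[OF t] compact_imp_closed[OF K(1)] K(3)] K(2,3) that by auto
  have s: "A \<in> sets lebesgue" "B \<in> sets lebesgue" using assms by auto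
  have "(LINT x|lebesgue_on A. f x * frechet_derivative \<phi> (at x) e) = - (LINT x|lebesgue_on A. g x * \<phi> x)"
    using assms(4) tA by (simp add: weak_deriv_def)
  moreover have "(LINT x|lebesgue_on A. h x) = (LINT x|lebesgue_on B. h x)"
    if "\<And>x. x \<notin> B \<Longrightarrow> h x = 0" for h :: "real^3 \<Rightarrow> real"
    using integral_lebesgue_on_test[OF s(1), of h] integral_lebesgue_on_test[OF s(2), of h] that assms(3) by auto
  ultimately show "(LINT x|lebesgue_on B. f x * frechet_derivative \<phi> (at x) e) = - (LINT x|lebesgue_on B. g x * \<phi> x)"
    using z by simp
qed

lemma weak_deriv_unique:
  assumes "open A" "f \<in> L2 A" "g \<in> L2 A" "g' \<in> L2 A" "weak_deriv A e f g" "weak_deriv A e f g'"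
  shows "AE x in lebesgue_on A. g x = g' x"
proof -
  have sA: "A \<in> sets lebesgue" using assms(1) by auto
  have "AE x in lebesgue_on A. g x - g' x = 0"
  proof (rule fundamental_lemma[OF assms(1) L2_diff[OF assms(3,4)]])
    fix \<psi> assume "test_function A \<psi>"
    then show "(LINT x|lebesgue_on A. (g x - g' x) * \<psi> x) = 0"
      using assms test_function_L2_on[OF sA] by (auto simp: weak_deriv_def left_diff_distrib L2_mult_integrable)
  qed
  then show ?thesis by eventually_elim simp
qed

text \<open>The product rule, together with the vanishing integral of the derivative of the
  compactly supported product f \<phi>. Growth of \<open>f\<close> is harmless because \<phi> cuts
  it off.\<close>

lemma weak_deriv_C1:
  assumes "open A" "C1 f"
  shows "weak_deriv A e f (\<lambda>x. frechet_derivative f (at x) e)"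
  unfolding weak_deriv_def
proof (intro allI impI)
  fix \<phi> assume t: "test_function A \<phi>"
  have sA: "A \<in> sets lebesgue" using assms by auto
  note Cf = assms(2) and C\<phi> = test_function_C1[OF t]
  obtain K where K: "compact K" "K \<subseteq> A" "\<And>x. x \<notin> K \<Longrightarrow> \<phi> x = 0" using t by (auto simp: test_function_def)
  have zK: "\<phi> x = 0" "frechet_derivative \<phi> (at x) e = 0" if "x \<notin> K" for x
    using frechet_derivative_outside_support[OF C\<phi> compact_imp_closed[OF K(1)] K(3)] K(3) that by auto
  have tf: "test_function UNIV (\<lambda>x. f x * \<phi> x)"
    by (rule test_function_mult(1)[OF test_function_mono[OF t] Cf]) auto
  have i1: "integrable lebesgue (\<lambda>x. f x * frechet_derivative \<phi> (at x) e)"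
    by (rule continuous_compact_support_L2(2)[OF _ K(1)])
      (intro continuous_on_mult C1_continuous C1_continuous_deriv Cf C\<phi>, simp add: zK)
  have i2: "integrable lebesgue (\<lambda>x. frechet_derivative f (at x) e * \<phi> x)"
    by (rule continuous_compact_support_L2(2)[OF _ K(1)])
      (intro continuous_on_mult C1_continuous C1_continuous_deriv Cf C\<phi>, simp add: zK)
  have "(LINT x|lebesgue. f x * frechet_derivative \<phi> (at x) e + frechet_derivative f (at x) e * \<phi> x) = 0"
    using integral_frechet_derivative_test_function[OF tf, of e] by (simp add: frechet_derivative_mult[OF Cf C\<phi>])
  then have "(LINT x|lebesgue. f x * frechet_derivative \<phi> (at x) e) = - (LINT x|lebesgue. frechet_derivative f (at x) e * \<phi> x)"
    using i1 i2 by simp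
  moreover have "(LINT x|lebesgue_on A. h x) = (LINT x|lebesgue. h x)"
    if "\<And>x. x \<notin> K \<Longrightarrow> h x = 0" for h :: "real^3 \<Rightarrow> real"
    using integral_lebesgue_on_test[OF sA, of h] that K(2) by auto
  ultimately show "(LINT x|lebesgue_on A. f x * frechet_derivative \<phi> (at x) e)
      = - (LINT x|lebesgue_on A. frechet_derivative f (at x) e * \<phi> x)"
    by (simp add: zK)
qed

lemma norm_axis_axis: "norm (axis i x :: 'a::real_inner^'n::finite) = norm x"
  by (simp add: norm_eq_sqrt_inner inner_axis_axis)

lemma L2_vec_component:
  fixes u :: "real^3 \<Rightarrow> real^3"
  assumes "u \<in> L2 A"
  shows "(\<lambda>x. u x $ i) \<in> L2 A" "L2_norm A (\<lambda>x. u x $ i) \<le> L2_norm A u"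
  using L2_component[OF assms, of "axis i 1"] by (simp_all add: inner_axis norm_axis_axis)

lemma L2_mat_component:
  fixes G :: "real^3 \<Rightarrow> real^3^3"
  assumes "G \<in> L2 A"
  shows "(\<lambda>x. G x $ i $ j) \<in> L2 A" "L2_norm A (\<lambda>x. G x $ i $ j) \<le> L2_norm A G"
  using L2_component[OF assms, of "axis i (axis j 1)"] by (simp_all add: inner_axis norm_axis_axis)

section \<open>The space \<open>H\<^sup>1\<close>\<close>

lemma H1_L2: "u \<in> H1 A \<Longrightarrow> u \<in> L2 A"
  by (simp add: H1_def)

lemma wgrad:
  assumes "u \<in> H1 A"
  shows wgrad_L2: "wgrad A u \<in> L2 A" and wgrad_weak: "has_weak_gradient A u (wgrad A u)"
proof -
  have "\<exists>G. G \<in> L2 A \<and> has_weak_gradient A u G" using assms by (auto simp: H1_def)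
  from someI_ex[OF this] show "wgrad A u \<in> L2 A" "has_weak_gradient A u (wgrad A u)"
    by (simp_all add: wgrad_def)
qed

lemma H1_I: "u \<in> L2 A \<Longrightarrow> G \<in> L2 A \<Longrightarrow> has_weak_gradient A u G \<Longrightarrow> u \<in> H1 A"
  by (auto simp: H1_def)

text \<open>\<open>wgrad\<close> is an arbitrary choice; computations with it identify it almost
  everywhere with an explicitly known gradient through this lemma.\<close>

lemma wgrad_unique:
  assumes "open A" "u \<in> L2 A" "G \<in> L2 A" "has_weak_gradient A u G"
  shows "AE x in lebesgue_on A. wgrad A u x = G x"
proof -
  have u: "u \<in> H1 A" using assms H1_I by blast
  have "AE x in lebesgue_on A. \<forall>i\<in>UNIV. \<forall>j\<in>UNIV. wgrad A u x $ i $ j = G x $ i $ j"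
    using wgrad_weak[OF u] assms(4) unfolding has_weak_gradient_iff
    by (intro AE_finite_allI weak_deriv_unique[OF assms(1) L2_vec_component(1)[OF assms(2)]] L2_mat_component(1) wgrad_L2 u assms(3)) auto
  then show ?thesis by eventually_elim (simp add: vec_eq_iff)
qed

lemma has_weak_gradient_add:
  assumes "A \<in> sets lebesgue" "u \<in> L2 A" "G \<in> L2 A" "v \<in> L2 A" "H \<in> L2 A"
    "has_weak_gradient A u G" "has_weak_gradient A v H"
  shows "has_weak_gradient A (\<lambda>x. u x + v x) (\<lambda>x. G x + H x)"
  using assms weak_deriv_add[OF assms(1) L2_vec_component(1)[OF assms(2)] L2_mat_component(1)[OF assms(3)]
       L2_vec_component(1)[OF assms(4)] L2_mat_component(1)[OF assms(5)]]
  by (simp add: has_weak_gradient_iff)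

lemma has_weak_gradient_scale:
  "has_weak_gradient A u G \<Longrightarrow> has_weak_gradient A (\<lambda>x. c *\<^sub>R u x) (\<lambda>x. c *\<^sub>R G x)"
  by (simp add: has_weak_gradient_iff weak_deriv_scale)

lemma has_weak_gradient_mono:
  "open A \<Longrightarrow> open B \<Longrightarrow> B \<subseteq> A \<Longrightarrow> has_weak_gradient A u G \<Longrightarrow> has_weak_gradient B u G"
  using weak_deriv_mono by (auto simp: has_weak_gradient_iff)

lemma
  assumes "open A" "u \<in> H1 A" "v \<in> H1 A"
  shows H1_add: "(\<lambda>x. u x + v x) \<in> H1 A"
    and wgrad_add: "AE x in lebesgue_on A. wgrad A (\<lambda>x. u x + v x) x = wgrad A u x + wgrad A v x"
proof -
  have sA: "A \<in> sets lebesgue" using assms(1) by auto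
  note L = H1_L2[OF assms(2)] wgrad_L2[OF assms(2)] H1_L2[OF assms(3)] wgrad_L2[OF assms(3)]
  note w = has_weak_gradient_add[OF sA L wgrad_weak[OF assms(2)] wgrad_weak[OF assms(3)]]
  show "(\<lambda>x. u x + v x) \<in> H1 A" by (rule H1_I[OF L2_add[OF L(1,3)] L2_add[OF L(2,4)] w])
  show "AE x in lebesgue_on A. wgrad A (\<lambda>x. u x + v x) x = wgrad A u x + wgrad A v x"
    by (rule wgrad_unique[OF assms(1) L2_add[OF L(1,3)] L2_add[OF L(2,4)] w])
qed

lemma
  assumes "open A" "u \<in> H1 A"
  shows H1_scale: "(\<lambda>x. c *\<^sub>R u x) \<in> H1 A"
    and wgrad_scale: "AE x in lebesgue_on A. wgrad A (\<lambda>x. c *\<^sub>R u x) x = c *\<^sub>R wgrad A u x"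
proof -
  note L = L2_scale[OF H1_L2[OF assms(2)], of c] L2_scale[OF wgrad_L2[OF assms(2)], of c]
  note w = has_weak_gradient_scale[OF wgrad_weak[OF assms(2)], of c]
  show "(\<lambda>x. c *\<^sub>R u x) \<in> H1 A" by (rule H1_I[OF L w])
  show "AE x in lebesgue_on A. wgrad A (\<lambda>x. c *\<^sub>R u x) x = c *\<^sub>R wgrad A u x"
    by (rule wgrad_unique[OF assms(1) L w])
qed

lemma
  assumes "open A" "open B" "B \<subseteq> A" "u \<in> H1 A"
  shows H1_mono: "u \<in> H1 B"
    and wgrad_mono: "AE x in lebesgue_on B. wgrad B u x = wgrad A u x"
proof -
  have s: "A \<in> sets lebesgue" "B \<in> sets lebesgue" using assms by auto
  note L = L2_mono(1)[OF s assms(3) H1_L2[OF assms(4)]] L2_mono(1)[OF s assms(3) wgrad_L2[OF assms(4)]]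
  note w = has_weak_gradient_mono[OF assms(1-3) wgrad_weak[OF assms(4)]]
  show "u \<in> H1 B" by (rule H1_I[OF L w])
  show "AE x in lebesgue_on B. wgrad B u x = wgrad A u x" by (rule wgrad_unique[OF assms(2) L w])
qed

definition H1_inner :: "(real^3) set \<Rightarrow> (real^3 \<Rightarrow> real^3) \<Rightarrow> (real^3 \<Rightarrow> real^3) \<Rightarrow> real" where
  "H1_inner A u v = L2_inner A u v + L2_inner A (wgrad A u) (wgrad A v)"

lemma H1_zero: "(\<lambda>x. 0) \<in> H1 A"
  by (rule H1_I[of _ _ "\<lambda>x. 0"]) (auto simp: L2_zero has_weak_gradient_def)

lemma wgrad_add_L2:
  assumes "open A" "u \<in> H1 A" "v \<in> H1 A" "G \<in> L2 A"
  shows "L2_inner A (wgrad A (\<lambda>x. u x + v x)) G = L2_inner A (wgrad A u) G + L2_inner A (wgrad A v) G"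
  using L2_inner_cong_AE[OF wgrad_L2[OF H1_add[OF assms(1-3)]] L2_add[OF wgrad_L2[OF assms(2)] wgrad_L2[OF assms(3)]] assms(4,4) wgrad_add[OF assms(1-3)]]
  by (simp add: L2.form_add wgrad_L2 assms)

lemma wgrad_scale_L2:
  assumes "open A" "u \<in> H1 A" "G \<in> L2 A"
  shows "L2_inner A (wgrad A (\<lambda>x. c *\<^sub>R u x)) G = c * L2_inner A (wgrad A u) G"
  using L2_inner_cong_AE[OF wgrad_L2[OF H1_scale[OF assms(1,2)]] L2_scale[OF wgrad_L2[OF assms(2)]] assms(3,3) wgrad_scale[OF assms(1,2)]]
  by (simp add: L2.form_scale wgrad_L2 assms)

text \<open>Linearity of \<open>wgrad\<close> comes from uniqueness of weak derivatives, hence from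
  openness; the structure is therefore a conditional fact, interpreted inside proofs.\<close>

lemma H1_form_space: "open A \<Longrightarrow> form_space (H1 A) (H1_inner A)"
proof
  assume A: "open A"
  show "(\<lambda>x. f x + g x) \<in> H1 A" if "f \<in> H1 A" "g \<in> H1 A" for f g by (rule H1_add[OF A that])
  show "(\<lambda>x. c *\<^sub>R f x) \<in> H1 A" if "f \<in> H1 A" for f c by (rule H1_scale[OF A that])
  show "H1_inner A (\<lambda>x. f x + g x) h = H1_inner A f h + H1_inner A g h"
    if "f \<in> H1 A" "g \<in> H1 A" "h \<in> H1 A" for f g h
    using that wgrad_add_L2[OF A that(1,2) wgrad_L2[OF that(3)]] by (simp add: H1_inner_def L2.form_add H1_L2)
  show "H1_inner A (\<lambda>x. c *\<^sub>R f x) h = c * H1_inner A f h" if "f \<in> H1 A" "h \<in> H1 A" for f h c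
    using that wgrad_scale_L2[OF A that(1) wgrad_L2[OF that(2)]] by (simp add: H1_inner_def L2.form_scale H1_L2 distrib_left)
  show "H1_inner A f g = H1_inner A g f" for f g
    by (simp add: H1_inner_def L2_inner_def inner_commute)
  show "0 \<le> H1_inner A f f" for f
    by (simp add: H1_inner_def L2_inner_def)
qed (rule H1_zero)

lemma H1_norm_eq: "open A \<Longrightarrow> form_space.nrm (H1_inner A) u = H1_norm A u"
  by (simp add: form_space.nrm_def[OF H1_form_space] H1_norm_def H1_inner_def L2_norm_def L2_inner_def power2_norm_eq_inner)

lemma H1_norm_nonneg: "0 \<le> H1_norm A u"
  by (simp add: H1_norm_def)

lemma H1_norm_power2: "(H1_norm A u)\<^sup>2 = (L2_norm A u)\<^sup>2 + (L2_norm A (wgrad A u))\<^sup>2"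
  by (simp add: H1_norm_def)

lemma H1_norm_ge: "L2_norm A u \<le> H1_norm A u" "L2_norm A (wgrad A u) \<le> H1_norm A u"
  by (rule power2_le_imp_le; simp add: H1_norm_power2 H1_norm_nonneg)+

lemma H1_norm_le: "H1_norm A u \<le> L2_norm A u + L2_norm A (wgrad A u)"
  by (rule power2_le_imp_le) (auto simp: H1_norm_power2 power2_sum L2_norm_nonneg)

lemma H1_norm_mono:
  assumes "open A" "open B" "B \<subseteq> A" "u \<in> H1 A"
  shows "H1_norm B u \<le> H1_norm A u"
proof -
  have s: "A \<in> sets lebesgue" "B \<in> sets lebesgue" using assms by auto
  have "L2_norm B (wgrad B u) = L2_norm B (wgrad A u)"
    by (rule L2_norm_cong_AE[OF wgrad_L2[OF H1_mono[OF assms]] L2_mono(1)[OF s assms(3) wgrad_L2[OF assms(4)]] wgrad_mono[OF assms]])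
  then have "(H1_norm B u)\<^sup>2 \<le> (H1_norm A u)\<^sup>2"
    unfolding H1_norm_power2
    using L2_mono(2)[OF s assms(3) H1_L2[OF assms(4)]] L2_mono(2)[OF s assms(3) wgrad_L2[OF assms(4)]]
    by (intro add_mono power_mono) (auto simp: L2_norm_nonneg)
  then show ?thesis by (rule power2_le_imp_le) (rule H1_norm_nonneg)
qed

lemma continuous_bounded_L2:
  fixes f :: "real^3 \<Rightarrow> 'b::euclidean_space"
  assumes "continuous_on UNIV f" "bounded A" "A \<in> sets lebesgue"
  shows "f \<in> L2 A"
proof -
  have "compact (f ` closure A)"
    using assms by (intro compact_continuous_image) (auto elim: continuous_on_subset simp: compact_closure)
  then obtain M where "\<forall>y\<in>f ` closure A. norm y \<le> M" using compact_imp_bounded bounded_iff by metis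
  then have M: "norm (f x) \<le> M" if "x \<in> A" for x using that closure_subset[of A] by blast
  have A: "A \<in> lmeasurable" using assms bounded_set_imp_lmeasurable by blast
  have "f \<in> borel_measurable lebesgue" by (simp add: assms(1) borel_measurable_continuous_onI measurable_completion)
  then have m: "f \<in> borel_measurable (lebesgue_on A)" by (rule measurable_restrict_space1)
  have "finite_measure (lebesgue_on A)" using A by (rule finite_measure_lebesgue_on)
  then have "integrable (lebesgue_on A) (\<lambda>x. M\<^sup>2)" by (rule finite_measure.integrable_const)
  then show ?thesis using M by (intro L2_bound[OF m]) (auto intro: power_mono)
qed

lemma C1_H1:
  fixes f :: "real^3 \<Rightarrow> real^3"
  assumes "C1 f" "bounded A" "open A"
  shows "f \<in> H1 A"
proof (rule H1_I)
  have sA: "A \<in> sets lebesgue" using assms by auto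
  show "f \<in> L2 A" by (rule continuous_bounded_L2[OF C1_continuous[OF assms(1)] assms(2) sA])
  show "(\<lambda>x. \<chi> i j. frechet_derivative f (at x) (axis j 1) $ i) \<in> L2 A"
    by (intro continuous_bounded_L2[OF _ assms(2) sA] continuous_on_vec_lambda continuous_on_component C1_continuous_deriv assms(1))
  show "has_weak_gradient A f (\<lambda>x. \<chi> i j. frechet_derivative f (at x) (axis j 1) $ i)"
    using weak_deriv_C1[OF assms(3) C1_component(1)[OF assms(1)]] C1_component(2)[OF assms(1)]
    by (simp add: has_weak_gradient_iff)
qed

section \<open>Surface measure\<close>

subsection \<open>Metric outer measures\<close>

lemma ennreal_suminf_tail_tendsto_0:
  fixes f :: "nat \<Rightarrow> ennreal"
  assumes "(\<Sum>k. f k) \<noteq> top"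
  shows "(\<lambda>n. \<Sum>k. f (k + n)) \<longlonglongrightarrow> 0"
proof -
  have fin: "f k \<noteq> top" for k
    using assms ennreal_suminf_lessD[of f top k] by (auto simp: less_top)
  define r where "r = (\<lambda>k. enn2real (f k))"
  have f: "f k = ennreal (r k)" for k using fin[of k] by (simp add: r_def less_top)
  have r0: "0 \<le> r k" for k by (simp add: r_def)
  have sum: "summable r" using assms r0 unfolding f by (intro summable_suminf_not_top) auto
  have "(\<lambda>n. ennreal (\<Sum>k. r (k + n))) \<longlonglongrightarrow> ennreal 0"
    by (intro tendsto_ennrealI suminf_exist_split2 sum)
  moreover have "(\<Sum>k. f (k + n)) = ennreal (\<Sum>k. r (k + n))" for n
    unfolding f using sum r0 by (intro suminf_ennreal2) (auto simp: summable_iff_shift)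
  ultimately show ?thesis by simp
qed

text \<open>Caratheodory's criterion: the part of \<open>X\<close> close to but outside \<open>F\<close> splits into annuli, every
  second of which are at positive distance from each other.\<close>

lemma metric_outer_measure_closed:
  fixes f :: "'a::metric_space set \<Rightarrow> ennreal"
  assumes empty: "f {} = 0" and mono: "\<And>A B. A \<subseteq> B \<Longrightarrow> f A \<le> f B"
    and subadd: "\<And>A. f (\<Union>n::nat. A n) \<le> (\<Sum>n. f (A n))"
    and metric: "\<And>A B \<eta>. \<eta> > 0 \<Longrightarrow> (\<And>a b. a \<in> A \<Longrightarrow> b \<in> B \<Longrightarrow> \<eta> \<le> dist a b) \<Longrightarrow> f A + f B \<le> f (A \<union> B)"
    and F: "closed F"
  shows "f (X \<inter> F) + f (X - F) \<le> f X"
\<comment> \<open>\<open>infdist\<close> to the empty set is 0 by convention, so that case is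
  separated; finiteness of \<open>f X\<close> is what makes the tail sums tend to 0.\<close>
proof (cases "F = {} \<or> f X = top")
  case True
  then show ?thesis by (auto simp: empty)
next
  case False
  then have Fne: "F \<noteq> {}" and fin: "f X \<noteq> top" by auto
  define d where "d = (\<lambda>x. infdist x F)"
  have d_lip: "d x \<le> d y + dist x y" for x y unfolding d_def by (rule infdist_triangle)
  have d_pos: "0 < d x" if "x \<notin> F" for x
    using that F Fne infdist_nonneg[of x F] in_closed_iff_infdist_zero[OF F Fne, of x] by (force simp: d_def)
  have d_F: "d x = 0" if "x \<in> F" for x using that by (simp add: d_def)
  define s where "s = (\<lambda>k::nat. inverse (real (Suc k)))"
  have s_less: "s j < s i" if "i < j" for i j using that by (simp add: s_def)
  define R where "R = (\<lambda>k. {x \<in> X. s (Suc k) \<le> d x \<and> d x < s k})"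
  define Y where "Y = (\<lambda>n. {x \<in> X. s n \<le> d x})"
  \<comment> \<open>Annuli whose indices differ by at least 2 are at positive distance, since
    \<open>d\<close> is 1-Lipschitz. Within one parity class the values therefore add up to at most
    \<open>f X\<close>.\<close>
  have parity: "(\<Sum>k<n. f (R (2 * k + p))) \<le> f X" for n p
  proof -
    have "(\<Sum>k<n. f (R (2 * k + p))) \<le> f (\<Union>k<n. R (2 * k + p))"
    proof (induction n)
      case 0 then show ?case by (simp add: empty)
    next
      case (Suc n)
      have "f (\<Union>k<n. R (2 * k + p)) + f (R (2 * n + p)) \<le> f ((\<Union>k<n. R (2 * k + p)) \<union> R (2 * n + p))"
      proof (cases n)
        case 0 then show ?thesis by (simp add: empty)
      next
        case (Suc m)
        show ?thesis
        proof (rule metric)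
          show "0 < s (2 * m + p + 1) - s (2 * n + p)" using s_less[of "2 * m + p + 1" "2 * n + p"] Suc by simp
          fix a b assume "a \<in> (\<Union>k<n. R (2 * k + p))" "b \<in> R (2 * n + p)"
          then obtain k where kn: "k < n" "a \<in> R (2 * k + p)" and b: "b \<in> R (2 * n + p)" by blast
          have k: "k \<le> m" "s (Suc (2 * k + p)) \<le> d a" "d b < s (2 * n + p)"
            using kn b Suc by (simp_all add: R_def)
          have "s (2 * m + p + 1) \<le> s (Suc (2 * k + p))"
            using k(1) s_less[of "Suc (2 * k + p)" "2 * m + p + 1"] by (cases "k = m") auto
          then show "s (2 * m + p + 1) - s (2 * n + p) \<le> dist a b" using k d_lip[of a b] by linarith
        qed
      qed
      then have "f (\<Union>k<n. R (2 * k + p)) + f (R (2 * n + p)) \<le> f (\<Union>k<Suc n. R (2 * k + p))"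
        by (simp add: lessThan_Suc Un_commute)
      then show ?case
        unfolding sum.lessThan_Suc by (rule order_trans[OF add_right_mono[OF Suc]])
    qed
    also have "\<dots> \<le> f X" by (intro mono) (auto simp: R_def)
    finally show ?thesis .
  qed
  have "(\<Sum>k<n. f (R k)) \<le> f X + f X" for n
  proof -
    have "(\<Sum>k<n. f (R k)) \<le> (\<Sum>k<2 * n. f (R k))" by (rule sum_mono2) auto
    also have "\<dots> = (\<Sum>k<n. f (R (2 * k + 0))) + (\<Sum>k<n. f (R (2 * k + 1)))"
      by (induction n) (auto simp: algebra_simps)
    also have "\<dots> \<le> f X + f X" by (intro add_mono parity)
    finally show ?thesis .
  qed
  then have "(\<Sum>k. f (R k)) \<le> f X + f X" by (intro suminf_le_const) auto
  then have "(\<Sum>k. f (R k)) \<noteq> top" using fin by (auto simp: top_unique)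
  then have tail: "(\<lambda>n. \<Sum>k. f (R (k + n))) \<longlonglongrightarrow> 0" by (rule ennreal_suminf_tail_tendsto_0)
  have "f (X \<inter> F) + f (X - F) \<le> f X + (\<Sum>k. f (R (k + n)))" for n
  proof -
    \<comment> \<open>The part of \<open>X\<close> at distance at least \<open>s n\<close> followed
      by the remaining annuli, as one sequence for countable subadditivity.\<close>
    define Z where "Z = (\<lambda>k. case k of 0 \<Rightarrow> Y n | Suc k \<Rightarrow> R (k + n))"
    have "X - F \<subseteq> Y n \<union> (\<Union>k. R (k + n))"
    proof
      fix x assume x: "x \<in> X - F"
      then have "0 < d x" using d_pos by auto
      then obtain m where m: "s m < d x" using reals_Archimedean unfolding s_def by blast
      show "x \<in> Y n \<union> (\<Union>k. R (k + n))"
      proof (cases "s n \<le> d x")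
        case True then show ?thesis using x by (simp add: Y_def)
      next
        case False
        \<comment> \<open>The first threshold not exceeding \<open>d x\<close>; its predecessor is
          the index of the annulus containing x.\<close>
        define j where "j = (LEAST j. s j \<le> d x)"
        have j: "s j \<le> d x" unfolding j_def by (rule LeastI[of _ m]) (use m in simp)
        have jn: "n < j" using j False s_less[of j n] by (metis linorder_neqE_nat order.strict_trans2 less_imp_le)
        then obtain i where i: "j = Suc i" by (cases j) auto
        have "\<not> s i \<le> d x" using not_less_Least[of i "\<lambda>j. s j \<le> d x"] i by (simp add: j_def)
        then have "x \<in> R ((i - n) + n)" using x j i jn by (simp add: R_def)
        then show ?thesis by blast
      qed
    qed
    also have "\<dots> \<subseteq> (\<Union>k. Z k)"
      using UN_upper[of 0 UNIV Z] UN_upper[of "Suc k" UNIV Z for k] by (auto simp: Z_def)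
    finally have "f (X - F) \<le> f (\<Union>k. Z k)" by (rule mono)
    also have "\<dots> \<le> (\<Sum>k. f (Z k))" by (rule subadd)
    also have "\<dots> = f (Y n) + (\<Sum>k. f (R (k + n)))"
      using suminf_offset[of "\<lambda>k. f (Z k)" 1] by (simp add: Z_def add.commute)
    finally have *: "f (X - F) \<le> f (Y n) + (\<Sum>k. f (R (k + n)))" .
    have "f (X \<inter> F) + f (Y n) \<le> f ((X \<inter> F) \<union> Y n)"
    proof (rule metric)
      show "0 < s n" by (simp add: s_def)
      show "s n \<le> dist a b" if "a \<in> X \<inter> F" "b \<in> Y n" for a b
        using that d_lip[of b a] d_F[of a] by (simp add: Y_def dist_commute)
    qed
    also have "\<dots> \<le> f X" by (intro mono) (auto simp: Y_def)
    finally have "f (X \<inter> F) + f (Y n) \<le> f X" .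
    then have "f (X \<inter> F) + f (Y n) + (\<Sum>k. f (R (k + n))) \<le> f X + (\<Sum>k. f (R (k + n)))" by (rule add_right_mono)
    with add_left_mono[OF *, of "f (X \<inter> F)"] show ?thesis unfolding add.assoc by (rule order_trans)
  qed
  moreover have "(\<lambda>n. f X + (\<Sum>k. f (R (k + n)))) \<longlonglongrightarrow> f X + 0" by (intro tendsto_intros tail)
  ultimately show ?thesis by (intro LIMSEQ_le_const[of "\<lambda>n. f X + (\<Sum>k. f (R (k + n)))"]) auto
qed

subsection \<open>The Hausdorff measure\<close>

lemma hausdorff2_pre_le:
  assumes "A \<subseteq> (\<Union>i. C i)" "\<And>i. bounded (C i)" "\<And>i. diameter (C i) \<le> \<delta>"
  shows "hausdorff2_pre \<delta> A \<le> (\<Sum>i. ennreal (pi / 4 * (diameter (C i))\<^sup>2))"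
  unfolding hausdorff2_pre_def by (rule INF_lower) (use assms in auto)

lemma hausdorff2_pre_mono: "A \<subseteq> B \<Longrightarrow> hausdorff2_pre \<delta> A \<le> hausdorff2_pre \<delta> B"
  unfolding hausdorff2_pre_def by (rule INF_superset_mono) auto

lemma hausdorff2_pre_antimono: "\<delta> \<le> \<delta>' \<Longrightarrow> hausdorff2_pre \<delta>' A \<le> hausdorff2_pre \<delta> A"
  unfolding hausdorff2_pre_def by (rule INF_superset_mono) (auto intro: order_trans)

lemma hausdorff2_pre_empty: "0 \<le> \<delta> \<Longrightarrow> hausdorff2_pre \<delta> {} = 0"
  using hausdorff2_pre_le[of "{}" "\<lambda>_. {}" \<delta>] by simp

text \<open>Covers of the sets \<open>A n\<close> that are optimal up to e / 2^(n+1) are merged into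
  one sequence by \<open>prod_decode\<close>. Strictly better than infimum plus error is available
  because only a finite right-hand side has to be considered.\<close>

lemma hausdorff2_pre_subadditive:
  "hausdorff2_pre \<delta> (\<Union>n. A n) \<le> (\<Sum>n. hausdorff2_pre \<delta> (A n))"
proof (rule ennreal_le_epsilon)
  fix e :: real assume e: "0 < e" and fin: "(\<Sum>n. hausdorff2_pre \<delta> (A n)) < top"
  let ?m = "\<lambda>X. ennreal (pi / 4 * (diameter X)\<^sup>2)"
  have finn: "hausdorff2_pre \<delta> (A n) < top" for n
    using fin ennreal_suminf_lessD by blast
  have "\<exists>C. A n \<subseteq> (\<Union>i. C i) \<and> (\<forall>i::nat. bounded (C i) \<and> diameter (C i) \<le> \<delta>) \<and>
      (\<Sum>i. ?m (C i)) < hausdorff2_pre \<delta> (A n) + e * (1/2)^Suc n" for n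
  proof -
    have "hausdorff2_pre \<delta> (A n) < hausdorff2_pre \<delta> (A n) + ennreal (e * (1/2)^Suc n)"
      using finn[of n] e ennreal_add_left_cancel_less[of "hausdorff2_pre \<delta> (A n)" 0 "ennreal (e * (1/2)^Suc n)"]
      by (simp add: less_top ennreal_zero_less_mult_iff)
    then show ?thesis by (subst (asm) (1) hausdorff2_pre_def) (auto simp: INF_less_iff)
  qed
  then obtain C where C: "\<And>n. A n \<subseteq> (\<Union>i. C n i)" "\<And>n i::nat. bounded (C n i)" "\<And>n i. diameter (C n i) \<le> \<delta>"
    "\<And>n. (\<Sum>i. ?m (C n i)) < hausdorff2_pre \<delta> (A n) + e * (1/2)^Suc n" by metis
  define D where "D = (\<lambda>k. case_prod C (prod_decode k))"
  have "hausdorff2_pre \<delta> (\<Union>n. A n) \<le> (\<Sum>k. ?m (D k))"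
  proof (rule hausdorff2_pre_le)
    show "(\<Union>n. A n) \<subseteq> (\<Union>k. D k)"
    proof
      fix x assume "x \<in> (\<Union>n. A n)"
      then obtain n i where "x \<in> C n i" using C(1) by blast
      then have "x \<in> D (prod_encode (n, i))" by (simp add: D_def)
      then show "x \<in> (\<Union>k. D k)" by blast
    qed
  qed (simp_all add: D_def C split: prod.split)
  also have "\<dots> = (\<Sum>n. \<Sum>i. ?m (C n i))"
    unfolding D_def by (rule suminf_ennreal_2dimen[where f="\<lambda>p. ?m (case_prod C p)", unfolded o_def]) simp
  also have "\<dots> \<le> (\<Sum>n. hausdorff2_pre \<delta> (A n) + ennreal (e * (1/2)^Suc n))"
    using less_imp_le[OF C(4)] by (intro suminf_le) simp_all
  also have "\<dots> = (\<Sum>n. hausdorff2_pre \<delta> (A n)) + (\<Sum>n. ennreal (e * (1/2)^Suc n))"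
    by (intro suminf_add[symmetric]) auto
  also have "(\<Sum>n. ennreal (e * (1/2)^Suc n)) = ennreal e"
    using e sums_mult[OF power_half_series, of e] by (intro suminf_ennreal_eq) auto
  finally show "hausdorff2_pre \<delta> (\<Union>n. A n) \<le> (\<Sum>n. hausdorff2_pre \<delta> (A n)) + ennreal e" .
qed

lemma hausdorff2_mono: "A \<subseteq> B \<Longrightarrow> hausdorff2 A \<le> hausdorff2 B"
  unfolding hausdorff2_def by (intro SUP_mono) (auto intro: hausdorff2_pre_mono)

lemma hausdorff2_empty: "hausdorff2 {} = 0"
  by (simp add: hausdorff2_def hausdorff2_pre_empty cong: SUP_cong_simp)

lemma hausdorff2_pre_le_hausdorff2: "0 < \<delta> \<Longrightarrow> hausdorff2_pre \<delta> A \<le> hausdorff2 A"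
  unfolding hausdorff2_def by (rule SUP_upper) auto

lemma hausdorff2_subadditive: "hausdorff2 (\<Union>n. A n) \<le> (\<Sum>n. hausdorff2 (A n))"
  unfolding hausdorff2_def[of "\<Union>n. A n"]
proof (rule SUP_least)
  fix \<delta> :: real assume "\<delta> \<in> {0<..}"
  then show "hausdorff2_pre \<delta> (\<Union>n. A n) \<le> (\<Sum>n. hausdorff2 (A n))"
    by (intro order_trans[OF hausdorff2_pre_subadditive] suminf_le hausdorff2_pre_le_hausdorff2) auto
qed

text \<open>A set of diameter at most \<delta> < \<eta> cannot meet both \<open>A\<close> and
  \<open>B\<close>, so each cover of the union splits into a cover of \<open>A\<close> and one of
  \<open>B\<close>.\<close>

lemma hausdorff2_pre_separated:
  assumes "0 \<le> \<delta>" "\<delta> < \<eta>" and sep: "\<And>a b. a \<in> A \<Longrightarrow> b \<in> B \<Longrightarrow> \<eta> \<le> dist a b"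
  shows "hausdorff2_pre \<delta> A + hausdorff2_pre \<delta> B \<le> hausdorff2_pre \<delta> (A \<union> B)"
  unfolding hausdorff2_pre_def[of \<delta> "A \<union> B"]
proof (rule INF_greatest, clarify)
  fix C :: "nat \<Rightarrow> (real^3) set"
  assume C: "A \<union> B \<subseteq> (\<Union>i. C i)" "\<forall>i. bounded (C i) \<and> diameter (C i) \<le> \<delta>"
  let ?m = "\<lambda>X. ennreal (pi / 4 * (diameter (X :: (real^3) set))\<^sup>2)"
  \<comment> \<open>Discarded members become empty instead of being removed, which keeps the
    indexing; the empty set has diameter 0 and is admissible as 0 \<le> \<delta>.\<close>
  define CA where "CA = (\<lambda>i. if C i \<inter> A = {} then {} else C i)"
  define CB where "CB = (\<lambda>i. if C i \<inter> B = {} then {} else C i)"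
  have excl: "C i \<inter> A = {} \<or> C i \<inter> B = {}" for i
  proof (rule ccontr)
    assume "\<not> ?thesis"
    then obtain a b where ab: "a \<in> C i" "a \<in> A" "b \<in> C i" "b \<in> B" by auto
    then have "dist a b \<le> diameter (C i)" using C(2) by (intro diameter_bounded_bound) auto
    then show False using sep[OF ab(2,4)] C(2) assms(2) by (metis linorder_not_le order_trans)
  qed
  have "hausdorff2_pre \<delta> A \<le> (\<Sum>i. ?m (CA i))"
    using C assms(1) by (intro hausdorff2_pre_le) (force simp: CA_def)+
  moreover have "hausdorff2_pre \<delta> B \<le> (\<Sum>i. ?m (CB i))"
    using C assms(1) by (intro hausdorff2_pre_le) (force simp: CB_def)+
  ultimately have "hausdorff2_pre \<delta> A + hausdorff2_pre \<delta> B \<le> (\<Sum>i. ?m (CA i)) + (\<Sum>i. ?m (CB i))"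
    by (rule add_mono)
  also have "\<dots> = (\<Sum>i. ?m (CA i) + ?m (CB i))" by (intro suminf_add) auto
  also have "\<dots> \<le> (\<Sum>i. ?m (C i))" using excl by (intro suminf_le) (auto simp: CA_def CB_def)
  finally show "hausdorff2_pre \<delta> A + hausdorff2_pre \<delta> B \<le> (\<Sum>i. ?m (C i))" .
qed

text \<open>Passing to a monotone sequence of scales lets the supremum commute with addition. The
  shift by 2 keeps every scale strictly below \<eta>, as \<open>hausdorff2_pre_separated\<close>
  demands.\<close>

lemma hausdorff2_eq_SUP_seq:
  assumes "0 < \<eta>"
  shows "hausdorff2 A = (SUP n. hausdorff2_pre (\<eta> / real (n + 2)) A)"
  unfolding hausdorff2_def
proof (rule SUP_eq)
  fix \<delta> :: real assume "\<delta> \<in> {0<..}"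
  then obtain n :: nat where n: "\<eta> / \<delta> < real n" using reals_Archimedean2 by blast
  have "\<eta> / real (n + 2) \<le> \<delta>"
  proof -
    have "\<eta> < real n * \<delta>" using n \<open>\<delta> \<in> {0<..}\<close> by (simp add: pos_divide_less_eq)
    also have "\<dots> \<le> real (n + 2) * \<delta>" using \<open>\<delta> \<in> {0<..}\<close> by (intro mult_right_mono) auto
    finally show ?thesis by (simp add: divide_le_eq mult.commute)
  qed
  then show "\<exists>n\<in>UNIV. hausdorff2_pre \<delta> A \<le> hausdorff2_pre (\<eta> / real (n + 2)) A"
    using hausdorff2_pre_antimono by blast
next
  fix n :: nat
  show "\<exists>\<delta>\<in>{0<..}. hausdorff2_pre (\<eta> / real (n + 2)) A \<le> hausdorff2_pre \<delta> A"
    using assms by (intro bexI[of _ "\<eta> / real (n + 2)"]) auto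
qed

lemma hausdorff2_separated:
  assumes "0 < \<eta>" and sep: "\<And>a b. a \<in> A \<Longrightarrow> b \<in> B \<Longrightarrow> \<eta> \<le> dist a b"
  shows "hausdorff2 A + hausdorff2 B \<le> hausdorff2 (A \<union> B)"
proof -
  have inc: "incseq (\<lambda>n. hausdorff2_pre (\<eta> / real (n + 2)) X)" for X
    using assms(1) by (intro incseq_SucI hausdorff2_pre_antimono divide_left_mono) auto
  have "hausdorff2 A + hausdorff2 B = (SUP n. hausdorff2_pre (\<eta> / real (n + 2)) A + hausdorff2_pre (\<eta> / real (n + 2)) B)"
    unfolding hausdorff2_eq_SUP_seq[OF assms(1)] by (rule ennreal_SUP_add[symmetric]) (rule inc)+
  also have "\<dots> \<le> hausdorff2 (A \<union> B)"
  proof (rule SUP_least)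
    fix n :: nat
    have "\<eta> / real (n + 2) < \<eta>" using assms(1) by (simp add: divide_less_eq)
    then show "hausdorff2_pre (\<eta> / real (n + 2)) A + hausdorff2_pre (\<eta> / real (n + 2)) B \<le> hausdorff2 (A \<union> B)"
      using assms by (intro order_trans[OF hausdorff2_pre_separated hausdorff2_pre_le_hausdorff2]) auto
  qed
  finally show ?thesis .
qed

lemma sets_surface_measure: "sets surface_measure = sets borel"
  by (simp add: surface_measure_def sets.sigma_sets_eq[of borel, simplified])

text \<open>Caratheodory: closed sets satisfy the splitting condition by the metric property, so the
  sigma-algebra of sets that split \<open>hausdorff2\<close> contains all Borel sets, and
  \<open>measure_of\<close> really returns \<open>hausdorff2\<close> there.\<close>

lemma emeasure_surface_measure:
  assumes "S \<in> sets borel"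
  shows "emeasure surface_measure S = hausdorff2 S"
proof -
  interpret P: sigma_algebra "UNIV :: (real^3) set" UNIV
    using sigma_algebra_Pow[of "UNIV :: (real^3) set"] by simp
  let ?L = "lambda_system (UNIV :: (real^3) set) UNIV hausdorff2"
  have oms: "outer_measure_space UNIV hausdorff2"
    unfolding outer_measure_space_def positive_def increasing_def countably_subadditive_def
    using hausdorff2_mono hausdorff2_empty hausdorff2_subadditive by auto
  have ms: "measure_space UNIV ?L hausdorff2" by (rule P.caratheodory_lemma[OF oms])
  then have sig: "sigma_algebra UNIV ?L" and ca: "countably_additive ?L hausdorff2"
    by (auto simp: measure_space_def)
  have "F \<in> ?L" if "closed F" for F
  proof -
    have "hausdorff2 (F \<inter> X) + hausdorff2 ((UNIV - F) \<inter> X) = hausdorff2 X" for X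
    proof (rule antisym)
      show "hausdorff2 (F \<inter> X) + hausdorff2 ((UNIV - F) \<inter> X) \<le> hausdorff2 X"
        using metric_outer_measure_closed[where f=hausdorff2 and X=X, OF hausdorff2_empty hausdorff2_mono hausdorff2_subadditive hausdorff2_separated that]
        by (simp add: Int_commute Diff_eq)
      \<comment> \<open>Subadditivity for two sets, obtained from the countable version by padding
        with empty sets.\<close>
      have "hausdorff2 X = hausdorff2 (\<Union>n::nat. if n = 0 then F \<inter> X else if n = 1 then (UNIV - F) \<inter> X else {})"
        by (rule arg_cong[of _ _ hausdorff2]) (auto split: if_splits)
      also have "\<dots> \<le> (\<Sum>n::nat. hausdorff2 (if n = 0 then F \<inter> X else if n = 1 then (UNIV - F) \<inter> X else {}))"
        by (rule hausdorff2_subadditive)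
      also have "\<dots> = (\<Sum>n<(2::nat). hausdorff2 (if n = 0 then F \<inter> X else if n = 1 then (UNIV - F) \<inter> X else {}))"
        by (rule suminf_finite) (auto simp: hausdorff2_empty)
      finally show "hausdorff2 X \<le> hausdorff2 (F \<inter> X) + hausdorff2 ((UNIV - F) \<inter> X)"
        by (simp add: numeral_2_eq_2)
    qed
    then show ?thesis by (simp add: lambda_system_def Int_commute)
  qed
  then have "sigma_sets UNIV (Collect closed) \<subseteq> ?L"
    by (intro sigma_algebra.sigma_sets_subset[OF sig]) auto
  then have sub: "sets borel \<subseteq> ?L" unfolding borel_eq_closed by simp
  have pos: "positive (sets borel) hausdorff2" by (simp add: positive_def hausdorff2_empty)
  have "countably_additive (sets borel) hausdorff2"
    using ca sub unfolding countably_additive_def by (meson subset_trans subsetD)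
  then show ?thesis
    using assms pos by (intro emeasure_measure_of[OF surface_measure_def]) (auto simp: sets_surface_measure)
qed

section \<open>Integration along a Lipschitz graph\<close>

lemma nn_integral_lborel_translate:
  fixes f :: "'a::euclidean_space \<Rightarrow> ennreal"
  assumes "f \<in> borel_measurable borel"
  shows "(\<integral>\<^sup>+x. f (x + a) \<partial>lborel) = (\<integral>\<^sup>+x. f x \<partial>lborel)"
  using nn_integral_distr[of "(+) a" lborel borel f] assms by (simp add: lborel_distr_plus add.commute)

lemma measurable_translate_borel: "(f :: real^3 \<Rightarrow> real) \<in> borel_measurable borel \<Longrightarrow> (\<lambda>x. f (x + a)) \<in> borel_measurable borel"
  by (rule measurable_compose[of "\<lambda>x. x + a" borel borel]) simp

text \<open>The graph is the zero set of \<open>h\<close>, the signed distance to it along \<open>N\<close>. Pushing the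
  Lebesgue measure of the layer \<open>0 \<le> h < 1\<close> forward along \<open>N\<close> yields a measure on the graph which
  replaces the area of the projection to the plane orthogonal to \<open>N\<close>.\<close>

locale lipschitz_graph =
  fixes h :: "real^3 \<Rightarrow> real" and N :: "real^3" and L :: real
  assumes lip: "\<bar>h x - h y\<bar> \<le> L * dist x y"
    and shift: "h (x + s *\<^sub>R N) = h x + s"
    and norm_N: "norm N = 1"
begin

lemma L_nonneg: "0 \<le> L"
  using lip[of N 0] norm_N abs_ge_zero[of "h N - h 0"] by simp

text \<open>Projection onto the graph along \<open>N\<close>, not to the nearest point: it is
  constant on lines parallel to \<open>N\<close>, and the displacement has length exactly |h
  x|.\<close>

definition proj :: "real^3 \<Rightarrow> real^3" where
  "proj x = x - h x *\<^sub>R N"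

text \<open>Half-open in the height so that consecutive layers tile without overlap.\<close>

definition layer :: "real \<Rightarrow> real \<Rightarrow> (real^3) set" where
  "layer a b = {x. a \<le> h x \<and> h x < b}"

lemma continuous_h: "continuous_on A h"
proof (rule continuous_on_subset[OF _ subset_UNIV])
  have "L-lipschitz_on UNIV h"
    using lip L_nonneg by (intro lipschitz_onI) (auto simp: dist_real_def)
  then show "continuous_on UNIV h" by (rule lipschitz_on_continuous_on)
qed

lemma continuous_proj: "continuous_on A proj"
  unfolding proj_def by (intro continuous_intros continuous_h)

lemma measurable_h [measurable]: "h \<in> borel_measurable borel"
  by (rule borel_measurable_continuous_onI[OF continuous_h])

lemma measurable_proj [measurable]: "proj \<in> borel_measurable borel"
  by (rule borel_measurable_continuous_onI[OF continuous_proj])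

lemma layer_measurable [measurable]: "layer a b \<in> sets borel"
  unfolding layer_def by measurable

lemma layer_proj_measurable:
  assumes "E \<in> sets borel"
  shows "{x \<in> layer a b. proj x \<in> E} \<in> sets borel"
proof -
  have "proj -` E \<in> sets borel" using measurable_sets[OF measurable_proj assms] by simp
  moreover have "{x \<in> layer a b. proj x \<in> E} = layer a b \<inter> proj -` E" by auto
  ultimately show ?thesis using layer_measurable by simp
qed

lemma h_proj: "h (proj x) = 0"
  using shift[of x "- h x"] by (simp add: proj_def)

lemma proj_shift: "proj (x + s *\<^sub>R N) = proj x"
  by (simp add: proj_def shift algebra_simps)

lemma norm_diff_proj: "norm (x - proj x) = \<bar>h x\<bar>"
  by (simp add: proj_def norm_N)

text \<open>The part of the unit layer over \<open>C\<close> is a tube of width about d, covered by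
  m + 1 balls of radius 2 d spaced by d along \<open>N\<close>. In the constant 16, the factor 8 is
  from the cube of 2 d and the factor 2 from (m + 1) d \<le> 1 + d \<le> 2.\<close>

lemma emeasure_layer_proj_le:
  assumes C: "closed C" "C \<noteq> {}" "\<And>x y. x \<in> C \<Longrightarrow> y \<in> C \<Longrightarrow> dist x y \<le> d" and d: "0 < d" "d \<le> 1"
  shows "emeasure lborel {x \<in> layer 0 1. proj x \<in> C} \<le> ennreal (16 * unit_ball_vol 3 * d\<^sup>2)"
proof -
  obtain c where c: "c \<in> C" using C by blast
  define m where "m = nat \<lfloor>1 / d\<rfloor>"
  have m: "real m \<le> 1 / d" using d by (simp add: m_def)
  have "{x \<in> layer 0 1. proj x \<in> C} \<subseteq> (\<Union>k\<in>{..m}. cball (c + (real k * d) *\<^sub>R N) (2 * d))"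
  proof
    fix x assume x: "x \<in> {x \<in> layer 0 1. proj x \<in> C}"
    define k where "k = nat \<lfloor>h x / d\<rfloor>"
    have h: "0 \<le> h x" "h x < 1" using x by (auto simp: layer_def)
    have k0: "real k \<le> h x / d" "h x / d < real k + 1" using h d unfolding k_def by auto
    have k: "real k * d \<le> h x" "h x \<le> real k * d + d"
      using k0 d by (auto simp: field_simps)
    have "h x / d \<le> 1 / d" using h d by (intro divide_right_mono) auto
    then have "k \<le> m" unfolding k_def m_def by (intro nat_mono floor_mono)
    moreover have "x - (c + (real k * d) *\<^sub>R N) = (proj x - c) + (h x - real k * d) *\<^sub>R N"
      by (simp add: proj_def algebra_simps)
    then have "norm (x - (c + (real k * d) *\<^sub>R N)) \<le> norm (proj x - c) + norm ((h x - real k * d) *\<^sub>R N)"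
      by (metis norm_triangle_ineq)
    then have "dist (c + (real k * d) *\<^sub>R N) x \<le> 2 * d"
      using C(3)[OF _ c, of "proj x"] x k by (simp add: dist_norm norm_minus_commute norm_N)
    ultimately show "x \<in> (\<Union>k\<in>{..m}. cball (c + (real k * d) *\<^sub>R N) (2 * d))" by auto
  qed
  then have "emeasure lborel {x \<in> layer 0 1. proj x \<in> C} \<le> emeasure lborel (\<Union>k\<in>{..m}. cball (c + (real k * d) *\<^sub>R N) (2 * d))"
    by (intro emeasure_mono) auto
  also have "\<dots> \<le> (\<Sum>k\<in>{..m}. emeasure lborel (cball (c + (real k * d) *\<^sub>R N) (2 * d)))"
    by (intro emeasure_subadditive_finite) auto
  also have "\<dots> = (\<Sum>k\<in>{..m}. ennreal (unit_ball_vol 3 * (2 * d) ^ 3))"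
    using d by (intro sum.cong refl) (subst emeasure_cball, auto)
  also have "\<dots> = ennreal (real (Suc m) * (unit_ball_vol 3 * (2 * d) ^ 3))"
    using d by (subst sum_ennreal) (auto simp: unit_ball_vol_nonneg)
  also have "\<dots> \<le> ennreal (16 * unit_ball_vol 3 * d\<^sup>2)"
  proof (rule ennreal_leI)
    have "real (Suc m) * d \<le> 2" using m d by (simp add: field_simps)
    then have "(real (Suc m) * d) * (8 * unit_ball_vol 3 * d\<^sup>2) \<le> 2 * (8 * unit_ball_vol 3 * d\<^sup>2)"
      by (intro mult_right_mono mult_nonneg_nonneg unit_ball_vol_nonneg) auto
    then show "real (Suc m) * (unit_ball_vol 3 * (2 * d) ^ 3) \<le> 16 * unit_ball_vol 3 * d\<^sup>2"
      by (simp add: power2_eq_square power3_eq_cube algebra_simps)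
  qed
  finally show ?thesis .
qed

text \<open>The preceding bound needs a positive d, while a diameter may be 0, so the diameter is
  approached from above. The increments are at most 1/2, which together with diameter at most 1/2
  respects d \<le> 1.\<close>

lemma emeasure_layer_proj_diameter:
  assumes C: "closed C" "bounded C" "diameter C \<le> 1/2"
  shows "emeasure lborel {x \<in> layer 0 1. proj x \<in> C} \<le> ennreal (16 * unit_ball_vol 3 * (diameter C)\<^sup>2)"
proof (cases "C = {}")
  case False
  have d0: "0 \<le> diameter C" using C by (simp add: diameter_ge_0)
  define F where "F = (\<lambda>n. ennreal (16 * unit_ball_vol 3 * (diameter C + inverse (real (Suc (Suc n))))\<^sup>2))"
  have "F \<longlonglongrightarrow> ennreal (16 * unit_ball_vol 3 * (diameter C + 0)\<^sup>2)"
    unfolding F_def by (intro tendsto_ennrealI tendsto_intros LIMSEQ_Suc[OF LIMSEQ_inverse_real_of_nat])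
  moreover have "emeasure lborel {x \<in> layer 0 1. proj x \<in> C} \<le> F n" for n
    unfolding F_def
  proof (rule emeasure_layer_proj_le[OF C(1) False])
    show "dist x y \<le> diameter C + inverse (real (Suc (Suc n)))" if "x \<in> C" "y \<in> C" for x y
      using diameter_bounded_bound[OF C(2) that] by (rule order_trans) simp
    have "inverse (real (Suc (Suc n))) \<le> inverse 2" by (rule le_imp_inverse_le) auto
    then show "diameter C + inverse (real (Suc (Suc n))) \<le> 1" using C(3) by simp
    show "0 < diameter C + inverse (real (Suc (Suc n)))" using d0 by (intro add_nonneg_pos) auto
  qed
  ultimately show ?thesis by (intro LIMSEQ_le_const[of F]) auto
qed simp

text \<open>Summing the tube bound over a cover; the constant is 16 \<open>unit_ball_vol 3\<close>
  divided by the normalising factor pi / 4. The single scale 1/2 is enough because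
  \<open>hausdorff2\<close> dominates \<open>hausdorff2_pre\<close> at every scale.\<close>

lemma emeasure_layer_proj_hausdorff2:
  assumes E: "E \<in> sets borel"
  shows "emeasure lborel {x \<in> layer 0 1. proj x \<in> E} \<le> ennreal (64 * unit_ball_vol 3 / pi) * hausdorff2 E"
proof -
  define c where "c = 64 * unit_ball_vol 3 / pi"
  have c: "0 < c" by (simp add: c_def)
  have cc: "ennreal (inverse c) * ennreal c = 1" "ennreal c * ennreal (inverse c) = 1"
    using c by (simp_all flip: ennreal_mult)
  have "ennreal (inverse c) * emeasure lborel {x \<in> layer 0 1. proj x \<in> E} \<le> hausdorff2_pre (1/2) E"
    unfolding hausdorff2_pre_def
  proof (rule INF_greatest, clarify)
    fix C :: "nat \<Rightarrow> (real^3) set"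
    assume C: "E \<subseteq> (\<Union>i. C i)" "\<forall>i. bounded (C i) \<and> diameter (C i) \<le> 1/2"
    \<comment> \<open>Closures make the covering sets measurable and leave their diameters
      unchanged.\<close>
    have "emeasure lborel {x \<in> layer 0 1. proj x \<in> E} \<le> emeasure lborel (\<Union>i. {x \<in> layer 0 1. proj x \<in> closure (C i)})"
    proof (rule emeasure_mono)
      show "{x \<in> layer 0 1. proj x \<in> E} \<subseteq> (\<Union>i. {x \<in> layer 0 1. proj x \<in> closure (C i)})"
        using C(1) closure_subset by blast
      show "(\<Union>i. {x \<in> layer 0 1. proj x \<in> closure (C i)}) \<in> sets lborel"
        unfolding sets_lborel by (intro sets.countable_UN image_subsetI layer_proj_measurable borel_closed closed_closure)
    qed
    also have "\<dots> \<le> (\<Sum>i. emeasure lborel {x \<in> layer 0 1. proj x \<in> closure (C i)})"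
      by (intro emeasure_subadditive_countably) (auto simp: image_subset_iff intro!: layer_proj_measurable)
    also have "\<dots> \<le> (\<Sum>i. ennreal c * ennreal (pi / 4 * (diameter (C i))\<^sup>2))"
    proof (rule suminf_le)
      fix i
      have "emeasure lborel {x \<in> layer 0 1. proj x \<in> closure (C i)} \<le> ennreal (16 * unit_ball_vol 3 * (diameter (C i))\<^sup>2)"
        using emeasure_layer_proj_diameter[of "closure (C i)"] C(2) by (simp add: diameter_closure bounded_closure)
      also have "16 * unit_ball_vol 3 * (diameter (C i))\<^sup>2 = c * (pi / 4 * (diameter (C i))\<^sup>2)"
        by (simp add: c_def)
      finally show "emeasure lborel {x \<in> layer 0 1. proj x \<in> closure (C i)} \<le> ennreal c * ennreal (pi / 4 * (diameter (C i))\<^sup>2)"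
        using c by (simp flip: ennreal_mult)
    qed auto
    also have "\<dots> = ennreal c * (\<Sum>i. ennreal (pi / 4 * (diameter (C i))\<^sup>2))" by simp
    finally have "ennreal (inverse c) * emeasure lborel {x \<in> layer 0 1. proj x \<in> E}
        \<le> ennreal (inverse c) * (ennreal c * (\<Sum>i. ennreal (pi / 4 * (diameter (C i))\<^sup>2)))"
      by (rule mult_left_mono) simp
    then show "ennreal (inverse c) * emeasure lborel {x \<in> layer 0 1. proj x \<in> E} \<le> (\<Sum>i. ennreal (pi / 4 * (diameter (C i))\<^sup>2))"
      by (simp add: cc(1) flip: mult.assoc)
  qed
  also have "\<dots> \<le> hausdorff2 E" by (rule hausdorff2_pre_le_hausdorff2) simp
  finally have "ennreal c * (ennreal (inverse c) * emeasure lborel {x \<in> layer 0 1. proj x \<in> E}) \<le> ennreal c * hausdorff2 E"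
    by (rule mult_left_mono) simp
  then show ?thesis by (simp add: cc(2) c_def[symmetric] flip: mult.assoc)
qed

text \<open>The image \<nu> of the layer's volume under \<open>proj\<close> is dominated setwise by
  a multiple of surface measure, hence so are integrals. Cutting \<open>g\<close> off outside the
  graph is invisible to \<nu>, since \<open>proj\<close> takes values on the graph.\<close>

lemma nn_integral_layer_le_surface:
  assumes g: "g \<in> borel_measurable borel"
  shows "(\<integral>\<^sup>+x\<in>layer 0 1. g (proj x) \<partial>lborel)
     \<le> ennreal (64 * unit_ball_vol 3 / pi) * (\<integral>\<^sup>+x\<in>{x. h x = 0}. g x \<partial>surface_measure)"
proof -
  define c where "c = ennreal (64 * unit_ball_vol 3 / pi)"
  define \<nu> where "\<nu> = distr (density lborel (indicator (layer 0 1))) borel proj"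
  define g0 where "g0 = (\<lambda>x. g x * indicator {x. h x = 0} x)"
  have g0 [measurable]: "g0 \<in> borel_measurable borel" unfolding g0_def using g by measurable
  have sets: "sets \<nu> = sets (scale_measure c surface_measure)" by (simp add: \<nu>_def sets_surface_measure)
  have "\<nu> \<le> scale_measure c surface_measure"
    unfolding le_measure[OF sets]
  proof
    fix E assume "E \<in> sets \<nu>"
    then have E [measurable]: "E \<in> sets borel" by (simp add: \<nu>_def)
    have [measurable]: "proj -` E \<in> sets borel" using measurable_sets[OF measurable_proj E] by simp
    note [measurable] = layer_proj_measurable[OF E, of 0 1]
    have "emeasure \<nu> E = emeasure (density lborel (indicator (layer 0 1))) (proj -` E \<inter> space lborel)"
      unfolding \<nu>_def using E by (subst emeasure_distr) auto
    also have "\<dots> = (\<integral>\<^sup>+x. indicator (layer 0 1) x * indicator (proj -` E) x \<partial>lborel)"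
      by (subst emeasure_density) auto
    also have "\<dots> = (\<integral>\<^sup>+x. indicator {x \<in> layer 0 1. proj x \<in> E} x \<partial>lborel)"
      by (intro nn_integral_cong) (auto split: split_indicator)
    also have "\<dots> = emeasure lborel {x \<in> layer 0 1. proj x \<in> E}" by (intro nn_integral_indicator) simp
    also have "\<dots> \<le> c * hausdorff2 E" unfolding c_def by (rule emeasure_layer_proj_hausdorff2[OF E])
    finally show "emeasure \<nu> E \<le> emeasure (scale_measure c surface_measure) E"
      by (simp add: emeasure_surface_measure[OF E])
  qed
  then have "nn_integral \<nu> g0 \<le> nn_integral (scale_measure c surface_measure) g0"
    by (rule nn_integral_mono_measure[OF sets])
  also have "\<dots> = c * nn_integral surface_measure g0"
    by (rule nn_integral_scale_measure) (simp add: measurable_cong_sets[OF sets_surface_measure refl])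
  also have "nn_integral \<nu> g0 = (\<integral>\<^sup>+x. g0 (proj x) \<partial>density lborel (indicator (layer 0 1)))"
    unfolding \<nu>_def by (intro nn_integral_distr) auto
  also have "\<dots> = (\<integral>\<^sup>+x. indicator (layer 0 1) x * g0 (proj x) \<partial>lborel)"
    by (intro nn_integral_density) auto
  also have "\<dots> = (\<integral>\<^sup>+x\<in>layer 0 1. g (proj x) \<partial>lborel)"
    by (intro nn_integral_cong) (simp add: g0_def h_proj mult.commute)
  finally show ?thesis by (simp add: c_def g0_def)
qed

text \<open>The integrand is invariant under shifts along \<open>N\<close>, so all layers of height
  1 / n carry the same integral; n of them tile the unit layer.\<close>

lemma nn_integral_thin_layer:
  assumes g: "g \<in> borel_measurable borel" and n: "0 < n"
  shows "of_nat n * (\<integral>\<^sup>+x\<in>{x. \<bar>h x\<bar> \<le> 1 / real n}. g (proj x) \<partial>lborel) \<le> 3 * (\<integral>\<^sup>+x\<in>layer 0 1. g (proj x) \<partial>lborel)"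
proof -
  define I where "I = (\<lambda>k::int. \<integral>\<^sup>+x\<in>layer (real_of_int k / n) ((real_of_int k + 1) / n). g (proj x) \<partial>lborel)"
  have I0: "I k = I 0" for k
  proof -
    define a where "a = real_of_int k / n"
    define F where "F = (\<lambda>x. g (proj x) * indicator (layer (real_of_int k / n) ((real_of_int k + 1) / n)) x)"
    have F: "F \<in> borel_measurable borel" unfolding F_def using g by measurable
    have "I k = (\<integral>\<^sup>+x. F x \<partial>lborel)" by (simp add: I_def F_def)
    also have "\<dots> = (\<integral>\<^sup>+x. F (x + a *\<^sub>R N) \<partial>lborel)" by (rule nn_integral_lborel_translate[OF F, symmetric])
    also have "\<dots> = I 0" unfolding I_def
    proof (intro nn_integral_cong)
      fix x :: "real^3"
      have "h x + a < (real_of_int k + 1) / n \<longleftrightarrow> h x < 1 / n" "real_of_int k / n \<le> h x + a \<longleftrightarrow> 0 \<le> h x"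
        by (auto simp: a_def add_divide_distrib)
      then show "F (x + a *\<^sub>R N) = g (proj x) * indicator (layer (real_of_int 0 / n) ((real_of_int 0 + 1) / n)) x"
        by (simp add: F_def proj_shift shift layer_def indicator_def)
    qed
    finally show ?thesis .
  qed
  have cover: "(\<integral>\<^sup>+x\<in>layer 0 1. g (proj x) \<partial>lborel) = (\<Sum>k<n. I (int k))"
  proof -
    have "(\<Sum>k<n. I (int k)) = (\<integral>\<^sup>+x. (\<Sum>k<n. g (proj x) * indicator (layer (real k / n) ((real k + 1) / n)) x) \<partial>lborel)"
      unfolding I_def using g by (subst nn_integral_sum) auto
    also have "\<dots> = (\<integral>\<^sup>+x\<in>layer 0 1. g (proj x) \<partial>lborel)"
    proof (intro nn_integral_cong)
      fix x :: "real^3"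
      have iff: "x \<in> layer (real k / n) ((real k + 1) / n) \<longleftrightarrow> \<lfloor>h x * n\<rfloor> = int k" for k
        using n by (simp add: layer_def floor_eq_iff field_simps)
      have "(\<Sum>k<n. indicator (layer (real k / n) ((real k + 1) / n)) x) = (indicator (layer 0 1) x :: ennreal)"
      proof (cases "x \<in> layer 0 1")
        case True
        then have hx: "0 \<le> h x * n" "h x * n < n" using n by (auto simp: layer_def)
        define j where "j = nat \<lfloor>h x * n\<rfloor>"
        have j: "int j = \<lfloor>h x * n\<rfloor>" using hx by (simp add: j_def)
        have "\<lfloor>h x * n\<rfloor> < int n" using hx by (simp add: floor_less_iff)
        then have "j < n" using j by simp
        have "(\<Sum>k<n. indicator (layer (real k / n) ((real k + 1) / n)) x) = (\<Sum>k<n. if k = j then 1 else 0 :: ennreal)"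
          using j by (intro sum.cong) (auto simp: indicator_def iff)
        then show ?thesis using True \<open>j < n\<close> by simp
      next
        case False
        have "x \<notin> layer (real k / n) ((real k + 1) / n)" if "k < n" for k
        proof
          assume a: "x \<in> layer (real k / n) ((real k + 1) / n)"
          have n1: "0 \<le> real k / n" "(real k + 1) / n \<le> 1" using that by auto
          have "real k / n \<le> h x" "h x < (real k + 1) / n" using a by (auto simp: layer_def)
          with n1 have "0 \<le> h x" "h x < 1" by linarith+
          then show False using False by (simp add: layer_def)
        qed
        then show ?thesis using False by simp
      qed
      then show "(\<Sum>k<n. g (proj x) * indicator (layer (real k / n) ((real k + 1) / n)) x) = g (proj x) * indicator (layer 0 1) x"
        by (simp flip: sum_distrib_left)
    qed
    finally show ?thesis by simp
  qed
  \<comment> \<open>Three half-open layers, the third one only for the endpoint h x = 1 / n.\<close>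
  have "(\<integral>\<^sup>+x\<in>{x. \<bar>h x\<bar> \<le> 1 / real n}. g (proj x) \<partial>lborel) \<le>
     (\<integral>\<^sup>+x. g (proj x) * indicator (layer (real_of_int (-1) / n) ((real_of_int (-1) + 1) / n)) x
        + (g (proj x) * indicator (layer (real_of_int 0 / n) ((real_of_int 0 + 1) / n)) x
        + g (proj x) * indicator (layer (real_of_int 1 / n) ((real_of_int 1 + 1) / n)) x) \<partial>lborel)"
  proof (intro nn_integral_mono)
    fix x :: "real^3"
    have "1 / real n < 2 / real n" using n by (simp add: divide_strict_right_mono)
    then show "g (proj x) * indicator {x. \<bar>h x\<bar> \<le> 1 / real n} x \<le>
        g (proj x) * indicator (layer (real_of_int (-1) / n) ((real_of_int (-1) + 1) / n)) x
        + (g (proj x) * indicator (layer (real_of_int 0 / n) ((real_of_int 0 + 1) / n)) x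
        + g (proj x) * indicator (layer (real_of_int 1 / n) ((real_of_int 1 + 1) / n)) x)"
      by (auto simp: indicator_def layer_def abs_le_iff)
  qed
  also have "\<dots> = I (-1) + (I 0 + I 1)"
    unfolding I_def using g by (subst nn_integral_add; (subst nn_integral_add)?; simp)
  also have "\<dots> = 3 * I 0" 
  proof -
    have "(3::ennreal) = 1 + (1 + 1)" by simp
    then show ?thesis unfolding I0[of "-1"] I0[of 1] by (simp only: distrib_right mult_1)
  qed
  finally have "of_nat n * (\<integral>\<^sup>+x\<in>{x. \<bar>h x\<bar> \<le> 1 / real n}. g (proj x) \<partial>lborel) \<le> of_nat n * (3 * I 0)"
    by (rule mult_left_mono) simp
  also have "\<dots> = 3 * (\<Sum>k<n. I (int k))" unfolding I0[of "int k" for k] by (simp add: ac_simps)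
  finally show ?thesis by (simp add: cover)
qed

lemma emeasure_layer_proj_bounded:
  assumes "E \<in> sets borel" "bounded E"
  shows "emeasure lborel {x \<in> layer 0 1. proj x \<in> E} < \<infinity>"
proof -
  obtain b where b: "\<And>x. x \<in> E \<Longrightarrow> norm x \<le> b" using assms(2) by (auto simp: bounded_iff)
  have "{x \<in> layer 0 1. proj x \<in> E} \<subseteq> cball 0 (b + 1)"
  proof
    fix x assume x: "x \<in> {x \<in> layer 0 1. proj x \<in> E}"
    have "norm x \<le> norm (proj x) + norm (x - proj x)" using norm_triangle_ineq[of "proj x" "x - proj x"] by simp
    then show "x \<in> cball 0 (b + 1)" using x b[of "proj x"] by (simp add: norm_diff_proj layer_def)
  qed
  then have "bounded {x \<in> layer 0 1. proj x \<in> E}" using bounded_cball bounded_subset by blast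
  then show ?thesis by (rule emeasure_bounded_finite)
qed

text \<open>The derivative of \<open>f\<close> in direction \<open>e\<close>, integrated over \<open>h < 0\<close>, is the limit of integrals of \<open>f\<close>
  over the difference of \<open>h < 0\<close> and its translates, which lies in a thin layer around the graph.\<close>

lemma integral_derivative_below_graph:
  assumes f: "test_function UNIV f"
  shows "ennreal \<bar>LINT x|lebesgue. indicator {x. h x < 0} x * frechet_derivative f (at x) e\<bar>
     \<le> ennreal (L * norm e + 1) * (3 * (\<integral>\<^sup>+x\<in>layer 0 1. ennreal \<bar>f (proj x)\<bar> \<partial>lborel))"
proof -
  \<comment> \<open>A translation by s e changes \<open>h\<close> by at most M s; the summand 1
    permits division by \<open>M\<close>.\<close>
  define M where "M = L * norm e + 1"
  have M: "1 \<le> M" using L_nonneg by (simp add: M_def)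
  define S where "S = {x. h x < 0}"
  note C = test_function_C1[OF f]
  have mf [measurable]: "f \<in> borel_measurable borel" by (rule borel_measurable_continuous_onI[OF C1_continuous[OF C]])
  have mS [measurable]: "S \<in> sets borel" unfolding S_def by measurable
  obtain \<rho> where \<rho>: "0 \<le> \<rho>" "\<And>x. \<rho> < norm x \<Longrightarrow> f x = 0"
    using test_function_bounds[OF f] by metis
  obtain Lf where Lf: "0 \<le> Lf" "\<And>x. \<bar>frechet_derivative f (at x) N\<bar> \<le> Lf"
    using test_function_bounds[OF f] by metis
  define B where "B = cball (0::real^3) (\<rho> + norm e)"
  define T where "T = (\<integral>\<^sup>+x\<in>layer 0 1. ennreal \<bar>f (proj x)\<bar> \<partial>lborel)"
  define E where "E = {x \<in> layer 0 1. proj x \<in> cball 0 (\<rho> + 1)}"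
  have [measurable]: "E \<in> sets borel" unfolding E_def by (rule layer_proj_measurable) simp
  have fin: "emeasure lborel E < \<infinity>" unfolding E_def by (rule emeasure_layer_proj_bounded) auto
  define D where "D = (LINT x|lebesgue. indicator S x * frechet_derivative f (at x) e)"
  \<comment> \<open>The region below the graph is not of finite measure; intersecting with
    \<open>B\<close> gives an \<open>L2\<close> indicator and loses nothing, since \<open>B\<close>
    contains the support of every translate with |s| at most 1.\<close>
  define G where "G = (\<lambda>s. LINT x|lebesgue. indicator (S \<inter> B) x * f (x + s *\<^sub>R e))"
  have zero: "f (x + s *\<^sub>R e) = 0" if "x \<notin> B" "\<bar>s\<bar> \<le> 1" for x s
  proof (rule \<rho>(2))
    have "norm x \<le> norm (x + s *\<^sub>R e) + \<bar>s\<bar> * norm e"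
      using norm_triangle_ineq4[of "x + s *\<^sub>R e" "s *\<^sub>R e"] by simp
    moreover have "\<bar>s\<bar> * norm e \<le> 1 * norm e" using that by (intro mult_right_mono) auto
    ultimately show "\<rho> < norm (x + s *\<^sub>R e)" using that by (simp add: B_def)
  qed
  have "(G has_real_derivative (LINT x|lebesgue. indicator (S \<inter> B) x * frechet_derivative f (at x) e)) (at 0)"
    unfolding G_def
  proof (rule L2_translate_test_deriv_0[OF L2_indicator f])
    show "S \<inter> B \<in> lmeasurable" by (intro bounded_set_imp_lmeasurable) (auto simp: B_def intro: bounded_subset[OF bounded_cball])
  qed
  moreover have "(LINT x|lebesgue. indicator (S \<inter> B) x * frechet_derivative f (at x) e) = D"
    unfolding D_def
  proof (intro Bochner_Integration.integral_cong refl)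
    fix x
    have "frechet_derivative f (at x) e = 0" if "x \<notin> B"
      by (rule frechet_derivative_outside_support[OF C, of B]) (use zero[of _ 0] that in \<open>auto simp: B_def\<close>)
    then show "indicator (S \<inter> B) x * frechet_derivative f (at x) e = indicator S x * frechet_derivative f (at x) e"
      by (auto simp: indicator_def)
  qed
  ultimately have GD: "(\<lambda>s. (G (0 + s) - G 0) / s) \<midarrow>0\<rightarrow> D" by (simp add: DERIV_def)
  have int_f: "integrable lebesgue f"
    using continuous_compact_support_L2(2)[OF C1_continuous[OF C], of "cball 0 \<rho>"] \<rho> by auto
  have Gdiff: "ennreal \<bar>G s - G 0\<bar> \<le> (\<integral>\<^sup>+x\<in>{x. \<bar>h x\<bar> \<le> M * s}. ennreal \<bar>f x\<bar> \<partial>lborel)" if s: "0 < s" "s \<le> 1" for s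
  proof -
    \<comment> \<open>The change of variables moves the translation from \<open>f\<close> to the
      region, so the difference of \<open>G s\<close> and \<open>G 0\<close> sees only points where
      the indicators of the region and its translate differ.\<close>
    define k where "k = (\<lambda>x. indicator S (x - s *\<^sub>R e) * f x)"
    have [measurable]: "k \<in> borel_measurable borel"
    proof -
      have "(\<lambda>x. indicator S (x + (- (s *\<^sub>R e))) :: real) \<in> borel_measurable borel"
        by (rule measurable_translate_borel) simp
      then have "(\<lambda>x. indicator S (x - s *\<^sub>R e) :: real) \<in> borel_measurable borel" by simp
      then show ?thesis unfolding k_def by measurable
    qed
    have km: "k \<in> borel_measurable lebesgue" by (intro measurable_completion) simp
    have ki: "integrable lebesgue k"
      by (rule Bochner_Integration.integrable_bound[OF int_f km]) (auto simp: k_def indicator_def)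
    have ji: "integrable lebesgue (\<lambda>x. indicator S x * f x)"
    proof (rule Bochner_Integration.integrable_bound[OF int_f])
      have "(\<lambda>x. indicator S x * f x) \<in> borel_measurable borel" by measurable
      then show "(\<lambda>x. indicator S x * f x) \<in> borel_measurable lebesgue" by (intro measurable_completion) simp
    qed (auto simp: indicator_def)
    have "G s = (LINT x|lebesgue. k (x + s *\<^sub>R e))"
      unfolding G_def k_def using zero[of _ s] s
      by (intro Bochner_Integration.integral_cong) (auto simp: indicator_def)
    also have "\<dots> = (LINT x|lebesgue. k x)" by (rule integral_translate(1)[OF km])
    finally have Gs: "G s = (LINT x|lebesgue. k x)" .
    have G0: "G 0 = (LINT x|lebesgue. indicator S x * f x)"
      unfolding G_def using zero[of _ 0]
      by (intro Bochner_Integration.integral_cong) (auto simp: indicator_def)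
    have "G s - G 0 = (LINT x|lebesgue. k x - indicator S x * f x)" using ki ji by (simp add: Gs G0)
    then have "ennreal \<bar>G s - G 0\<bar> \<le> ennreal (LINT x|lebesgue. \<bar>k x - indicator S x * f x\<bar>)"
      by (intro ennreal_leI) (simp add: integral_abs_bound)
    also have "\<dots> = (\<integral>\<^sup>+x. ennreal \<bar>k x - indicator S x * f x\<bar> \<partial>lebesgue)"
      using ki ji by (intro nn_integral_eq_integral[symmetric]) auto
    also have "\<dots> = (\<integral>\<^sup>+x. ennreal \<bar>k x - indicator S x * f x\<bar> \<partial>lborel)" by (rule nn_integral_completion)
    also have "\<dots> \<le> (\<integral>\<^sup>+x\<in>{x. \<bar>h x\<bar> \<le> M * s}. ennreal \<bar>f x\<bar> \<partial>lborel)"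
    proof (intro nn_integral_mono)
      fix x
      have d: "\<bar>h x - h (x - s *\<^sub>R e)\<bar> \<le> M * s"
      proof -
        have "\<bar>h x - h (x - s *\<^sub>R e)\<bar> \<le> L * (s * norm e)" using lip[of x "x - s *\<^sub>R e"] s by (simp add: dist_norm)
        also have "\<dots> \<le> M * s" using s by (simp add: M_def algebra_simps)
        finally show ?thesis .
      qed
      have "indicator S (x - s *\<^sub>R e) = (indicator S x :: real)" if "\<not> \<bar>h x\<bar> \<le> M * s"
        using d that by (auto simp: indicator_def S_def)
      then show "ennreal \<bar>k x - indicator S x * f x\<bar> \<le> ennreal \<bar>f x\<bar> * indicator {x. \<bar>h x\<bar> \<le> M * s} x"
        by (cases "\<bar>h x\<bar> \<le> M * s") (auto simp: k_def indicator_def)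
    qed
    finally show ?thesis .
  qed
  \<comment> \<open>Chosen so that the layer of half-height M s n is exactly the one of
    \<open>nn_integral_thin_layer\<close> with n + 1; dividing by \<open>s n\<close> then produces
    the factor n + 1 that lemma absorbs.\<close>
  define s where "s = (\<lambda>n::nat. inverse (real (Suc n)) / M)"
  have s0: "0 < s n" "s n \<le> 1" "M * s n = 1 / real (Suc n)" "1 / s n = real (Suc n) * M" for n
  proof -
    have inv: "0 < inverse (real (Suc n))" "inverse (real (Suc n)) \<le> 1" by (simp_all add: inverse_le_1_iff)
    show "0 < s n" using M inv(1) by (simp add: s_def)
    show "s n \<le> 1" using M inv(2) unfolding s_def by (subst divide_le_eq_1_pos) linarith+
    show "M * s n = 1 / real (Suc n)" "1 / s n = real (Suc n) * M"
      using M by (simp_all add: s_def divide_inverse)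
  qed
  have slim: "s \<longlonglongrightarrow> 0" unfolding s_def
    using tendsto_divide[OF LIMSEQ_inverse_real_of_nat tendsto_const[of M]] M by simp
  have upper: "ennreal \<bar>(G (s n) - G 0) / s n\<bar> \<le> ennreal M * (3 * (T + ennreal (Lf / real (Suc n)) * emeasure lborel E))" for n
  proof -
    define m where "m = Suc n"
    \<comment> \<open>On the thin layer \<open>f\<close> may be evaluated on the graph at the cost
      of Lf / m, by the Lipschitz bound along \<open>N\<close>. The error lives over a bounded set,
      hence on the set \<open>E\<close> of finite volume, and disappears in the limit.\<close>
    define g where "g = (\<lambda>y. ennreal \<bar>f y\<bar> + ennreal (Lf / m) * indicator (cball 0 (\<rho> + 1)) y)"
    have [measurable]: "cball (0::real^3) (\<rho> + 1) \<in> sets borel" by simp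
    have g: "g \<in> borel_measurable borel" unfolding g_def by measurable
    have "ennreal \<bar>G (s n) - G 0\<bar> \<le> (\<integral>\<^sup>+x\<in>{x. \<bar>h x\<bar> \<le> 1 / real m}. ennreal \<bar>f x\<bar> \<partial>lborel)"
      using Gdiff[OF s0(1,2), of n] unfolding s0(3) m_def .
    also have "\<dots> \<le> (\<integral>\<^sup>+x\<in>{x. \<bar>h x\<bar> \<le> 1 / real m}. g (proj x) \<partial>lborel)"
    proof (intro nn_integral_mono)
      fix x
      have "ennreal \<bar>f x\<bar> \<le> g (proj x)" if hx: "\<bar>h x\<bar> \<le> 1 / real m"
      proof (cases "f x = 0")
        case False
        then have nx: "norm x \<le> \<rho>" using \<rho>(2)[of x] by fastforce
        have "1 / real m \<le> 1" by (simp add: m_def)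
        moreover have "norm (proj x) \<le> norm x + norm (x - proj x)"
          using norm_triangle_ineq4[of x "x - proj x"] by simp
        ultimately have px: "proj x \<in> cball 0 (\<rho> + 1)" using nx hx by (simp add: norm_diff_proj)
        have "proj x + h x *\<^sub>R N = x" by (simp add: proj_def)
        then have "\<bar>f x - f (proj x)\<bar> \<le> Lf * \<bar>h x\<bar>" using C1_line_lipschitz[OF C Lf(2), of "proj x" "h x"] by simp
        also have "\<dots> \<le> Lf * (1 / m)" using hx Lf(1) by (intro mult_left_mono)
        finally have "\<bar>f x\<bar> \<le> \<bar>f (proj x)\<bar> + Lf / m" by simp
        then have "ennreal \<bar>f x\<bar> \<le> ennreal (\<bar>f (proj x)\<bar> + Lf / m)" by (rule ennreal_leI)
        also have "\<dots> = g (proj x)" using px Lf(1) by (simp add: g_def)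
        finally show ?thesis .
      qed simp
      then show "ennreal \<bar>f x\<bar> * indicator {x. \<bar>h x\<bar> \<le> 1 / real m} x \<le> g (proj x) * indicator {x. \<bar>h x\<bar> \<le> 1 / real m} x"
        by (auto simp: indicator_def)
    qed
    finally have le: "of_nat m * ennreal \<bar>G (s n) - G 0\<bar> \<le> of_nat m * (\<integral>\<^sup>+x\<in>{x. \<bar>h x\<bar> \<le> 1 / real m}. g (proj x) \<partial>lborel)"
      by (rule mult_left_mono) simp
    also have "\<dots> \<le> 3 * (\<integral>\<^sup>+x\<in>layer 0 1. g (proj x) \<partial>lborel)" by (rule nn_integral_thin_layer[OF g]) (simp add: m_def)
    also have "(\<integral>\<^sup>+x\<in>layer 0 1. g (proj x) \<partial>lborel) =
        (\<integral>\<^sup>+x. ennreal \<bar>f (proj x)\<bar> * indicator (layer 0 1) x + ennreal (Lf / m) * indicator E x \<partial>lborel)"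
      by (intro nn_integral_cong) (auto simp: g_def E_def indicator_def distrib_right)
    also have "\<dots> = T + ennreal (Lf / m) * emeasure lborel E"
      unfolding T_def by (subst nn_integral_add) (auto simp: nn_integral_cmult_indicator)
    finally have *: "of_nat m * ennreal \<bar>G (s n) - G 0\<bar> \<le> 3 * (T + ennreal (Lf / m) * emeasure lborel E)" .
    have "\<bar>(G (s n) - G 0) / s n\<bar> = M * (real m * \<bar>G (s n) - G 0\<bar>)"
    proof -
      have "\<bar>(G (s n) - G 0) / s n\<bar> = (1 / s n) * \<bar>G (s n) - G 0\<bar>" using s0(1)[of n] by (simp add: abs_divide)
      then show ?thesis unfolding s0(4) m_def by simp
    qed
    then have "ennreal \<bar>(G (s n) - G 0) / s n\<bar> = ennreal M * (of_nat m * ennreal \<bar>G (s n) - G 0\<bar>)"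
      using M by (simp add: ennreal_mult ennreal_of_nat_eq_real_of_nat)
    also have "\<dots> \<le> ennreal M * (3 * (T + ennreal (Lf / m) * emeasure lborel E))"
      by (rule mult_left_mono[OF *]) simp
    finally show ?thesis by (simp add: m_def)
  qed
  have "(\<lambda>n. ennreal \<bar>(G (s n) - G 0) / s n\<bar>) \<longlonglongrightarrow> ennreal \<bar>D\<bar>"
  proof (intro tendsto_ennrealI tendsto_rabs)
    have "((\<lambda>s. (G (0 + s) - G 0) / s) \<circ> s) \<longlonglongrightarrow> D"
      using GD[unfolded tendsto_at_iff_sequentially, rule_format, of s] slim s0(1) by (metis DiffI UNIV_I less_irrefl singletonD)
    then show "(\<lambda>n. (G (s n) - G 0) / s n) \<longlonglongrightarrow> D" by (simp add: o_def)
  qed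
  moreover have "(\<lambda>n. ennreal M * (3 * (T + ennreal (Lf / real (Suc n)) * emeasure lborel E))) \<longlonglongrightarrow> ennreal M * (3 * (T + 0))"
  proof (intro ennreal_tendsto_cmult tendsto_add tendsto_const)
    obtain v where v: "emeasure lborel E = ennreal v" "0 \<le> v" using fin by (cases "emeasure lborel E") auto
    have "(\<lambda>n. ennreal (Lf * inverse (real (Suc n)) * v)) \<longlonglongrightarrow> ennreal (Lf * 0 * v)"
      by (intro tendsto_ennrealI tendsto_intros LIMSEQ_inverse_real_of_nat)
    then show "(\<lambda>n. ennreal (Lf / real (Suc n)) * emeasure lborel E) \<longlonglongrightarrow> 0"
      using Lf(1) v(2) by (simp add: v(1) divide_inverse ennreal_mult)
  qed auto
  ultimately have "ennreal \<bar>D\<bar> \<le> ennreal M * (3 * (T + 0))"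
    by (rule LIMSEQ_le) (intro exI[of _ 0] allI impI upper)
  then show ?thesis by (simp add: D_def M_def T_def S_def)
qed

text \<open>The layer estimate is applied to \<phi> n times \<psi>. Cauchy-Schwarz on the unit layer
  separates the \<phi> n part, controlled by the boundary integral, from the fixed finite quantity
  \<open>W\<close> of \<psi>.\<close>

lemma integral_derivative_tendsto_0:
  assumes \<Omega>: "open \<Omega>" "\<Omega> \<inter> ball p r = {x \<in> ball p r. h x < 0}"
    and \<psi>: "test_function (ball p r) \<psi>" and \<phi>: "\<And>n::nat. C1 (\<phi> n)"
    and lim: "(\<lambda>n. \<integral>\<^sup>+x\<in>frontier \<Omega>. ennreal ((\<phi> n x)\<^sup>2) \<partial>surface_measure) \<longlonglongrightarrow> 0"
  shows "(\<lambda>n. LINT x|lebesgue_on \<Omega>. frechet_derivative (\<lambda>x. \<phi> n x * \<psi> x) (at x) e) \<longlonglongrightarrow> 0"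
proof -
  define f where "f = (\<lambda>n x. \<phi> n x * \<psi> x)"
  have tf: "test_function (ball p r) (f n)" for n unfolding f_def by (rule test_function_mult(1)[OF \<psi> \<phi>])
  have tfU: "test_function UNIV (f n)" for n by (rule test_function_mono[OF tf]) simp
  have [measurable]: "\<phi> n \<in> borel_measurable borel" for n by (rule borel_measurable_continuous_onI[OF C1_continuous[OF \<phi>]])
  have [measurable]: "\<psi> \<in> borel_measurable borel" by (rule borel_measurable_continuous_onI[OF C1_continuous[OF test_function_C1[OF \<psi>]]])
  have so: "\<Omega> \<in> sets lebesgue" using \<Omega> by auto
  obtain K where K: "compact K" "K \<subseteq> ball p r" "\<And>x. x \<notin> K \<Longrightarrow> \<psi> x = 0" using \<psi> by (auto simp: test_function_def)
  obtain Mp where Mp: "0 \<le> Mp" "\<And>x. norm (\<psi> x) \<le> Mp"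
    using compact_support_bounded[OF C1_continuous[OF test_function_C1[OF \<psi>]] K(1,3)] by metis
  define I where "I = (\<lambda>n. LINT x|lebesgue_on \<Omega>. frechet_derivative (f n) (at x) e)"
  have I: "I n = (LINT x|lebesgue. indicator {x. h x < 0} x * frechet_derivative (f n) (at x) e)" for n
  proof -
    have "I n = (LINT x|lebesgue. indicator \<Omega> x * frechet_derivative (f n) (at x) e)"
      unfolding I_def using lebesgue_on_integral_indicator(1)[of UNIV \<Omega> "\<lambda>x. frechet_derivative (f n) (at x) e"] so
      by (simp add: lebesgue_on_UNIV_eq)
    also have "\<dots> = (LINT x|lebesgue. indicator {x. h x < 0} x * frechet_derivative (f n) (at x) e)"
    proof (intro Bochner_Integration.integral_cong refl)
      fix x
      have "frechet_derivative (f n) (at x) e = 0" if "x \<notin> ball p r"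
        by (rule frechet_derivative_outside_support[OF test_function_C1[OF tf] compact_imp_closed[OF K(1)]])
          (use K that in \<open>auto simp: f_def\<close>)
      moreover have "x \<in> \<Omega> \<longleftrightarrow> h x < 0" if "x \<in> ball p r" using \<Omega>(2) that by blast
      ultimately show "indicator \<Omega> x * frechet_derivative (f n) (at x) e = indicator {x. h x < 0} x * frechet_derivative (f n) (at x) e"
        by (cases "x \<in> ball p r") (auto simp: indicator_def)
    qed
    finally show ?thesis .
  qed
  \<comment> \<open>Only this inclusion matters, since the surface integral is needed as an upper
    bound. Points of the graph are outside \<Omega> but are limits of points moved slightly along
    -N, which lie in \<Omega>.\<close>
  have graph_sub: "{x. h x = 0} \<inter> ball p r \<subseteq> frontier \<Omega>"
  proof
    fix x assume x: "x \<in> {x. h x = 0} \<inter> ball p r"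
    then have "x \<notin> \<Omega>" using \<Omega>(2) by force
    moreover have "x \<in> closure \<Omega>"
      unfolding closure_sequential
    proof (intro exI conjI allI)
      define R where "R = r - dist p x"
      have R: "R > 0" using x by (simp add: R_def)
      define t where "t = (\<lambda>n::nat. (R / 2) * inverse (real (Suc n)))"
      have t: "0 < t n" "t n < R" for n
      proof -
        show "0 < t n" using R by (simp add: t_def)
        have "inverse (real (Suc n)) \<le> 1" by (simp add: inverse_le_1_iff)
        then have "t n \<le> (R / 2) * 1" unfolding t_def using R by (intro mult_left_mono) auto
        then show "t n < R" using R by simp
      qed
      show "x + (- t n) *\<^sub>R N \<in> \<Omega>" for n
      proof -
        have "dist p (x + (- t n) *\<^sub>R N) \<le> dist p x + dist x (x + (- t n) *\<^sub>R N)" by (rule dist_triangle)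
        also have "dist x (x + (- t n) *\<^sub>R N) = t n" using t(1)[of n] by (simp add: dist_norm norm_N)
        finally have "x + (- t n) *\<^sub>R N \<in> ball p r" using t(2)[of n] by (simp add: R_def)
        moreover have "h (x + (- t n) *\<^sub>R N) < 0" using x t(1)[of n] shift[of x "- t n"] by simp
        ultimately show ?thesis using \<Omega>(2) by blast
      qed
      have "(\<lambda>n. x + (- ((R / 2) * inverse (real (Suc n)))) *\<^sub>R N) \<longlonglongrightarrow> x + (- ((R / 2) * 0)) *\<^sub>R N"
        by (intro tendsto_intros LIMSEQ_inverse_real_of_nat)
      then show "(\<lambda>n. x + (- t n) *\<^sub>R N) \<longlonglongrightarrow> x" by (simp add: t_def)
    qed
    ultimately show "x \<in> frontier \<Omega>" using \<Omega>(1) by (simp add: frontier_def interior_open)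
  qed
  have [measurable]: "ball p r \<in> sets borel" by simp
  define c where "c = ennreal (64 * unit_ball_vol 3 / pi)"
  define a where "a = (\<lambda>n. \<integral>\<^sup>+x\<in>frontier \<Omega>. ennreal ((\<phi> n x)\<^sup>2) \<partial>surface_measure)"
  define T where "T = (\<lambda>n. \<integral>\<^sup>+x\<in>layer 0 1. ennreal \<bar>f n (proj x)\<bar> \<partial>lborel)"
  define W where "W = (\<integral>\<^sup>+x. (ennreal \<bar>\<psi> (proj x)\<bar> * indicator (layer 0 1) x)\<^sup>2 \<partial>lborel)"
  define E where "E = {x \<in> layer 0 1. proj x \<in> ball p r}"
  have [measurable]: "E \<in> sets borel" unfolding E_def by (rule layer_proj_measurable) simp
  have W: "W < \<infinity>"
  proof -
    have "W \<le> (\<integral>\<^sup>+x. ennreal (Mp\<^sup>2) * indicator E x \<partial>lborel)"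
      unfolding W_def
    proof (rule nn_integral_mono)
      fix x
      have "(ennreal \<bar>\<psi> (proj x)\<bar>)\<^sup>2 \<le> ennreal (Mp\<^sup>2)"
        using Mp(2)[of "proj x"] by (subst ennreal_power) (auto intro!: ennreal_leI abs_le_square_iff[THEN iffD1])
      moreover have "\<psi> (proj x) = 0" if "proj x \<notin> ball p r" using K that by blast
      ultimately show "(ennreal \<bar>\<psi> (proj x)\<bar> * indicator (layer 0 1) x)\<^sup>2 \<le> ennreal (Mp\<^sup>2) * indicator E x"
        by (cases "proj x \<in> ball p r") (auto simp: E_def indicator_def simp del: mem_ball)
    qed
    also have "\<dots> = ennreal (Mp\<^sup>2) * emeasure lborel E" by (rule nn_integral_cmult_indicator) simp
    also have "\<dots> < \<infinity>" using emeasure_layer_proj_bounded[of "ball p r"] by (simp add: E_def ennreal_mult_less_top)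
    finally show ?thesis .
  qed
  have T2: "(T n)\<^sup>2 \<le> c * a n * W" for n
  proof -
    \<comment> \<open>The indicator of the ball is inserted because the graph is known to lie in the
      frontier only there; the support of \<psi> makes it harmless.\<close>
    define F where "F = (\<lambda>x. ennreal \<bar>\<phi> n (proj x)\<bar> * indicator (ball p r) (proj x) * indicator (layer 0 1) x)"
    have [measurable]: "(\<lambda>x. indicator (ball p r) (proj x) :: ennreal) \<in> borel_measurable borel"
      by (rule measurable_compose[OF measurable_proj borel_measurable_indicator]) simp
    have [measurable]: "F \<in> borel_measurable borel" unfolding F_def by measurable
    have "T n = (\<integral>\<^sup>+x. F x * (ennreal \<bar>\<psi> (proj x)\<bar> * indicator (layer 0 1) x) \<partial>lborel)"
      unfolding T_def
    proof (intro nn_integral_cong)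
      fix x
      have "\<psi> (proj x) = 0" if "proj x \<notin> ball p r" using K that by blast
      then show "ennreal \<bar>f n (proj x)\<bar> * indicator (layer 0 1) x = F x * (ennreal \<bar>\<psi> (proj x)\<bar> * indicator (layer 0 1) x)"
        by (cases "proj x \<in> ball p r") (auto simp: f_def F_def indicator_def abs_mult ennreal_mult simp del: mem_ball)
    qed
    then have "(T n)\<^sup>2 \<le> (\<integral>\<^sup>+x. (F x)\<^sup>2 \<partial>lborel) * W"
      unfolding W_def by (simp only:) (rule Cauchy_Schwarz_nn_integral, auto)
    also have "(\<integral>\<^sup>+x. (F x)\<^sup>2 \<partial>lborel) = (\<integral>\<^sup>+x\<in>layer 0 1. (\<lambda>y. ennreal ((\<phi> n y)\<^sup>2) * indicator (ball p r) y) (proj x) \<partial>lborel)"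
      by (intro nn_integral_cong) (auto simp: F_def indicator_def ennreal_power)
    also have "\<dots> \<le> c * (\<integral>\<^sup>+x\<in>{x. h x = 0}. ennreal ((\<phi> n x)\<^sup>2) * indicator (ball p r) x \<partial>surface_measure)"
      unfolding c_def by (rule nn_integral_layer_le_surface) measurable
    also have "\<dots> \<le> c * a n"
      unfolding a_def using graph_sub by (intro mult_left_mono nn_integral_mono) (auto simp: indicator_def)
    finally show ?thesis by (simp add: mult_right_mono)
  qed
  define d where "d = ennreal (L * norm e + 1) * 3"
  have "ennreal ((I n)\<^sup>2) \<le> (d\<^sup>2 * c * W) * a n" for n
  proof -
    have "ennreal \<bar>I n\<bar> \<le> d * T n"
      using integral_derivative_below_graph[OF tfU, of n e] unfolding I T_def d_def by (simp add: mult.assoc)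
    then have "(ennreal \<bar>I n\<bar>)\<^sup>2 \<le> (d * T n)\<^sup>2" by (rule power_mono) simp
    also have "\<dots> = d\<^sup>2 * (T n)\<^sup>2" by (rule power_mult_distrib)
    also have "\<dots> \<le> d\<^sup>2 * (c * a n * W)" by (rule mult_left_mono[OF T2]) simp
    finally show ?thesis by (simp add: ennreal_power ac_simps)
  qed
  moreover have "(\<lambda>n. (d\<^sup>2 * c * W) * a n) \<longlonglongrightarrow> (d\<^sup>2 * c * W) * 0"
  proof (rule ennreal_tendsto_cmult)
    show "d\<^sup>2 * c * W < top" using W by (simp add: ennreal_mult_less_top c_def d_def power_less_top_ennreal)
    show "a \<longlonglongrightarrow> 0" unfolding a_def by (rule lim)
  qed
  ultimately have "(\<lambda>n. ennreal ((I n)\<^sup>2)) \<longlonglongrightarrow> 0"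
    by (intro tendsto_sandwich[of "\<lambda>_. 0" "\<lambda>n. ennreal ((I n)\<^sup>2)" sequentially "\<lambda>n. (d\<^sup>2 * c * W) * a n"]) auto
  then have "(\<lambda>n. (I n)\<^sup>2) \<longlonglongrightarrow> 0"
    by (subst (asm) ennreal_0[symmetric], subst (asm) tendsto_ennreal_iff) auto
  then have "(\<lambda>n. sqrt ((I n)\<^sup>2)) \<longlonglongrightarrow> sqrt 0" by (intro tendsto_intros)
  then have "I \<longlonglongrightarrow> 0" by (simp add: tendsto_rabs_zero_iff)
  then show ?thesis by (simp add: I_def f_def)
qed

end

text \<open>\<open>h\<close> is the third rotated coordinate minus \<gamma> of the other two, and
  \<open>N\<close> is the preimage of the third basis vector. The 2 in the Lipschitz constant is
  from estimating a plane norm by the sum of its two components.\<close>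

lemma lipschitz_domain_graph:
  assumes "lipschitz_domain D" "p \<in> frontier D"
  obtains r h N L where "0 < r" "lipschitz_graph h N L" "D \<inter> ball p r = {x \<in> ball p r. h x < 0}"
proof -
  obtain r and R :: "real^3 \<Rightarrow> real^3" and \<gamma> L where r: "r > 0" and R: "orthogonal_transformation R" and \<gamma>: "L-lipschitz_on UNIV (\<gamma> :: real^2 \<Rightarrow> real)"
    and D: "D \<inter> ball p r = {x \<in> ball p r. R x $ 3 < \<gamma> (vector [R x $ 1, R x $ 2])}"
    using assms unfolding lipschitz_domain_def by blast
  define h where "h = (\<lambda>x. R x $ 3 - \<gamma> (vector [R x $ 1, R x $ 2]))"
  have lin: "linear R" and nR: "norm (R x) = norm x" for x
    using R by (auto simp: orthogonal_transformation)
  obtain N where N: "R N = axis 3 1" using orthogonal_transformation_surj[OF R] by (metis surjD)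
  have "lipschitz_graph h N (1 + L * 2)"
  proof
    fix x y :: "real^3" and s :: real
    have L: "0 \<le> L" using \<gamma> by (auto simp: lipschitz_on_def)
    have comp: "\<bar>R x $ i - R y $ i\<bar> \<le> dist x y" for i
      using component_le_norm_cart[of "R x - R y" i] nR[of "x - y"] by (simp add: linear_diff[OF lin] dist_norm)
    have "\<bar>\<gamma> (vector [R x $ 1, R x $ 2]) - \<gamma> (vector [R y $ 1, R y $ 2])\<bar>
        \<le> L * norm (vector [R x $ 1, R x $ 2] - vector [R y $ 1, R y $ 2] :: real^2)"
      using lipschitz_onD[OF \<gamma>] by (simp add: dist_norm)
    also have "\<dots> \<le> L * (2 * dist x y)"
    proof (rule mult_left_mono[OF _ L])
      have "norm (vector [R x $ 1, R x $ 2] - vector [R y $ 1, R y $ 2] :: real^2)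
         \<le> (\<Sum>i\<in>UNIV. \<bar>(vector [R x $ 1, R x $ 2] - vector [R y $ 1, R y $ 2] :: real^2) $ i\<bar>)"
        by (rule norm_le_l1_cart)
      also have "\<dots> \<le> 2 * dist x y" using comp[of 1] comp[of 2] by (simp add: sum_2)
      finally show "norm (vector [R x $ 1, R x $ 2] - vector [R y $ 1, R y $ 2] :: real^2) \<le> 2 * dist x y" .
    qed
    finally show "\<bar>h x - h y\<bar> \<le> (1 + L * 2) * dist x y"
      using comp[of 3] unfolding h_def by (simp add: algebra_simps)
    show "h (x + s *\<^sub>R N) = h x + s"
      by (simp add: h_def linear_add[OF lin] linear_scale[OF lin] N axis_def)
    show "norm N = 1" using nR[of N] N by (simp add: norm_axis_axis)
  qed
  moreover have "D \<inter> ball p r = {x \<in> ball p r. h x < 0}" by (simp add: D h_def)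
  ultimately show ?thesis using that r by blast
qed

section \<open>Extension by zero\<close>

lemma frechet_derivative_add:
  "C1 f \<Longrightarrow> C1 g \<Longrightarrow> frechet_derivative (\<lambda>x. f x + g x) (at x) v = frechet_derivative f (at x) v + frechet_derivative g (at x) v"
  by (simp add: frechet_derivative_eq[OF has_derivative_add[OF C1_has_derivative C1_has_derivative]])

lemma test_function_UNIV_L2_on:
  assumes "A \<in> sets lebesgue" "test_function UNIV \<psi>"
  shows "\<psi> \<in> L2 A" "(\<lambda>x. frechet_derivative \<psi> (at x) v) \<in> L2 A"
  using L2_mono(1)[OF _ assms(1) subset_UNIV] test_function_L2[OF assms(2)] by auto

lemma L2_inner_real: "L2_inner A f g = (LINT x|lebesgue_on A. f x * g x)" for f g :: "real^3 \<Rightarrow> real"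
  by (simp add: L2_inner_def)

lemma L2_extend_real:
  fixes f g :: "real^3 \<Rightarrow> real"
  assumes "A \<in> sets lebesgue"
  shows "f \<in> L2 A \<Longrightarrow> (\<lambda>x. indicator A x * f x) \<in> L2 UNIV"
    and "L2_norm UNIV (\<lambda>x. indicator A x * f x) = L2_norm A f"
    and "L2_inner UNIV (\<lambda>x. indicator A x * f x) g = L2_inner A f g"
proof -
  show "f \<in> L2 A \<Longrightarrow> (\<lambda>x. indicator A x * f x) \<in> L2 UNIV"
    using L2_extend(1)[OF assms, of f] by simp
  show "L2_norm UNIV (\<lambda>x. indicator A x * f x) = L2_norm A f"
    using L2_extend(2)[OF assms, of f] by simp
  show "L2_inner UNIV (\<lambda>x. indicator A x * f x) g = L2_inner A f g"
    unfolding L2_inner_real using lebesgue_on_integral_indicator(1)[of UNIV A "\<lambda>x. f x * g x"] assms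
    by (simp add: mult.assoc)
qed

lemma weak_deriv_inner:
  assumes "weak_deriv A e U G" "test_function A \<psi>"
  shows "L2_inner A U (\<lambda>x. frechet_derivative \<psi> (at x) e) = - L2_inner A G \<psi>"
  using assms by (simp add: weak_deriv_def L2_inner_real)

text \<open>If the integration by parts formula holds for test functions supported in small balls around
  points of the closure, it holds for all test functions on the whole space: multiplying by the functions
  \<open>1 - \<beta> p\<close>, one for each ball of a finite cover, does not change the defect of the formula.\<close>

lemma weak_deriv_extend_by_zero:
  assumes \<Omega>: "open \<Omega>" "bounded \<Omega>" and U: "U \<in> L2 \<Omega>" and G: "G \<in> L2 \<Omega>"
    and local: "\<And>p. p \<in> closure \<Omega> \<Longrightarrow> \<exists>r>0. \<forall>\<psi>. test_function (ball p r) \<psi> \<longrightarrow>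
       L2_inner \<Omega> U (\<lambda>x. frechet_derivative \<psi> (at x) e) + L2_inner \<Omega> G \<psi> = 0"
  shows "weak_deriv UNIV e (\<lambda>x. indicator \<Omega> x * U x) (\<lambda>x. indicator \<Omega> x * G x)"
  unfolding weak_deriv_def
proof (intro allI impI)
  fix \<psi> :: "real^3 \<Rightarrow> real" assume \<psi>: "test_function UNIV \<psi>"
  have so: "\<Omega> \<in> sets lebesgue" using \<Omega> by auto
  \<comment> \<open>The defect of the integration by parts formula, additive in the test
    function.\<close>
  define T where "T = (\<lambda>\<psi>. L2_inner \<Omega> U (\<lambda>x. frechet_derivative \<psi> (at x) e) + L2_inner \<Omega> G \<psi>)"
  have tL: "\<psi> \<in> L2 \<Omega>" "(\<lambda>x. frechet_derivative \<psi> (at x) e) \<in> L2 \<Omega>" if "test_function UNIV \<psi>" for \<psi>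
    by (rule test_function_UNIV_L2_on[OF so that])+
  have T_add: "T (\<lambda>x. f x + g x) = T f + T g" if "test_function UNIV f" "test_function UNIV g" for f g
    unfolding T_def using tL[OF that(1)] tL[OF that(2)] U G
    by (simp add: frechet_derivative_add test_function_C1[OF that(1)] test_function_C1[OF that(2)] L2.form_add_right)
  obtain r where r: "\<And>p. p \<in> closure \<Omega> \<Longrightarrow> 0 < r p"
    and rT: "\<And>p \<psi>. p \<in> closure \<Omega> \<Longrightarrow> test_function (ball p (r p)) \<psi> \<Longrightarrow> T \<psi> = 0"
    using local unfolding T_def by metis
  \<comment> \<open>Equal to 1 on the half-size balls used for the cover, with support in a closed
    ball strictly inside the ball where the defect is known to vanish.\<close>
  have "\<exists>\<beta>. C1 \<beta> \<and> (\<forall>x\<in>cball p (r p / 2). \<beta> x = (1::real)) \<and> (\<forall>x. x \<notin> cball p (3 * r p / 4) \<longrightarrow> \<beta> x = 0)"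
    if "p \<in> closure \<Omega>" for p
  proof -
    have "0 \<le> r p / 2" "r p / 2 < 3 * r p / 4" using r[OF that] by auto
    from C1_cutoff[OF this, of p] show ?thesis by metis
  qed
  then obtain \<beta> where \<beta>: "\<And>p. p \<in> closure \<Omega> \<Longrightarrow> C1 (\<beta> p)"
    "\<And>p x. p \<in> closure \<Omega> \<Longrightarrow> x \<in> cball p (r p / 2) \<Longrightarrow> \<beta> p x = (1::real)"
    "\<And>p x. p \<in> closure \<Omega> \<Longrightarrow> x \<notin> cball p (3 * r p / 4) \<Longrightarrow> \<beta> p x = 0"
    by metis
  have "compact (closure \<Omega>)" using \<Omega>(2) by (simp add: compact_closure)
  then obtain P where P: "P \<subseteq> closure \<Omega>" "finite P" "closure \<Omega> \<subseteq> (\<Union>p\<in>P. ball p (r p / 2))"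
    by (rule compactE_image[of _ "closure \<Omega>" "\<lambda>p. ball p (r p / 2)"]) (use r in auto)
  have prod: "test_function UNIV (\<lambda>x. (\<Prod>p\<in>P'. 1 - \<beta> p x) * \<psi> x) \<and> T (\<lambda>x. (\<Prod>p\<in>P'. 1 - \<beta> p x) * \<psi> x) = T \<psi>"
    if "finite P'" "P' \<subseteq> closure \<Omega>" for P'
    using that
  proof (induction P' rule: finite_induct)
    case empty
    then show ?case using \<psi> by simp
  next
    case (insert p P')
    define f where "f = (\<lambda>x. (\<Prod>p\<in>P'. 1 - \<beta> p x) * \<psi> x)"
    have p: "p \<in> closure \<Omega>" and tf: "test_function UNIV f" and Tf: "T f = T \<psi>" using insert by (auto simp: f_def)
    have t1: "test_function UNIV (\<lambda>x. (1 - \<beta> p x) * f x)"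
      by (rule test_function_mult(1)[OF tf C1_diff[OF C1_const \<beta>(1)[OF p]]])
    have t2: "test_function (ball p (r p)) (\<lambda>x. \<beta> p x * f x)"
      by (rule test_function_mult(2)[OF test_function_ball[where p=p and R="3 * r p / 4", OF \<beta>(1)[OF p] \<beta>(3)[OF p]] test_function_C1[OF tf]])
        (use r[OF p] in auto)
    have "T f = T (\<lambda>x. (1 - \<beta> p x) * f x + \<beta> p x * f x)" by (simp add: left_diff_distrib)
    also have "\<dots> = T (\<lambda>x. (1 - \<beta> p x) * f x)"
      using T_add[OF t1 test_function_mono[OF t2]] rT[OF p t2] by simp
    also have "(\<lambda>x. (1 - \<beta> p x) * f x) = (\<lambda>x. (\<Prod>p\<in>insert p P'. 1 - \<beta> p x) * \<psi> x)"
      using insert by (simp add: f_def fun_eq_iff)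
    finally show ?case using t1 Tf insert by (simp add: f_def mult.assoc)
  qed
  define f where "f = (\<lambda>x. (\<Prod>p\<in>P. 1 - \<beta> p x) * \<psi> x)"
  have f: "test_function UNIV f" "T f = T \<psi>" using prod[OF P(2,1)] by (auto simp: f_def)
  \<comment> \<open>Each point lies in a half-size ball of the cover, where one factor vanishes; so
    the modified test function, which has the same defect as \<psi>, is zero throughout
    \<Omega>.\<close>
  have f0: "f x = 0" if "x \<in> \<Omega>" for x
  proof -
    have "x \<in> closure \<Omega>" using that closure_subset[of \<Omega>] by (rule rev_subsetD)
    then obtain p where "p \<in> P" "x \<in> ball p (r p / 2)" using subsetD[OF P(3)] by fast
    then have "1 - \<beta> p x = 0" using \<beta>(2)[of p x] P(1) by auto
    then have "(\<Prod>p\<in>P. 1 - \<beta> p x) = 0" using P(2) \<open>p \<in> P\<close> by (intro prod_zero) auto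
    then show ?thesis by (simp add: f_def)
  qed
  have df0: "frechet_derivative f (at x) e = 0" if "x \<in> \<Omega>" for x
    by (rule frechet_derivative_outside_support[OF test_function_C1[OF f(1)], of "- \<Omega>"]) (use \<Omega>(1) f0 that in auto)
  have "L2_inner \<Omega> U (\<lambda>x. frechet_derivative f (at x) e) = 0" "L2_inner \<Omega> G f = 0"
    unfolding L2_inner_real using f0 df0 by (auto intro!: integral_eq_zero_AE AE_I2)
  then have "T \<psi> = 0" using f(2) by (simp add: T_def)
  then show "(LINT x|lebesgue_on UNIV. indicator \<Omega> x * U x * frechet_derivative \<psi> (at x) e)
      = - (LINT x|lebesgue_on UNIV. indicator \<Omega> x * G x * \<psi> x)"
    unfolding T_def L2_inner_real[symmetric] L2_extend_real(3)[OF so] by simp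
qed

text \<open>One entry of the approximation in the definition of the trace. The explicit derivative
  error is identified almost everywhere with an entry of \<open>wgrad\<close> of the error by
  uniqueness, and so is controlled by the \<open>H1\<close> norm.\<close>

lemma V_component_approx:
  assumes \<Omega>: "open \<Omega>" "bounded \<Omega>" and v: "v \<in> V_space \<Omega>"
  obtains \<phi> where "\<And>n. C1 (\<phi> n)" "(\<lambda>n. L2_norm \<Omega> (\<lambda>x. \<phi> n x - v x $ i)) \<longlonglongrightarrow> 0"
    "(\<lambda>n. L2_norm \<Omega> (\<lambda>x. frechet_derivative (\<phi> n) (at x) (axis j 1) - wgrad \<Omega> v x $ i $ j)) \<longlonglongrightarrow> 0"
    "(\<lambda>n::nat. \<integral>\<^sup>+x\<in>frontier \<Omega>. ennreal ((\<phi> n x)\<^sup>2) \<partial>surface_measure) \<longlonglongrightarrow> 0"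
proof -
  have so: "\<Omega> \<in> sets lebesgue" using \<Omega> by auto
  interpret H1: form_space "H1 \<Omega>" "H1_inner \<Omega>" by (rule H1_form_space[OF \<Omega>(1)])
  have vH: "v \<in> H1 \<Omega>" using v by (simp add: V_space_def)
  obtain \<Phi> :: "nat \<Rightarrow> real^3 \<Rightarrow> real^3" where \<Phi>: "\<And>n. C1 (\<Phi> n)"
    and lim: "(\<lambda>n. H1_norm \<Omega> (\<lambda>x. \<Phi> n x - v x)) \<longlonglongrightarrow> 0"
    and bd: "(\<lambda>n. \<integral>\<^sup>+x\<in>frontier \<Omega>. ennreal ((norm (\<Phi> n x - 0))\<^sup>2) \<partial>surface_measure) \<longlonglongrightarrow> 0"
    using v unfolding V_space_def has_trace_def by blast
  define d where "d = (\<lambda>n x. \<Phi> n x - v x)"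
  have dH: "d n \<in> H1 \<Omega>" for n
    unfolding d_def by (intro H1.diff_in C1_H1 \<Phi> \<Omega> vH)
  have lim_d: "(\<lambda>n. H1_norm \<Omega> (d n)) \<longlonglongrightarrow> 0" using lim by (simp add: d_def)
  define \<phi> where "\<phi> = (\<lambda>n x. \<Phi> n x $ i)"
  have C: "C1 (\<phi> n)" for n unfolding \<phi>_def by (rule C1_component(1)[OF \<Phi>])
  have Lw: "(\<lambda>x. v x $ i) \<in> L2 \<Omega>" "(\<lambda>x. wgrad \<Omega> v x $ i $ j) \<in> L2 \<Omega>"
    by (rule L2_vec_component(1)[OF H1_L2[OF vH]] L2_mat_component(1)[OF wgrad_L2[OF vH]])+
  have L\<phi>: "\<phi> n \<in> L2 \<Omega>" "(\<lambda>x. frechet_derivative (\<phi> n) (at x) (axis j 1)) \<in> L2 \<Omega>" for n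
    by (intro continuous_bounded_L2[OF _ \<Omega>(2) so] C1_continuous C1_continuous_deriv C)+
  have 1: "(\<lambda>n. L2_norm \<Omega> (\<lambda>x. \<phi> n x - v x $ i)) \<longlonglongrightarrow> 0"
  proof (rule Lim_null_comparison[OF _ lim_d])
    have "L2_norm \<Omega> (\<lambda>x. \<phi> n x - v x $ i) \<le> H1_norm \<Omega> (d n)" for n
      using order_trans[OF L2_vec_component(2)[OF H1_L2[OF dH[of n]], of i] H1_norm_ge(1)] by (simp add: d_def \<phi>_def)
    then show "\<forall>\<^sub>F n in sequentially. norm (L2_norm \<Omega> (\<lambda>x. \<phi> n x - v x $ i)) \<le> H1_norm \<Omega> (d n)"
      by (simp add: L2_norm_nonneg)
  qed
  have 2: "(\<lambda>n. L2_norm \<Omega> (\<lambda>x. frechet_derivative (\<phi> n) (at x) (axis j 1) - wgrad \<Omega> v x $ i $ j)) \<longlonglongrightarrow> 0"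
  proof (rule Lim_null_comparison[OF _ lim_d])
    have "L2_norm \<Omega> (\<lambda>x. frechet_derivative (\<phi> n) (at x) (axis j 1) - wgrad \<Omega> v x $ i $ j) \<le> H1_norm \<Omega> (d n)" for n
    proof -
      note La = L2_diff[OF L\<phi>(2)[of n] Lw(2)] and Lb = L2_mat_component(1)[OF wgrad_L2[OF dH[of n]], of i j]
      have w1: "weak_deriv \<Omega> (axis j 1) (\<lambda>x. d n x $ i) (\<lambda>x. wgrad \<Omega> (d n) x $ i $ j)"
        using wgrad_weak[OF dH] by (simp add: has_weak_gradient_iff)
      have "weak_deriv \<Omega> (axis j 1) (\<lambda>x. \<phi> n x + (-1) * v x $ i)
          (\<lambda>x. frechet_derivative (\<phi> n) (at x) (axis j 1) + (-1) * wgrad \<Omega> v x $ i $ j)"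
      proof (rule weak_deriv_add[OF so L\<phi> L2_real_scale L2_real_scale weak_deriv_C1[OF \<Omega>(1) C] weak_deriv_scale])
        show "weak_deriv \<Omega> (axis j 1) (\<lambda>x. v x $ i) (\<lambda>x. wgrad \<Omega> v x $ i $ j)"
          using wgrad_weak[OF vH] by (simp add: has_weak_gradient_iff)
      qed (rule Lw)+
      then have w2: "weak_deriv \<Omega> (axis j 1) (\<lambda>x. d n x $ i)
          (\<lambda>x. frechet_derivative (\<phi> n) (at x) (axis j 1) - wgrad \<Omega> v x $ i $ j)"
        by (simp add: d_def \<phi>_def)
      have "AE x in lebesgue_on \<Omega>. frechet_derivative (\<phi> n) (at x) (axis j 1) - wgrad \<Omega> v x $ i $ j = wgrad \<Omega> (d n) x $ i $ j"
        by (rule weak_deriv_unique[OF \<Omega>(1) L2_vec_component(1)[OF H1_L2[OF dH]] La Lb w2 w1])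
      then have "L2_norm \<Omega> (\<lambda>x. frechet_derivative (\<phi> n) (at x) (axis j 1) - wgrad \<Omega> v x $ i $ j) = L2_norm \<Omega> (\<lambda>x. wgrad \<Omega> (d n) x $ i $ j)"
        by (rule L2_norm_cong_AE[OF La Lb])
      also have "\<dots> \<le> H1_norm \<Omega> (d n)"
        by (rule order_trans[OF L2_mat_component(2)[OF wgrad_L2[OF dH]] H1_norm_ge(2)])
      finally show ?thesis .
    qed
    then show "\<forall>\<^sub>F n in sequentially. norm (L2_norm \<Omega> (\<lambda>x. frechet_derivative (\<phi> n) (at x) (axis j 1) - wgrad \<Omega> v x $ i $ j)) \<le> H1_norm \<Omega> (d n)"
      by (simp add: L2_norm_nonneg)
  qed
  have 3: "(\<lambda>n. \<integral>\<^sup>+x\<in>frontier \<Omega>. ennreal ((\<phi> n x)\<^sup>2) \<partial>surface_measure) \<longlonglongrightarrow> 0"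
  proof (rule tendsto_sandwich[OF _ _ tendsto_const bd])
    have "ennreal ((\<phi> n x)\<^sup>2) \<le> ennreal ((norm (\<Phi> n x - 0))\<^sup>2)" for n x
      using power_mono[OF component_le_norm_cart[of "\<Phi> n x" i], of 2] by (intro ennreal_leI) (simp add: \<phi>_def)
    then show "\<forall>\<^sub>F n in sequentially. (\<integral>\<^sup>+x\<in>frontier \<Omega>. ennreal ((\<phi> n x)\<^sup>2) \<partial>surface_measure)
        \<le> (\<integral>\<^sup>+x\<in>frontier \<Omega>. ennreal ((norm (\<Phi> n x - 0))\<^sup>2) \<partial>surface_measure)"
      by (intro always_eventually allI nn_integral_mono mult_right_mono) auto
  qed simp
  show ?thesis by (rule that[OF C 1 2 3])
qed

text \<open>Verified locally: near interior points it is the definition of the weak gradient. Near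
  boundary points the defect for the \<open>C1\<close> approximants is the integral of the
  derivative of \<phi> n times \<psi>, which tends to 0 by the graph estimate.\<close>

lemma V_weak_deriv_UNIV:
  assumes \<Omega>: "lipschitz_domain \<Omega>" "bounded \<Omega>" and v: "v \<in> V_space \<Omega>"
  shows "weak_deriv UNIV (axis j 1) (\<lambda>x. indicator \<Omega> x * v x $ i) (\<lambda>x. indicator \<Omega> x * wgrad \<Omega> v x $ i $ j)"
proof -
  have op: "open \<Omega>" using \<Omega>(1) by (simp add: lipschitz_domain_def)
  have so: "\<Omega> \<in> sets lebesgue" using op by auto
  have vH: "v \<in> H1 \<Omega>" using v by (simp add: V_space_def)
  have Lw: "(\<lambda>x. v x $ i) \<in> L2 \<Omega>" "(\<lambda>x. wgrad \<Omega> v x $ i $ j) \<in> L2 \<Omega>"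
    by (rule L2_vec_component(1)[OF H1_L2[OF vH]] L2_mat_component(1)[OF wgrad_L2[OF vH]])+
  obtain \<phi> where \<phi>: "\<And>n. C1 (\<phi> n)" "(\<lambda>n. L2_norm \<Omega> (\<lambda>x. \<phi> n x - v x $ i)) \<longlonglongrightarrow> 0"
    "(\<lambda>n. L2_norm \<Omega> (\<lambda>x. frechet_derivative (\<phi> n) (at x) (axis j 1) - wgrad \<Omega> v x $ i $ j)) \<longlonglongrightarrow> 0"
    "(\<lambda>n::nat. \<integral>\<^sup>+x\<in>frontier \<Omega>. ennreal ((\<phi> n x)\<^sup>2) \<partial>surface_measure) \<longlonglongrightarrow> 0"
    by (rule V_component_approx[OF op \<Omega>(2) v]) blast
  have L\<phi>: "\<phi> n \<in> L2 \<Omega>" "(\<lambda>x. frechet_derivative (\<phi> n) (at x) (axis j 1)) \<in> L2 \<Omega>" for n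
    by (intro continuous_bounded_L2[OF _ \<Omega>(2) so] C1_continuous C1_continuous_deriv \<phi>(1))+
  show ?thesis
  proof (rule weak_deriv_extend_by_zero[OF op \<Omega>(2) Lw])
    fix p assume p: "p \<in> closure \<Omega>"
    show "\<exists>r>0. \<forall>\<psi>. test_function (ball p r) \<psi> \<longrightarrow>
       L2_inner \<Omega> (\<lambda>x. v x $ i) (\<lambda>x. frechet_derivative \<psi> (at x) (axis j 1)) + L2_inner \<Omega> (\<lambda>x. wgrad \<Omega> v x $ i $ j) \<psi> = 0"
    proof (cases "p \<in> \<Omega>")
      case True
      then obtain r where r: "r > 0" "ball p r \<subseteq> \<Omega>" using op open_contains_ball by blast
      have "weak_deriv \<Omega> (axis j 1) (\<lambda>x. v x $ i) (\<lambda>x. wgrad \<Omega> v x $ i $ j)"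
        using wgrad_weak[OF vH] by (simp add: has_weak_gradient_iff)
      from weak_deriv_inner[OF this test_function_mono[OF _ r(2)]] show ?thesis
        by (intro exI[of _ r] conjI allI impI r(1)) simp
    next
      case False
      then have "p \<in> frontier \<Omega>" using p op by (simp add: frontier_def interior_open)
      then obtain r h N L where r: "0 < r" and g: "lipschitz_graph h N L" "\<Omega> \<inter> ball p r = {x \<in> ball p r. h x < 0}"
        using lipschitz_domain_graph[OF \<Omega>(1)] by blast
      interpret lipschitz_graph h N L by (rule g(1))
      have "L2_inner \<Omega> (\<lambda>x. v x $ i) (\<lambda>x. frechet_derivative \<psi> (at x) (axis j 1)) + L2_inner \<Omega> (\<lambda>x. wgrad \<Omega> v x $ i $ j) \<psi> = 0"
        if t: "test_function (ball p r) \<psi>" for \<psi>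
      proof -
        have tU: "test_function UNIV \<psi>" by (rule test_function_mono[OF t]) simp
        have tL: "\<psi> \<in> L2 \<Omega>" "(\<lambda>x. frechet_derivative \<psi> (at x) (axis j 1)) \<in> L2 \<Omega>"
          by (rule test_function_UNIV_L2_on[OF so tU])+
        have "(\<lambda>n. L2_inner \<Omega> (\<phi> n) (\<lambda>x. frechet_derivative \<psi> (at x) (axis j 1))
            + L2_inner \<Omega> (\<lambda>x. frechet_derivative (\<phi> n) (at x) (axis j 1)) \<psi>)
          \<longlonglongrightarrow> L2_inner \<Omega> (\<lambda>x. v x $ i) (\<lambda>x. frechet_derivative \<psi> (at x) (axis j 1)) + L2_inner \<Omega> (\<lambda>x. wgrad \<Omega> v x $ i $ j) \<psi>"
          by (intro tendsto_add L2_inner_tendsto L\<phi> Lw tL \<phi>)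
        moreover have "L2_inner \<Omega> (\<phi> n) (\<lambda>x. frechet_derivative \<psi> (at x) (axis j 1))
            + L2_inner \<Omega> (\<lambda>x. frechet_derivative (\<phi> n) (at x) (axis j 1)) \<psi>
          = (LINT x|lebesgue_on \<Omega>. frechet_derivative (\<lambda>x. \<phi> n x * \<psi> x) (at x) (axis j 1))" for n
          unfolding L2_inner_real frechet_derivative_mult[OF \<phi>(1) test_function_C1[OF t]]
          by (intro Bochner_Integration.integral_add[symmetric] L2_mult_integrable L\<phi> tL)
        ultimately show ?thesis
          using LIMSEQ_unique[OF _ integral_derivative_tendsto_0[OF op g(2) t \<phi>(1,4), of "axis j 1"]] by simp
      qed
      then show ?thesis using r by blast
    qed
  qed
qed

section \<open>Difference quotients\<close>

text \<open>Letting the test functions tend to \<open>f\<close> gives |f|^2 \<le> C |f| in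
  norm.\<close>

lemma L2_norm_le_dual:
  fixes f :: "real^3 \<Rightarrow> real"
  assumes f: "f \<in> L2 UNIV" and C: "0 \<le> C" and bound: "\<And>\<psi>. test_function UNIV \<psi> \<Longrightarrow> \<bar>L2_inner UNIV \<psi> f\<bar> \<le> C * L2_norm UNIV \<psi>"
  shows "L2_norm UNIV f \<le> C"
proof -
  obtain \<psi> where \<psi>: "\<And>n. test_function UNIV (\<psi> n)" "(\<lambda>n. L2_norm UNIV (\<lambda>x. \<psi> n x - f x)) \<longlonglongrightarrow> 0"
    using L2_test_function_seq[OF f] by blast
  have "(\<lambda>n. \<bar>L2_inner UNIV (\<psi> n) f\<bar>) \<longlonglongrightarrow> \<bar>L2_inner UNIV f f\<bar>"
    by (intro tendsto_rabs L2_inner_tendsto test_function_L2(1) \<psi> f)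
  moreover have "(\<lambda>n. C * L2_norm UNIV (\<psi> n)) \<longlonglongrightarrow> C * L2_norm UNIV f"
    by (intro tendsto_mult tendsto_const L2_norm_tendsto test_function_L2(1) \<psi> f)
  ultimately have "\<bar>L2_inner UNIV f f\<bar> \<le> C * L2_norm UNIV f"
    by (rule LIMSEQ_le) (intro exI[of _ 0] allI impI bound \<psi>)
  then have "L2_norm UNIV f * L2_norm UNIV f \<le> C * L2_norm UNIV f"
    using L2_norm_power2[OF f] by (simp add: power2_eq_square)
  then show ?thesis using C L2_norm_nonneg[of UNIV f] mult_right_le_imp_le[of "L2_norm UNIV f" "L2_norm UNIV f" C]
    by (cases "L2_norm UNIV f = 0") auto
qed

lemma translate_test_deriv_weak:
  assumes U: "U \<in> L2 UNIV" and w: "weak_deriv UNIV e U G" and \<psi>: "test_function UNIV \<psi>"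
  shows "((\<lambda>s. L2_inner UNIV U (\<lambda>x. \<psi> (x + s *\<^sub>R e))) has_real_derivative
      - L2_inner UNIV G (\<lambda>x. \<psi> (x + s *\<^sub>R e))) (at s)"
  using L2_translate_test_deriv[OF U \<psi>, of e s] weak_deriv_inner[OF w test_function_translate[OF \<psi>], of "s *\<^sub>R e"]
  by (simp add: L2_inner_real C1_translate(2)[OF test_function_C1[OF \<psi>]] lebesgue_on_UNIV_eq)

lemma L2_inner_translate_diff:
  fixes U \<psi> :: "real^3 \<Rightarrow> real"
  assumes "U \<in> L2 UNIV" "\<psi> \<in> L2 UNIV"
  shows "L2_inner UNIV \<psi> (\<lambda>x. U (x + a) - U x) = L2_inner UNIV U (\<lambda>x. \<psi> (x + (- a))) - L2_inner UNIV U \<psi>"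
proof -
  have "L2_inner UNIV U (\<lambda>x. \<psi> (x + (- a))) = L2_inner UNIV (\<lambda>x. U (x + a)) (\<lambda>x. \<psi> (x + a + (- a)))"
    by (rule L2_inner_translate[symmetric]) (intro assms L2_translate)+
  also have "\<dots> = L2_inner UNIV \<psi> (\<lambda>x. U (x + a))" by (simp add: L2_inner_real mult.commute)
  finally show ?thesis
    using L2.form_sym[OF assms] by (simp add: L2.form_diff_right assms L2_translate)
qed

text \<open>By duality the translation is moved to a smooth \<psi>; the pairing is then
  differentiable in the shift, with derivative bounded by the norms of \<open>G\<close> and \<psi>,
  and the mean value inequality applies.\<close>

lemma L2_translate_diff_le:
  assumes U: "U \<in> L2 UNIV" and G: "G \<in> L2 UNIV" and w: "weak_deriv UNIV e U G"
  shows "L2_norm UNIV (\<lambda>x. U (x + s *\<^sub>R e) - U x) \<le> \<bar>s\<bar> * L2_norm UNIV G"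
proof (rule L2_norm_le_dual[OF L2_diff[OF L2_translate(1)[OF U] U]])
  show "0 \<le> \<bar>s\<bar> * L2_norm UNIV G" by (simp add: L2_norm_nonneg)
next
  fix \<psi> :: "real^3 \<Rightarrow> real" assume \<psi>: "test_function UNIV \<psi>"
  note L = test_function_L2(1)[OF \<psi>]
  define g where "g = (\<lambda>s. L2_inner UNIV U (\<lambda>x. \<psi> (x + s *\<^sub>R e)))"
  have d: "(g has_real_derivative - L2_inner UNIV G (\<lambda>x. \<psi> (x + s *\<^sub>R e))) (at s)" for s
    unfolding g_def by (rule translate_test_deriv_weak[OF U w \<psi>])
  have b: "\<bar>- L2_inner UNIV G (\<lambda>x. \<psi> (x + s *\<^sub>R e))\<bar> \<le> L2_norm UNIV G * L2_norm UNIV \<psi>" for s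
    using L2_Cauchy_Schwarz[OF G L2_translate(1)[OF L, of "s *\<^sub>R e"]] by (simp add: L2_translate(2)[OF L])
  have "L2_inner UNIV \<psi> (\<lambda>x. U (x + s *\<^sub>R e) - U x) = g (- s) - g 0"
    using L2_inner_translate_diff[OF U L, of "s *\<^sub>R e"] by (simp add: g_def)
  also have "\<bar>\<dots>\<bar> \<le> L2_norm UNIV G * L2_norm UNIV \<psi> * \<bar>s\<bar>"
    using field_differentiable_bound[of UNIV g "\<lambda>s. - L2_inner UNIV G (\<lambda>x. \<psi> (x + s *\<^sub>R e))"
        "L2_norm UNIV G * L2_norm UNIV \<psi>" "- s" 0] d b by simp
  finally show "\<bar>L2_inner UNIV \<psi> (\<lambda>x. U (x + s *\<^sub>R e) - U x)\<bar> \<le> \<bar>s\<bar> * L2_norm UNIV G * L2_norm UNIV \<psi>"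
    by (simp add: ac_simps)
qed

definition diff_quot :: "nat \<Rightarrow> real^3 \<Rightarrow> (real^3 \<Rightarrow> real) \<Rightarrow> real^3 \<Rightarrow> real" where
  "diff_quot n e U = (\<lambda>x. real (Suc n) *\<^sub>R (U (x + inverse (real (Suc n)) *\<^sub>R e) - U x))"

lemma diff_quot_L2: "U \<in> L2 UNIV \<Longrightarrow> diff_quot n e U \<in> L2 UNIV"
  unfolding diff_quot_def by (intro L2_scale L2_diff L2_translate)

text \<open>Weak convergence together with \<open>\<parallel>diff_quot n e U\<parallel> \<le> \<parallel>G\<parallel>\<close> gives strong convergence.\<close>

lemma diff_quot_tendsto:
  assumes U: "U \<in> L2 UNIV" and G: "G \<in> L2 UNIV" and w: "weak_deriv UNIV e U G"
  shows "(\<lambda>n. L2_norm UNIV (\<lambda>x. diff_quot n e U x - G x)) \<longlonglongrightarrow> 0"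
proof -
  let ?D = "\<lambda>n. diff_quot n e U"
  note D = diff_quot_L2[OF U, of _ e]
  have bound: "L2_norm UNIV (?D n) \<le> L2_norm UNIV G" for n
  proof -
    have "L2_norm UNIV (?D n) = real (Suc n) * L2_norm UNIV (\<lambda>x. U (x + inverse (real (Suc n)) *\<^sub>R e) - U x)"
      unfolding diff_quot_def using L2_norm_scale[OF L2_diff[OF L2_translate(1)[OF U] U]] by simp
    also have "\<dots> \<le> real (Suc n) * (inverse (real (Suc n)) * L2_norm UNIV G)"
      using L2_translate_diff_le[OF U G w, of "inverse (real (Suc n))"] by (intro mult_left_mono) auto
    also have "\<dots> = L2_norm UNIV G"
      using right_inverse[of "real (Suc n)"] by (simp only: mult.assoc[symmetric])
    finally show ?thesis .
  qed
  have weak: "(\<lambda>n. L2_inner UNIV \<psi> (?D n)) \<longlonglongrightarrow> L2_inner UNIV \<psi> G" if \<psi>: "test_function UNIV \<psi>" for \<psi>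
  proof -
    note L = test_function_L2(1)[OF \<psi>]
    define g where "g = (\<lambda>s. L2_inner UNIV U (\<lambda>x. \<psi> (x + s *\<^sub>R e)))"
    have "(g has_real_derivative - L2_inner UNIV G \<psi>) (at 0)"
      using translate_test_deriv_weak[OF U w \<psi>, of 0] by (simp add: g_def)
    then have "(\<lambda>h. (g (0 + h) - g 0) / h) \<midarrow>0\<rightarrow> - L2_inner UNIV G \<psi>" by (simp add: DERIV_def)
    \<comment> \<open>The steps are negative because a forward shift of \<open>U\<close> is a
      backward shift of \<psi>.\<close>
    moreover have "(\<lambda>n. - inverse (real (Suc n))) \<longlonglongrightarrow> 0"
      using tendsto_minus[OF LIMSEQ_inverse_real_of_nat] by simp
    ultimately have "((\<lambda>h. (g (0 + h) - g 0) / h) \<circ> (\<lambda>n. - inverse (real (Suc n)))) \<longlonglongrightarrow> - L2_inner UNIV G \<psi>"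
      unfolding tendsto_at_iff_sequentially by simp
    then have "(\<lambda>n. - ((g (- inverse (real (Suc n))) - g 0) / (- inverse (real (Suc n))))) \<longlonglongrightarrow> - (- L2_inner UNIV G \<psi>)"
      by (intro tendsto_minus) (simp add: o_def)
    moreover have "L2_inner UNIV \<psi> (?D n) = - ((g (- inverse (real (Suc n))) - g 0) / (- inverse (real (Suc n))))" for n
    proof -
      have "L2_inner UNIV \<psi> (?D n) = real (Suc n) * L2_inner UNIV \<psi> (\<lambda>x. U (x + inverse (real (Suc n)) *\<^sub>R e) - U x)"
        unfolding diff_quot_def by (rule L2.form_scale_right[OF L2_diff[OF L2_translate(1)[OF U] U] L])
      also have "L2_inner UNIV \<psi> (\<lambda>x. U (x + inverse (real (Suc n)) *\<^sub>R e) - U x) = g (- inverse (real (Suc n))) - g 0"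
        using L2_inner_translate_diff[OF U L, of "inverse (real (Suc n)) *\<^sub>R e"] by (simp add: g_def)
      finally show ?thesis by (simp del: of_nat_Suc add: divide_inverse mult.commute)
    qed
    ultimately show ?thesis using L2.form_sym[OF G L] by simp
  qed
  \<comment> \<open>Weak convergence is known only against test functions; \<open>G\<close> is
    approximated by one, and the uniform norm bound keeps the two errors below \<epsilon> /
    3.\<close>
  have inner: "(\<lambda>n. L2_inner UNIV (?D n) G) \<longlonglongrightarrow> (L2_norm UNIV G)\<^sup>2"
  proof (rule LIMSEQ_I)
    fix \<epsilon> :: real assume \<epsilon>: "0 < \<epsilon>"
    define c where "c = L2_norm UNIV G + 1"
    have c: "1 \<le> c" "L2_norm UNIV G \<le> c" by (simp_all add: c_def L2_norm_nonneg)
    obtain \<psi> where \<psi>: "test_function UNIV \<psi>" and \<psi>G: "L2_norm UNIV (\<lambda>x. \<psi> x - G x) < \<epsilon> / (3 * c)"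
      using L2_test_function_dense[OF G, of "\<epsilon> / (3 * c)"] \<epsilon> c by auto
    note L = test_function_L2(1)[OF \<psi>]
    obtain n0 where n0: "\<And>n. n \<ge> n0 \<Longrightarrow> \<bar>L2_inner UNIV \<psi> (?D n) - L2_inner UNIV \<psi> G\<bar> < \<epsilon> / 3"
      using LIMSEQ_D[OF weak[OF \<psi>], of "\<epsilon> / 3"] \<epsilon> by auto
    have small: "\<bar>L2_inner UNIV (\<lambda>x. \<psi> x - G x) F\<bar> < \<epsilon> / 3" if "F \<in> L2 UNIV" "L2_norm UNIV F \<le> L2_norm UNIV G" for F
    proof -
      have "\<bar>L2_inner UNIV (\<lambda>x. \<psi> x - G x) F\<bar> \<le> L2_norm UNIV (\<lambda>x. \<psi> x - G x) * L2_norm UNIV F"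
        by (rule L2_Cauchy_Schwarz[OF L2_diff[OF L G] that(1)])
      also have "\<dots> \<le> L2_norm UNIV (\<lambda>x. \<psi> x - G x) * c"
        using that(2) c(2) by (intro mult_left_mono) (auto simp: L2_norm_nonneg)
      also have "\<dots> < \<epsilon> / (3 * c) * c" using \<psi>G c(1) by (intro mult_strict_right_mono) auto
      finally show ?thesis using c(1) by simp
    qed
    have "norm (L2_inner UNIV (?D n) G - (L2_norm UNIV G)\<^sup>2) < \<epsilon>" if "n \<ge> n0" for n
    proof -
      have "L2_inner UNIV (?D n) G - (L2_norm UNIV G)\<^sup>2
          = (L2_inner UNIV \<psi> (?D n) - L2_inner UNIV \<psi> G) - L2_inner UNIV (\<lambda>x. \<psi> x - G x) (?D n) + L2_inner UNIV (\<lambda>x. \<psi> x - G x) G"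
        using L2.form_sym[OF D G] by (simp add: L2_norm_power2[OF G] L2.form_diff L D G)
      moreover have "\<bar>a - b + c\<bar> < \<epsilon>" if "\<bar>a\<bar> < \<epsilon> / 3" "\<bar>b\<bar> < \<epsilon> / 3" "\<bar>c\<bar> < \<epsilon> / 3" for a b c
        using that by (auto simp: abs_if split: if_splits)
      ultimately show ?thesis using n0[OF that] small[OF D bound, of n] small[OF G order_refl] by (simp only: real_norm_def)
    qed
    then show "\<exists>n0. \<forall>n\<ge>n0. norm (L2_inner UNIV (?D n) G - (L2_norm UNIV G)\<^sup>2) < \<epsilon>" by blast
  qed
  have "(\<lambda>n. (L2_norm UNIV (\<lambda>x. ?D n x - G x))\<^sup>2) \<longlonglongrightarrow> 0"
  proof (rule Lim_null_comparison)
    have "(L2_norm UNIV (\<lambda>x. ?D n x - G x))\<^sup>2 \<le> 2 * ((L2_norm UNIV G)\<^sup>2 - L2_inner UNIV (?D n) G)" for n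
      using L2.form_diff_expand[OF D G, of n] power_mono[OF bound[of n] L2_norm_nonneg, of 2]
      by (simp add: L2_norm_power2 L2_diff D G)
    then show "\<forall>\<^sub>F n in sequentially. norm ((L2_norm UNIV (\<lambda>x. ?D n x - G x))\<^sup>2) \<le> 2 * ((L2_norm UNIV G)\<^sup>2 - L2_inner UNIV (?D n) G)"
      by simp
    have "(\<lambda>n. 2 * ((L2_norm UNIV G)\<^sup>2 - L2_inner UNIV (?D n) G)) \<longlonglongrightarrow> 2 * ((L2_norm UNIV G)\<^sup>2 - (L2_norm UNIV G)\<^sup>2)"
      by (intro tendsto_intros inner)
    then show "(\<lambda>n. 2 * ((L2_norm UNIV G)\<^sup>2 - L2_inner UNIV (?D n) G)) \<longlonglongrightarrow> 0" by simp
  qed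
  from tendsto_real_sqrt[OF this] show ?thesis by (simp add: L2_norm_nonneg)
qed

section \<open>The inequalities of Poincare and Korn\<close>

text \<open>A shift by s = 2 \<rho> + 1 moves the support off itself, so \<open>U\<close> and its
  translate are orthogonal and the squared norm of their difference is twice that of
  \<open>U\<close>, while the difference is at most s times the norm of \<open>G\<close>.\<close>

lemma poincare_line:
  assumes A: "\<And>x. norm x > \<rho> \<Longrightarrow> U x = 0" "0 \<le> \<rho>"
    and U: "U \<in> L2 UNIV" and G: "G \<in> L2 UNIV" and w: "weak_deriv UNIV e U G" and e: "norm e = 1"
  shows "L2_norm UNIV U \<le> (2 * \<rho> + 1) * L2_norm UNIV G"
proof -
  define s where "s = 2 * \<rho> + 1"
  have s: "0 < s" using A(2) by (simp add: s_def)
  have "U (x + s *\<^sub>R e) * U x = 0" for x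
  proof (cases "norm x > \<rho>")
    case False
    have "s \<le> norm (x + s *\<^sub>R e) + norm x"
      using norm_triangle_ineq4[of "x + s *\<^sub>R e" x] e s by simp
    then have "norm (x + s *\<^sub>R e) > \<rho>" using False by (simp add: s_def)
    then show ?thesis using A(1) by simp
  qed (simp add: A)
  then have "L2_inner UNIV (\<lambda>x. U (x + s *\<^sub>R e)) U = 0" unfolding L2_inner_real by (simp only:) simp
  then have "(L2_norm UNIV (\<lambda>x. U (x + s *\<^sub>R e) - U x))\<^sup>2 = 2 * (L2_norm UNIV U)\<^sup>2"
    using L2.form_diff_expand[OF L2_translate(1)[OF U] U, of "s *\<^sub>R e"]
    by (simp add: L2_norm_power2[symmetric] L2_diff L2_translate U)
  moreover have "(L2_norm UNIV (\<lambda>x. U (x + s *\<^sub>R e) - U x))\<^sup>2 \<le> (s * L2_norm UNIV G)\<^sup>2"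
    using L2_translate_diff_le[OF U G w, of s] s by (intro power_mono) (auto simp: L2_norm_nonneg)
  ultimately have "(L2_norm UNIV U)\<^sup>2 \<le> (s * L2_norm UNIV G)\<^sup>2"
    using zero_le_power2[of "L2_norm UNIV U"] by linarith
  then have "L2_norm UNIV U \<le> s * L2_norm UNIV G"
    by (rule power2_le_imp_le) (use s in \<open>simp add: L2_norm_nonneg\<close>)
  then show ?thesis by (simp add: s_def)
qed

text \<open>Discrete form of integrating by parts twice, exchanging the directions of the two
  derivatives: the four terms of the product are shifted separately.\<close>

lemma L2_inner_translate_diff_swap:
  fixes a b :: "real^3 \<Rightarrow> real"
  assumes a: "a \<in> L2 UNIV" and b: "b \<in> L2 UNIV"
  shows "L2_inner UNIV (\<lambda>x. a (x + p) - a x) (\<lambda>x. b (x + q) - b x)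
      = L2_inner UNIV (\<lambda>x. a (x - q) - a x) (\<lambda>x. b (x - p) - b x)"
proof -
  note ta = L2_translate(1)[OF a] and tb = L2_translate(1)[OF b]
  have m: "(\<lambda>x. a (x - q)) \<in> L2 UNIV" "(\<lambda>x. b (x - p)) \<in> L2 UNIV"
    using ta[of "- q"] tb[of "- p"] by simp_all
  have 1: "L2_inner UNIV (\<lambda>x. a (x - q)) (\<lambda>x. b (x - p)) = L2_inner UNIV (\<lambda>x. a (x + p)) (\<lambda>x. b (x + q))"
    using L2_inner_translate[OF m, of "p + q"] by (simp add: algebra_simps)
  have 2: "L2_inner UNIV (\<lambda>x. a (x - q)) b = L2_inner UNIV a (\<lambda>x. b (x + q))"
    using L2_inner_translate[OF m(1) b, of q] by simp
  have 3: "L2_inner UNIV a (\<lambda>x. b (x - p)) = L2_inner UNIV (\<lambda>x. a (x + p)) b"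
    using L2_inner_translate[OF a m(2), of p] by simp
  show ?thesis
    by (simp add: L2.form_diff L2.form_diff_right L2_diff a b ta tb m 1 2 3)
qed

text \<open>For smooth fields the sum is the integral of the squared divergence. The entries of
  \<open>U\<close> have only first derivatives, so this is done with difference quotients, where
  swapping directions leaves the square of a discrete divergence; strong convergence passes the sign
  to the limit.\<close>

lemma korn_symmetric_part:
  fixes U :: "3 \<Rightarrow> real^3 \<Rightarrow> real"
  assumes U: "\<And>i. U i \<in> L2 UNIV" and G: "\<And>i j. G i j \<in> L2 UNIV"
    and w: "\<And>i j. weak_deriv UNIV (axis j 1) (U i) (G i j)"
  shows "0 \<le> (\<Sum>i\<in>UNIV. \<Sum>j\<in>UNIV. L2_inner UNIV (G i j) (G j i))"
proof -
  let ?D = "\<lambda>n i j. diff_quot n (axis j 1) (U i)"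
  have D: "?D n i j \<in> L2 UNIV" for n i j by (rule diff_quot_L2[OF U])
  have "(\<lambda>n. L2_inner UNIV (?D n i j) (?D n j i)) \<longlonglongrightarrow> L2_inner UNIV (G i j) (G j i)" for i j
  proof -
    have "(\<lambda>n. L2_inner UNIV (\<lambda>x. ?D n i j x - G i j x) (?D n j i) + L2_inner UNIV (?D n j i) (G i j)) \<longlonglongrightarrow> 0 + L2_inner UNIV (G j i) (G i j)"
    proof (intro tendsto_add L2_inner_tendsto D G diff_quot_tendsto U w)
      show "(\<lambda>n. L2_inner UNIV (\<lambda>x. ?D n i j x - G i j x) (?D n j i)) \<longlonglongrightarrow> 0"
      proof (rule Lim_null_comparison)
        show "\<forall>\<^sub>F n in sequentially. norm (L2_inner UNIV (\<lambda>x. ?D n i j x - G i j x) (?D n j i))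
            \<le> L2_norm UNIV (\<lambda>x. ?D n i j x - G i j x) * L2_norm UNIV (?D n j i)"
          using L2_Cauchy_Schwarz[OF L2_diff[OF D G] D] by simp
        have "(\<lambda>n. L2_norm UNIV (\<lambda>x. ?D n i j x - G i j x) * L2_norm UNIV (?D n j i)) \<longlonglongrightarrow> 0 * L2_norm UNIV (G j i)"
          by (intro tendsto_mult L2_norm_tendsto D G diff_quot_tendsto U w)
        then show "(\<lambda>n. L2_norm UNIV (\<lambda>x. ?D n i j x - G i j x) * L2_norm UNIV (?D n j i)) \<longlonglongrightarrow> 0" by simp
      qed
    qed
    then show ?thesis using L2.form_sym[OF G D] L2.form_sym[OF G G] by (simp add: L2.form_diff D G)
  qed
  then have "(\<lambda>n. \<Sum>i\<in>UNIV. \<Sum>j\<in>UNIV. L2_inner UNIV (?D n i j) (?D n j i)) \<longlonglongrightarrow> (\<Sum>i\<in>UNIV. \<Sum>j\<in>UNIV. L2_inner UNIV (G i j) (G j i))"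
    by (intro tendsto_sum)
  moreover have "0 \<le> (\<Sum>i\<in>UNIV. \<Sum>j\<in>UNIV. L2_inner UNIV (?D n i j) (?D n j i))" for n
  proof -
    define s where "s = inverse (real (Suc n))"
    \<comment> \<open>Minus the backward difference quotient of component i in its own
      direction.\<close>
    define B where "B = (\<lambda>i x. real (Suc n) *\<^sub>R (U i (x - s *\<^sub>R axis i 1) - U i x))"
    have t: "(\<lambda>x. U i (x - a)) \<in> L2 UNIV" for i a using L2_translate(1)[OF U, of i "- a"] by simp
    have B: "B i \<in> L2 UNIV" for i unfolding B_def by (intro L2_scale L2_diff t U)
    have "L2_inner UNIV (?D n i j) (?D n j i) = L2_inner UNIV (B i) (B j)" for i j
      unfolding B_def diff_quot_def s_def[symmetric]
      using L2_inner_translate_diff_swap[OF U U, of i "s *\<^sub>R axis j 1" j "s *\<^sub>R axis i 1"]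
      by (simp add: L2.form_scale L2.form_scale_right L2_scale L2_diff L2_translate U t del: real_scaleR_def)
    then have "(\<Sum>i\<in>UNIV. \<Sum>j\<in>UNIV. L2_inner UNIV (?D n i j) (?D n j i)) = (\<Sum>i\<in>UNIV. \<Sum>j\<in>UNIV. L2_inner UNIV (B i) (B j))"
      by simp
    also have "\<dots> = (LINT x|lebesgue. (\<Sum>i\<in>UNIV. \<Sum>j\<in>UNIV. B i x * B j x))"
      by (simp add: L2_inner_real lebesgue_on_UNIV_eq L2_mult_integrable_UNIV B Bochner_Integration.integral_sum)
    also have "\<dots> = (LINT x|lebesgue. (\<Sum>i\<in>UNIV. B i x)\<^sup>2)"
      by (simp add: power2_eq_square sum_product)
    also have "0 \<le> \<dots>" by simp
    finally show ?thesis .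
  qed
  ultimately show ?thesis by (intro LIMSEQ_le_const) auto
qed

section \<open>Korn and Poincare inequalities on V\<close>

definition sym_part :: "real^3^3 \<Rightarrow> real^3^3" where
  "sym_part A = (1/2) *\<^sub>R (A + transpose A)"

lemma inner_transpose: "A \<bullet> transpose A = (\<Sum>i\<in>UNIV. \<Sum>j\<in>UNIV. A $ i $ j * A $ j $ i)" for A :: "real^3^3"
  by (simp add: inner_vec_def transpose_def)

lemma norm_transpose: "norm (transpose A) = norm A" for A :: "real^3^3"
proof -
  have "transpose A \<bullet> transpose A = A \<bullet> A"
    by (simp add: inner_vec_def transpose_def, rule sum.swap)
  then show ?thesis by (simp add: norm_eq_sqrt_inner)
qed

lemma norm_sym_part_power2: "2 * (norm (sym_part A))\<^sup>2 = (norm A)\<^sup>2 + A \<bullet> transpose A"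
proof -
  have "4 * (norm (sym_part A))\<^sup>2 = (norm (A + transpose A))\<^sup>2"
    by (simp add: sym_part_def power_divide)
  also have "\<dots> = (norm A)\<^sup>2 + 2 * (A \<bullet> transpose A) + (norm (transpose A))\<^sup>2"
    by (simp add: power2_norm_eq_inner inner_add_left inner_add_right inner_commute)
  finally show ?thesis by (simp add: norm_transpose)
qed

lemma bounded_linear_transpose: "bounded_linear (transpose :: real^3^3 \<Rightarrow> real^3^3)"
  by (intro linear_conv_bounded_linear[THEN iffD1] linearI) (simp_all add: transpose_def vec_eq_iff)

lemma L2_bounded_linear:
  fixes f :: "real^3 \<Rightarrow> 'b::euclidean_space" and T :: "'b \<Rightarrow> 'c::euclidean_space"
  assumes "f \<in> L2 A" "bounded_linear T"
  shows "(\<lambda>x. T (f x)) \<in> L2 A"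
proof -
  obtain K where K: "\<And>x. norm (T x) \<le> norm x * K" using bounded_linear.bounded[OF assms(2)] by blast
  have T: "T \<in> borel_measurable borel"
    by (intro borel_measurable_continuous_onI linear_continuous_on assms(2))
  show ?thesis
  proof (rule L2_bound)
    show "(\<lambda>x. T (f x)) \<in> borel_measurable (lebesgue_on A)" by (rule measurable_compose[OF L2_measurable[OF assms(1)] T])
    show "integrable (lebesgue_on A) (\<lambda>x. (norm (f x))\<^sup>2 * K\<^sup>2)" using L2_integrable[OF assms(1)] by simp
    show "(norm (T (f x)))\<^sup>2 \<le> (norm (f x))\<^sup>2 * K\<^sup>2" for x
      using power_mono[OF K, of "f x" 2] by (simp add: power_mult_distrib)
  qed
qed

lemma bounded_linear_sym_part: "bounded_linear sym_part"
  unfolding sym_part_def[abs_def]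
  by (intro bounded_linear_scaleR_right[THEN bounded_linear_compose] bounded_linear_add bounded_linear_ident bounded_linear_transpose)

text \<open>Integrating \<open>norm_sym_part_power2\<close>, it remains to see that the integral of
  the gradient against its transpose is nonnegative, which holds for the extension by zero.\<close>

lemma korn_V:
  assumes \<Omega>: "lipschitz_domain \<Omega>" "bounded \<Omega>" and v: "v \<in> V_space \<Omega>"
  shows "(L2_norm \<Omega> (wgrad \<Omega> v))\<^sup>2 \<le> 2 * (L2_norm \<Omega> (\<lambda>x. sym_part (wgrad \<Omega> v x)))\<^sup>2"
proof -
  have op: "open \<Omega>" using \<Omega>(1) by (simp add: lipschitz_domain_def)
  have so: "\<Omega> \<in> sets lebesgue" using op by auto
  have vH: "v \<in> H1 \<Omega>" using v by (simp add: V_space_def)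
  define W where "W = wgrad \<Omega> v"
  have W: "W \<in> L2 \<Omega>" unfolding W_def by (rule wgrad_L2[OF vH])
  note Wc = L2_mat_component(1)[OF W]
  have "0 \<le> (\<Sum>i\<in>UNIV. \<Sum>j\<in>UNIV. L2_inner UNIV (\<lambda>x. indicator \<Omega> x * W x $ i $ j) (\<lambda>x. indicator \<Omega> x * W x $ j $ i))"
    using korn_symmetric_part[of "\<lambda>i x. indicator \<Omega> x * v x $ i" "\<lambda>i j x. indicator \<Omega> x * W x $ i $ j"]
      V_weak_deriv_UNIV[OF \<Omega> v] L2_extend_real(1)[OF so L2_vec_component(1)[OF H1_L2[OF vH]]] L2_extend_real(1)[OF so Wc]
    by (simp add: W_def)
  also have "\<dots> = (\<Sum>i\<in>UNIV. \<Sum>j\<in>UNIV. L2_inner \<Omega> (\<lambda>x. W x $ i $ j) (\<lambda>x. W x $ j $ i))"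
  proof (intro sum.cong refl)
    fix i j :: 3
    show "L2_inner UNIV (\<lambda>x. indicator \<Omega> x * W x $ i $ j) (\<lambda>x. indicator \<Omega> x * W x $ j $ i) = L2_inner \<Omega> (\<lambda>x. W x $ i $ j) (\<lambda>x. W x $ j $ i)"
      unfolding L2_extend_real(3)[OF so] unfolding L2_inner_real
      by (intro Bochner_Integration.integral_cong) (auto simp: indicator_def)
  qed
  also have "\<dots> = (LINT x|lebesgue_on \<Omega>. W x \<bullet> transpose (W x))"
    by (simp add: inner_transpose L2_inner_real L2_mult_integrable Wc Bochner_Integration.integral_sum)
  finally have nonneg: "0 \<le> (LINT x|lebesgue_on \<Omega>. W x \<bullet> transpose (W x))" .
  have "2 * (L2_norm \<Omega> (\<lambda>x. sym_part (W x)))\<^sup>2 = (LINT x|lebesgue_on \<Omega>. 2 * (norm (sym_part (W x)))\<^sup>2)"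
    by (simp add: L2_norm_def)
  also have "\<dots> = (LINT x|lebesgue_on \<Omega>. (norm (W x))\<^sup>2 + W x \<bullet> transpose (W x))"
    by (simp only: norm_sym_part_power2)
  also have "\<dots> = (LINT x|lebesgue_on \<Omega>. (norm (W x))\<^sup>2) + (LINT x|lebesgue_on \<Omega>. W x \<bullet> transpose (W x))"
    by (rule Bochner_Integration.integral_add[OF L2_integrable[OF W] L2_inner_integrable[OF W L2_bounded_linear[OF W bounded_linear_transpose]]])
  also have "(LINT x|lebesgue_on \<Omega>. (norm (W x))\<^sup>2) = (L2_norm \<Omega> W)\<^sup>2" by (simp add: L2_norm_def)
  finally show ?thesis using nonneg by (simp add: W_def)
qed

lemma poincare_V:
  assumes \<Omega>: "lipschitz_domain \<Omega>" "bounded \<Omega>"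
  obtains C where "0 < C" "\<And>v. v \<in> V_space \<Omega> \<Longrightarrow> L2_norm \<Omega> v \<le> C * L2_norm \<Omega> (wgrad \<Omega> v)"
proof -
  have op: "open \<Omega>" using \<Omega>(1) by (simp add: lipschitz_domain_def)
  have so: "\<Omega> \<in> sets lebesgue" using op by auto
  obtain \<rho>0 where "\<And>x. x \<in> \<Omega> \<Longrightarrow> norm x \<le> \<rho>0" using \<Omega>(2) by (auto simp: bounded_iff)
  then obtain \<rho> where \<rho>: "0 \<le> \<rho>" "\<And>x. x \<in> \<Omega> \<Longrightarrow> norm x \<le> \<rho>"
    by (metis max.cobounded2 max.coboundedI1)
  define c where "c = 2 * \<rho> + 1"
  have c: "0 < c" using \<rho> by (simp add: c_def)
  \<comment> \<open>Each of the three components contributes at most the square of c times the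
    gradient norm, and 3 c^2 \<le> (2 c)^2.\<close>
  have "L2_norm \<Omega> v \<le> (2 * c) * L2_norm \<Omega> (wgrad \<Omega> v)" if v: "v \<in> V_space \<Omega>" for v
  proof -
    have vH: "v \<in> H1 \<Omega>" using v by (simp add: V_space_def)
    note Lv = L2_vec_component(1)[OF H1_L2[OF vH]] and Lw = L2_mat_component[OF wgrad_L2[OF vH]]
    have comp: "L2_norm \<Omega> (\<lambda>x. v x $ i) \<le> c * L2_norm \<Omega> (wgrad \<Omega> v)" for i
    proof -
      have "L2_norm UNIV (\<lambda>x. indicator \<Omega> x * v x $ i) \<le> (2 * \<rho> + 1) * L2_norm UNIV (\<lambda>x. indicator \<Omega> x * wgrad \<Omega> v x $ i $ 1)"
      proof (rule poincare_line[OF _ \<rho>(1) L2_extend_real(1)[OF so Lv] L2_extend_real(1)[OF so Lw(1)] V_weak_deriv_UNIV[OF \<Omega> v]])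
        show "indicator \<Omega> x * v x $ i = 0" if "\<rho> < norm x" for x using \<rho>(2)[of x] that by (auto simp: indicator_def)
      qed (simp add: norm_axis_axis)
      also have "\<dots> \<le> c * L2_norm \<Omega> (wgrad \<Omega> v)"
        unfolding L2_extend_real(2)[OF so] c_def[symmetric] using c by (intro mult_left_mono Lw(2)) auto
      finally show ?thesis by (simp add: L2_extend_real(2)[OF so])
    qed
    have "(L2_norm \<Omega> v)\<^sup>2 = (\<Sum>i\<in>UNIV. (L2_norm \<Omega> (\<lambda>x. v x $ i))\<^sup>2)"
    proof -
      have "(L2_norm \<Omega> v)\<^sup>2 = (LINT x|lebesgue_on \<Omega>. (\<Sum>i\<in>UNIV. (norm (v x $ i))\<^sup>2))"
        by (simp add: L2_norm_def norm_vec_def L2_set_def sum_nonneg)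
      also have "\<dots> = (\<Sum>i\<in>UNIV. (LINT x|lebesgue_on \<Omega>. (norm (v x $ i))\<^sup>2))"
        by (intro Bochner_Integration.integral_sum L2_integrable Lv)
      finally show ?thesis by (simp add: L2_norm_def sum_nonneg)
    qed
    also have "\<dots> \<le> (\<Sum>i\<in>(UNIV::3 set). (c * L2_norm \<Omega> (wgrad \<Omega> v))\<^sup>2)"
      by (intro sum_mono power_mono comp L2_norm_nonneg)
    also have "\<dots> \<le> (2 * c * L2_norm \<Omega> (wgrad \<Omega> v))\<^sup>2" by (simp add: power_mult_distrib)
    finally show ?thesis by (rule power2_le_imp_le) (use c in \<open>simp add: L2_norm_nonneg\<close>)
  qed
  then show ?thesis using that[of "2 * c"] c by simp
qed

section \<open>Completeness\<close>

text \<open>Riesz-Fischer: on a set of finite measure an \<open>L2\<close> Cauchy sequence is Cauchy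
  in L1, so a subsequence converges almost everywhere, and Fatou carries the Cauchy estimate over to
  the limit.\<close>

lemma L2_complete:
  fixes F :: "nat \<Rightarrow> real^3 \<Rightarrow> 'b::euclidean_space"
  assumes A: "A \<in> lmeasurable" and F: "\<And>n. F n \<in> L2 A"
    and cauchy: "\<And>e. e > 0 \<Longrightarrow> \<exists>N. \<forall>m\<ge>N. \<forall>n\<ge>N. L2_norm A (\<lambda>x. F m x - F n x) < e"
  shows "\<exists>f\<in>L2 A. (\<lambda>n. L2_norm A (\<lambda>x. F n x - f x)) \<longlonglongrightarrow> 0"
proof -
  have fin: "finite_measure (lebesgue_on A)" using A by (rule finite_measure_lebesgue_on)
  have one: "(\<lambda>x. 1::real) \<in> L2 A"
    unfolding L2_def using finite_measure.integrable_const[OF fin, of "1::real"] by simp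
  have nL: "(\<lambda>x. norm (g x)) \<in> L2 A" if "g \<in> L2 A" for g :: "real^3 \<Rightarrow> 'b"
    using that by (auto simp: L2_def)
  have int: "integrable (lebesgue_on A) g" if "g \<in> L2 A" for g :: "real^3 \<Rightarrow> 'b"
    using L2_mult_integrable[OF nL[OF that] one] L2_measurable[OF that] by (simp add: integrable_norm_iff)
  have L1: "(LINT x|lebesgue_on A. norm (g x)) \<le> L2_norm A g * L2_norm A (\<lambda>x. 1::real)" if "g \<in> L2 A" for g :: "real^3 \<Rightarrow> 'b"
    using L2_Cauchy_Schwarz[OF nL[OF that] one] by (simp add: L2_inner_real L2_norm_def)
  \<comment> \<open>The norm of the constant 1, increased by 1 to be positive even for a null
    set.\<close>
  define c where "c = L2_norm A (\<lambda>x. 1::real) + 1"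
  have c: "0 < c" "L2_norm A (\<lambda>x. 1::real) \<le> c" using L2_norm_nonneg[of A "\<lambda>x. 1::real"] by (simp_all add: c_def)
  have "\<exists>N. \<forall>i\<ge>N. \<forall>j\<ge>N. (LINT x|lebesgue_on A. norm (F i x - F j x)) < e" if e: "e > 0" for e
  proof -
    obtain N where N: "\<And>m n. m \<ge> N \<Longrightarrow> n \<ge> N \<Longrightarrow> L2_norm A (\<lambda>x. F m x - F n x) < e / c"
      using cauchy[of "e / c"] e c by auto
    have "(LINT x|lebesgue_on A. norm (F i x - F j x)) < e" if "i \<ge> N" "j \<ge> N" for i j
    proof -
      have "(LINT x|lebesgue_on A. norm (F i x - F j x)) \<le> L2_norm A (\<lambda>x. F i x - F j x) * L2_norm A (\<lambda>x. 1::real)"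
        by (rule L1[OF L2_diff[OF F F]])
      also have "\<dots> \<le> L2_norm A (\<lambda>x. F i x - F j x) * c" by (intro mult_left_mono c L2_norm_nonneg)
      also have "\<dots> < e / c * c" by (intro mult_strict_right_mono N that c)
      finally show ?thesis using c by simp
    qed
    then show ?thesis by blast
  qed
  then obtain r where r: "strict_mono r" and AEc: "AE x in lebesgue_on A. Cauchy (\<lambda>i. F (r i) x)"
    by (rule cauchy_L1_AE_cauchy_subseq[OF int[OF F]]) blast
  define f where "f = (\<lambda>x. lim (\<lambda>i. F (r i) x))"
  have mF: "F n \<in> borel_measurable (lebesgue_on A)" for n by (rule L2_measurable[OF F])
  have mf: "f \<in> borel_measurable (lebesgue_on A)" unfolding f_def by (intro borel_measurable_lim_metric mF)
  have AEf: "AE x in lebesgue_on A. (\<lambda>i. F (r i) x) \<longlonglongrightarrow> f x"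
    using AEc by eventually_elim (simp add: f_def Cauchy_convergent_iff convergent_LIMSEQ_iff)
  have key: "\<exists>N. \<forall>n\<ge>N. (\<integral>\<^sup>+x. ennreal ((norm (F n x - f x))\<^sup>2) \<partial>lebesgue_on A) \<le> ennreal (e\<^sup>2)" if e: "e > 0" for e
  proof -
    obtain N where N: "\<And>m n. m \<ge> N \<Longrightarrow> n \<ge> N \<Longrightarrow> L2_norm A (\<lambda>x. F m x - F n x) < e" using cauchy[OF e] by blast
    have "(\<integral>\<^sup>+x. ennreal ((norm (F n x - f x))\<^sup>2) \<partial>lebesgue_on A) \<le> ennreal (e\<^sup>2)" if n: "n \<ge> N" for n
    proof -
      have "(\<integral>\<^sup>+x. ennreal ((norm (F n x - f x))\<^sup>2) \<partial>lebesgue_on A)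
          = (\<integral>\<^sup>+x. liminf (\<lambda>k. ennreal ((norm (F n x - F (r k) x))\<^sup>2)) \<partial>lebesgue_on A)"
      proof (rule nn_integral_cong_AE)
        show "AE x in lebesgue_on A. ennreal ((norm (F n x - f x))\<^sup>2) = liminf (\<lambda>k. ennreal ((norm (F n x - F (r k) x))\<^sup>2))"
          using AEf
        proof eventually_elim
          case (elim x)
          show ?case by (rule lim_imp_Liminf[symmetric]) (auto intro!: tendsto_ennrealI tendsto_intros elim)
        qed
      qed
      also have "\<dots> \<le> liminf (\<lambda>k. \<integral>\<^sup>+x. ennreal ((norm (F n x - F (r k) x))\<^sup>2) \<partial>lebesgue_on A)"
        using mF by (intro nn_integral_liminf) auto
      also have "\<dots> \<le> ennreal (e\<^sup>2)"
      proof (rule Liminf_le)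
        show "\<forall>\<^sub>F k in sequentially. (\<integral>\<^sup>+x. ennreal ((norm (F n x - F (r k) x))\<^sup>2) \<partial>lebesgue_on A) \<le> ennreal (e\<^sup>2)"
        proof (rule eventually_sequentiallyI[of N])
          fix k assume "N \<le> k"
          then have "N \<le> r k" using seq_suble[OF r, of k] by simp
          have "(\<integral>\<^sup>+x. ennreal ((norm (F n x - F (r k) x))\<^sup>2) \<partial>lebesgue_on A) = ennreal ((L2_norm A (\<lambda>x. F n x - F (r k) x))\<^sup>2)"
            using L2_integrable[OF L2_diff[OF F F]] by (simp add: nn_integral_eq_integral L2_norm_def)
          also have "\<dots> \<le> ennreal (e\<^sup>2)"
            using N[OF n \<open>N \<le> r k\<close>] by (intro ennreal_leI power_mono) (auto simp: L2_norm_nonneg)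
          finally show "(\<integral>\<^sup>+x. ennreal ((norm (F n x - F (r k) x))\<^sup>2) \<partial>lebesgue_on A) \<le> ennreal (e\<^sup>2)" .
        qed
      qed simp
      finally show ?thesis .
    qed
    then show ?thesis by blast
  qed
  have mdiff: "(\<lambda>x. (norm (F n x - f x))\<^sup>2) \<in> borel_measurable (lebesgue_on A)" for n using mF[of n] mf by measurable
  have diffL: "(\<lambda>x. F n x - f x) \<in> L2 A"
    if "(\<integral>\<^sup>+x. ennreal ((norm (F n x - f x))\<^sup>2) \<partial>lebesgue_on A) \<le> ennreal (e\<^sup>2)" for n e
  proof -
    have "integrable (lebesgue_on A) (\<lambda>x. (norm (F n x - f x))\<^sup>2)"
      using order.strict_trans1[OF that ennreal_less_top] by (intro integrableI_bounded mdiff) simp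
    then show ?thesis using mF[of n] mf by (simp add: L2_def)
  qed
  obtain n0 where "(\<integral>\<^sup>+x. ennreal ((norm (F n0 x - f x))\<^sup>2) \<partial>lebesgue_on A) \<le> ennreal (1\<^sup>2)" using key[of 1] by auto
  then have "(\<lambda>x. F n0 x - f x) \<in> L2 A" by (rule diffL)
  from L2_diff[OF F[of n0] this] have f: "f \<in> L2 A" by simp
  have "(\<lambda>n. L2_norm A (\<lambda>x. F n x - f x)) \<longlonglongrightarrow> 0"
  proof (rule LIMSEQ_I)
    fix e :: real assume e: "0 < e"
    obtain N where N: "\<And>n. n \<ge> N \<Longrightarrow> (\<integral>\<^sup>+x. ennreal ((norm (F n x - f x))\<^sup>2) \<partial>lebesgue_on A) \<le> ennreal ((e/2)\<^sup>2)"
      using key[of "e/2"] e by auto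
    have "norm (L2_norm A (\<lambda>x. F n x - f x) - 0) < e" if "n \<ge> N" for n
    proof -
      have "ennreal ((L2_norm A (\<lambda>x. F n x - f x))\<^sup>2) = (\<integral>\<^sup>+x. ennreal ((norm (F n x - f x))\<^sup>2) \<partial>lebesgue_on A)"
        using L2_integrable[OF L2_diff[OF F f]] by (simp add: nn_integral_eq_integral L2_norm_def)
      also have "\<dots> \<le> ennreal ((e/2)\<^sup>2)" by (rule N[OF that])
      finally have "(L2_norm A (\<lambda>x. F n x - f x))\<^sup>2 \<le> (e/2)\<^sup>2" by simp
      then have "L2_norm A (\<lambda>x. F n x - f x) \<le> e/2" by (rule power2_le_imp_le) (use e in simp)
      then show ?thesis using e by (simp add: L2_norm_nonneg)
    qed
    then show "\<exists>N. \<forall>n\<ge>N. norm (L2_norm A (\<lambda>x. F n x - f x) - 0) < e" by blast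
  qed
  then show ?thesis using f by blast
qed

lemma weak_deriv_limit:
  fixes F G :: "nat \<Rightarrow> real^3 \<Rightarrow> real"
  assumes A: "A \<in> sets lebesgue" and L: "\<And>n. F n \<in> L2 A" "\<And>n. G n \<in> L2 A" "f \<in> L2 A" "g \<in> L2 A"
    and w: "\<And>n. weak_deriv A e (F n) (G n)"
    and lim: "(\<lambda>n. L2_norm A (\<lambda>x. F n x - f x)) \<longlonglongrightarrow> 0" "(\<lambda>n. L2_norm A (\<lambda>x. G n x - g x)) \<longlonglongrightarrow> 0"
  shows "weak_deriv A e f g"
  unfolding weak_deriv_def L2_inner_real[symmetric]
proof (intro allI impI)
  fix \<phi> assume t: "test_function A \<phi>"
  note tL = test_function_L2_on[OF A t]
  have "(\<lambda>n. L2_inner A (F n) (\<lambda>x. frechet_derivative \<phi> (at x) e)) \<longlonglongrightarrow> L2_inner A f (\<lambda>x. frechet_derivative \<phi> (at x) e)"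
    by (rule L2_inner_tendsto[OF L(1,3) tL(2) lim(1)])
  moreover have "(\<lambda>n. - L2_inner A (G n) \<phi>) \<longlonglongrightarrow> - L2_inner A g \<phi>"
    by (intro tendsto_minus L2_inner_tendsto[OF L(2,4) tL(1) lim(2)])
  ultimately show "L2_inner A f (\<lambda>x. frechet_derivative \<phi> (at x) e) = - L2_inner A g \<phi>"
    using weak_deriv_inner[OF w t] by (simp add: LIMSEQ_unique)
qed

lemma H1_diff:
  assumes "open A" "u \<in> H1 A" "v \<in> H1 A"
  shows "(\<lambda>x. u x - v x) \<in> H1 A"
proof -
  interpret form_space "H1 A" "H1_inner A" by (rule H1_form_space[OF assms(1)])
  show ?thesis by (rule diff_in[OF assms(2,3)])
qed

lemma H1_triangle_diff:
  assumes "open A" "u \<in> H1 A" "v \<in> H1 A" "w \<in> H1 A"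
  shows "H1_norm A (\<lambda>x. u x - v x) \<le> H1_norm A (\<lambda>x. u x - w x) + H1_norm A (\<lambda>x. w x - v x)"
proof -
  interpret form_space "H1 A" "H1_inner A" by (rule H1_form_space[OF assms(1)])
  show ?thesis using nrm_triangle_diff[OF assms(2-4)] by (simp add: H1_norm_eq[OF assms(1)])
qed

lemma wgrad_diff:
  assumes "open A" "u \<in> H1 A" "v \<in> H1 A"
  shows "AE x in lebesgue_on A. wgrad A (\<lambda>x. u x - v x) x = wgrad A u x - wgrad A v x"
proof -
  have "AE x in lebesgue_on A. wgrad A (\<lambda>x. u x + (-1) *\<^sub>R v x) x = wgrad A u x + wgrad A (\<lambda>x. (-1) *\<^sub>R v x) x"
    by (rule wgrad_add[OF assms(1,2) H1_scale[OF assms(1,3)]])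
  with wgrad_scale[OF assms(1,3), of "-1"] show ?thesis by eventually_elim simp
qed

text \<open>Functions and gradients converge separately in \<open>L2\<close>; the limit of the
  gradients is the gradient of the limit because weak derivatives pass to \<open>L2\<close>
  limits.\<close>

lemma H1_complete:
  assumes A: "open A" "bounded A" and F: "\<And>n. F n \<in> H1 A"
    and cauchy: "\<And>e. e > 0 \<Longrightarrow> \<exists>N. \<forall>m\<ge>N. \<forall>n\<ge>N. H1_norm A (\<lambda>x. F m x - F n x) < e"
  shows "\<exists>u\<in>H1 A. (\<lambda>n. H1_norm A (\<lambda>x. F n x - u x)) \<longlonglongrightarrow> 0"
proof -
  have lA: "A \<in> lmeasurable" "A \<in> sets lebesgue" using A by (auto intro: lmeasurable_open)
  have L: "F n \<in> L2 A" "wgrad A (F n) \<in> L2 A" for n by (rule H1_L2[OF F] wgrad_L2[OF F])+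
  have gdiff: "L2_norm A (\<lambda>x. wgrad A (F m) x - wgrad A (F n) x) = L2_norm A (wgrad A (\<lambda>x. F m x - F n x))" for m n
    using L2_norm_cong_AE[OF wgrad_L2[OF H1_diff[OF A(1) F F]] L2_diff[OF L(2,2)] wgrad_diff[OF A(1) F F]] by simp
  have "\<exists>f\<in>L2 A. (\<lambda>n. L2_norm A (\<lambda>x. F n x - f x)) \<longlonglongrightarrow> 0"
  proof (rule L2_complete[OF lA(1) L(1)])
    fix e :: real assume "0 < e"
    from cauchy[OF this] show "\<exists>N. \<forall>m\<ge>N. \<forall>n\<ge>N. L2_norm A (\<lambda>x. F m x - F n x) < e"
      using H1_norm_ge(1) order_le_less_trans by blast
  qed
  then obtain u where u: "u \<in> L2 A" "(\<lambda>n. L2_norm A (\<lambda>x. F n x - u x)) \<longlonglongrightarrow> 0" by blast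
  have "\<exists>f\<in>L2 A. (\<lambda>n. L2_norm A (\<lambda>x. wgrad A (F n) x - f x)) \<longlonglongrightarrow> 0"
  proof (rule L2_complete[OF lA(1) L(2)])
    fix e :: real assume "0 < e"
    from cauchy[OF this] show "\<exists>N. \<forall>m\<ge>N. \<forall>n\<ge>N. L2_norm A (\<lambda>x. wgrad A (F m) x - wgrad A (F n) x) < e"
      unfolding gdiff using H1_norm_ge(2) order_le_less_trans by blast
  qed
  then obtain G where G: "G \<in> L2 A" "(\<lambda>n. L2_norm A (\<lambda>x. wgrad A (F n) x - G x)) \<longlonglongrightarrow> 0" by blast
  have w: "has_weak_gradient A u G"
    unfolding has_weak_gradient_iff
  proof (intro allI)
    fix i j :: 3
    show "weak_deriv A (axis j 1) (\<lambda>x. u x $ i) (\<lambda>x. G x $ i $ j)"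
    proof (rule weak_deriv_limit[where F="\<lambda>n x. F n x $ i" and G="\<lambda>n x. wgrad A (F n) x $ i $ j", OF lA(2)])
      show "weak_deriv A (axis j 1) (\<lambda>x. F n x $ i) (\<lambda>x. wgrad A (F n) x $ i $ j)" for n
        using wgrad_weak[OF F] by (simp add: has_weak_gradient_iff)
      show "(\<lambda>n. L2_norm A (\<lambda>x. F n x $ i - u x $ i)) \<longlonglongrightarrow> 0"
        using L2_vec_component(2)[OF L2_diff[OF L(1) u(1)]]
        by (intro Lim_null_comparison[OF _ u(2)] always_eventually allI) (simp add: L2_norm_nonneg)
      show "(\<lambda>n. L2_norm A (\<lambda>x. wgrad A (F n) x $ i $ j - G x $ i $ j)) \<longlonglongrightarrow> 0"
        using L2_mat_component(2)[OF L2_diff[OF L(2) G(1)]]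
        by (intro Lim_null_comparison[OF _ G(2)] always_eventually allI) (simp add: L2_norm_nonneg)
    qed (intro L2_vec_component(1) L2_mat_component(1) L u G)+
  qed
  have uH: "u \<in> H1 A" by (rule H1_I[OF u(1) G(1) w])
  have "(\<lambda>n. H1_norm A (\<lambda>x. F n x - u x)) \<longlonglongrightarrow> 0"
  proof (rule Lim_null_comparison)
    have "L2_norm A (wgrad A (\<lambda>x. F n x - u x)) = L2_norm A (\<lambda>x. wgrad A (F n) x - G x)" for n
    proof (rule L2_norm_cong_AE[OF wgrad_L2[OF H1_diff[OF A(1) F uH]] L2_diff[OF L(2) G(1)]])
      show "AE x in lebesgue_on A. wgrad A (\<lambda>x. F n x - u x) x = wgrad A (F n) x - G x"
        using wgrad_diff[OF A(1) F[of n] uH] wgrad_unique[OF A(1) u(1) G(1) w] by eventually_elim simp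
    qed
    then show "\<forall>\<^sub>F n in sequentially. norm (H1_norm A (\<lambda>x. F n x - u x))
        \<le> L2_norm A (\<lambda>x. F n x - u x) + L2_norm A (\<lambda>x. wgrad A (F n) x - G x)"
      using H1_norm_le[of A "\<lambda>x. F n x - u x" for n] by (intro always_eventually allI) (simp add: H1_norm_nonneg)
    show "(\<lambda>n. L2_norm A (\<lambda>x. F n x - u x) + L2_norm A (\<lambda>x. wgrad A (F n) x - G x)) \<longlonglongrightarrow> 0"
      using tendsto_add[OF u(2) G(2)] by simp
  qed
  then show ?thesis using uH by blast
qed

section \<open>Functions with zero trace\<close>

text \<open>\<open>has_trace\<close> with boundary value 0, freed from the measurability clause,
  which is trivial for 0, and from the subtraction.\<close>

definition zero_trace :: "(real^3) set \<Rightarrow> (real^3) set \<Rightarrow> (real^3 \<Rightarrow> real^3) \<Rightarrow> bool" where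
  "zero_trace D \<Gamma> u \<longleftrightarrow> (\<exists>\<phi>. (\<forall>n. C1 (\<phi> n)) \<and> (\<lambda>n. H1_norm D (\<lambda>x. \<phi> n x - u x)) \<longlonglongrightarrow> 0 \<and>
     (\<lambda>n::nat. \<integral>\<^sup>+x\<in>\<Gamma>. ennreal ((norm (\<phi> n x))\<^sup>2) \<partial>surface_measure) \<longlonglongrightarrow> 0)"

lemma has_trace_zero_iff: "has_trace D \<Gamma> u (\<lambda>_. 0) \<longleftrightarrow> zero_trace D \<Gamma> u"
  by (simp add: has_trace_def zero_trace_def)

lemma H1_norm_zero: "open A \<Longrightarrow> H1_norm A (\<lambda>x. 0) = 0"
proof -
  assume A: "open A"
  interpret form_space "H1 A" "H1_inner A" by (rule H1_form_space[OF A])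
  show ?thesis using nrm_scale[OF zero_in, of 0] by (simp add: H1_norm_eq[OF A])
qed

lemma zero_trace_zero: "open D \<Longrightarrow> zero_trace D \<Gamma> (\<lambda>x. 0)"
  unfolding zero_trace_def by (intro exI[of _ "\<lambda>n x. 0"]) (auto simp: C1_const H1_norm_zero)

lemma C1_scaleR: "C1 f \<Longrightarrow> C1 (\<lambda>x. c *\<^sub>R f x)"
  by (rule C1_bounded_linear[OF _ bounded_linear_scaleR_right])

lemma trace_measurable:
  fixes \<phi> :: "real^3 \<Rightarrow> real^3"
  assumes "C1 \<phi>" "\<Gamma> \<in> sets borel"
  shows "(\<lambda>x. ennreal ((norm (\<phi> x))\<^sup>2) * indicator \<Gamma> x) \<in> borel_measurable surface_measure"
proof -
  have [measurable]: "\<phi> \<in> borel_measurable borel" by (rule borel_measurable_continuous_onI[OF C1_continuous[OF assms(1)]])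
  note [measurable] = assms(2)
  show ?thesis unfolding measurable_cong_sets[OF sets_surface_measure refl] by measurable
qed

lemma zero_trace_scale:
  assumes D: "open D" "bounded D" and \<Gamma>: "\<Gamma> \<in> sets borel" and u: "u \<in> H1 D" "zero_trace D \<Gamma> u"
  shows "zero_trace D \<Gamma> (\<lambda>x. c *\<^sub>R u x)"
proof -
  interpret form_space "H1 D" "H1_inner D" by (rule H1_form_space[OF D(1)])
  obtain \<phi> where \<phi>: "\<And>n. C1 (\<phi> n)" "(\<lambda>n. H1_norm D (\<lambda>x. \<phi> n x - u x)) \<longlonglongrightarrow> 0"
     "(\<lambda>n::nat. \<integral>\<^sup>+x\<in>\<Gamma>. ennreal ((norm (\<phi> n x))\<^sup>2) \<partial>surface_measure) \<longlonglongrightarrow> 0"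
    using u(2) unfolding zero_trace_def by blast
  have "(\<lambda>n. H1_norm D (\<lambda>x. c *\<^sub>R \<phi> n x - c *\<^sub>R u x)) \<longlonglongrightarrow> 0"
  proof -
    have "H1_norm D (\<lambda>x. c *\<^sub>R \<phi> n x - c *\<^sub>R u x) = \<bar>c\<bar> * H1_norm D (\<lambda>x. \<phi> n x - u x)" for n
      using nrm_scale[OF diff_in[OF C1_H1[OF \<phi>(1) D(2,1)] u(1)], of c n]
      by (simp add: H1_norm_eq[OF D(1)] scaleR_diff_right)
    then show ?thesis using tendsto_mult_left[OF \<phi>(2), of "\<bar>c\<bar>"] by simp
  qed
  moreover have "(\<lambda>n. \<integral>\<^sup>+x\<in>\<Gamma>. ennreal ((norm (c *\<^sub>R \<phi> n x))\<^sup>2) \<partial>surface_measure) \<longlonglongrightarrow> 0"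
  proof (rule tendsto_sandwich[OF _ _ tendsto_const])
    show "\<forall>\<^sub>F n in sequentially. (\<integral>\<^sup>+x\<in>\<Gamma>. ennreal ((norm (c *\<^sub>R \<phi> n x))\<^sup>2) \<partial>surface_measure)
        \<le> ennreal (c\<^sup>2) * (\<integral>\<^sup>+x\<in>\<Gamma>. ennreal ((norm (\<phi> n x))\<^sup>2) \<partial>surface_measure)"
    proof (intro always_eventually allI)
      fix n
      have eq: "ennreal ((norm (c *\<^sub>R \<phi> n x))\<^sup>2) * indicator \<Gamma> x = ennreal (c\<^sup>2) * (ennreal ((norm (\<phi> n x))\<^sup>2) * indicator \<Gamma> x)" for x
        by (simp add: power_mult_distrib ennreal_mult mult.assoc)
      show "(\<integral>\<^sup>+x\<in>\<Gamma>. ennreal ((norm (c *\<^sub>R \<phi> n x))\<^sup>2) \<partial>surface_measure)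
        \<le> ennreal (c\<^sup>2) * (\<integral>\<^sup>+x\<in>\<Gamma>. ennreal ((norm (\<phi> n x))\<^sup>2) \<partial>surface_measure)"
        unfolding eq by (simp add: nn_integral_cmult trace_measurable[OF \<phi>(1) \<Gamma>])
    qed
    show "(\<lambda>n. ennreal (c\<^sup>2) * (\<integral>\<^sup>+x\<in>\<Gamma>. ennreal ((norm (\<phi> n x))\<^sup>2) \<partial>surface_measure)) \<longlonglongrightarrow> 0"
      using ennreal_tendsto_cmult[OF _ \<phi>(3), of "ennreal (c\<^sup>2)"] by simp
  qed simp
  ultimately show ?thesis unfolding zero_trace_def
    by (intro exI[of _ "\<lambda>n x. c *\<^sub>R \<phi> n x"] conjI allI C1_scaleR \<phi>(1))
qed

lemma zero_trace_add:
  assumes D: "open D" "bounded D" and \<Gamma>: "\<Gamma> \<in> sets borel"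
    and u: "u \<in> H1 D" "zero_trace D \<Gamma> u" and v: "v \<in> H1 D" "zero_trace D \<Gamma> v"
  shows "zero_trace D \<Gamma> (\<lambda>x. u x + v x)"
proof -
  interpret form_space "H1 D" "H1_inner D" by (rule H1_form_space[OF D(1)])
  obtain \<phi> where \<phi>: "\<And>n. C1 (\<phi> n)" "(\<lambda>n. H1_norm D (\<lambda>x. \<phi> n x - u x)) \<longlonglongrightarrow> 0"
     "(\<lambda>n::nat. \<integral>\<^sup>+x\<in>\<Gamma>. ennreal ((norm (\<phi> n x))\<^sup>2) \<partial>surface_measure) \<longlonglongrightarrow> 0"
    using u(2) unfolding zero_trace_def by blast
  obtain \<psi> where \<psi>: "\<And>n. C1 (\<psi> n)" "(\<lambda>n. H1_norm D (\<lambda>x. \<psi> n x - v x)) \<longlonglongrightarrow> 0"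
     "(\<lambda>n::nat. \<integral>\<^sup>+x\<in>\<Gamma>. ennreal ((norm (\<psi> n x))\<^sup>2) \<partial>surface_measure) \<longlonglongrightarrow> 0"
    using v(2) unfolding zero_trace_def by blast
  let ?a = "\<lambda>n. \<integral>\<^sup>+x\<in>\<Gamma>. ennreal ((norm (\<phi> n x))\<^sup>2) \<partial>surface_measure"
  let ?b = "\<lambda>n. \<integral>\<^sup>+x\<in>\<Gamma>. ennreal ((norm (\<psi> n x))\<^sup>2) \<partial>surface_measure"
  have "(\<lambda>n. H1_norm D (\<lambda>x. (\<phi> n x + \<psi> n x) - (u x + v x))) \<longlonglongrightarrow> 0"
  proof (rule Lim_null_comparison)
    have "H1_norm D (\<lambda>x. (\<phi> n x + \<psi> n x) - (u x + v x)) \<le> H1_norm D (\<lambda>x. \<phi> n x - u x) + H1_norm D (\<lambda>x. \<psi> n x - v x)" for n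
      using nrm_triangle[OF diff_in[OF C1_H1[OF \<phi>(1) D(2,1)] u(1)] diff_in[OF C1_H1[OF \<psi>(1) D(2,1)] v(1)], of n n]
      by (simp add: H1_norm_eq[OF D(1)] add_diff_add)
    then show "\<forall>\<^sub>F n in sequentially. norm (H1_norm D (\<lambda>x. (\<phi> n x + \<psi> n x) - (u x + v x)))
        \<le> H1_norm D (\<lambda>x. \<phi> n x - u x) + H1_norm D (\<lambda>x. \<psi> n x - v x)"
      by (simp add: H1_norm_nonneg)
    show "(\<lambda>n. H1_norm D (\<lambda>x. \<phi> n x - u x) + H1_norm D (\<lambda>x. \<psi> n x - v x)) \<longlonglongrightarrow> 0"
      using tendsto_add[OF \<phi>(2) \<psi>(2)] by simp
  qed
  moreover have "(\<lambda>n. \<integral>\<^sup>+x\<in>\<Gamma>. ennreal ((norm (\<phi> n x + \<psi> n x))\<^sup>2) \<partial>surface_measure) \<longlonglongrightarrow> 0"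
  proof (rule tendsto_sandwich[OF _ _ tendsto_const])
    show "\<forall>\<^sub>F n in sequentially. (\<integral>\<^sup>+x\<in>\<Gamma>. ennreal ((norm (\<phi> n x + \<psi> n x))\<^sup>2) \<partial>surface_measure) \<le> 2 * ?a n + 2 * ?b n"
    proof (intro always_eventually allI)
      fix n
      have "(\<integral>\<^sup>+x\<in>\<Gamma>. ennreal ((norm (\<phi> n x + \<psi> n x))\<^sup>2) \<partial>surface_measure)
        \<le> (\<integral>\<^sup>+x. 2 * (ennreal ((norm (\<phi> n x))\<^sup>2) * indicator \<Gamma> x) + 2 * (ennreal ((norm (\<psi> n x))\<^sup>2) * indicator \<Gamma> x) \<partial>surface_measure)"
      proof (rule nn_integral_mono)
        fix x
        have "ennreal ((norm (\<phi> n x + \<psi> n x))\<^sup>2) \<le> ennreal (2 * (norm (\<phi> n x))\<^sup>2 + 2 * (norm (\<psi> n x))\<^sup>2)"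
          by (intro ennreal_leI norm_add_power2_le)
        also have "\<dots> = 2 * ennreal ((norm (\<phi> n x))\<^sup>2) + 2 * ennreal ((norm (\<psi> n x))\<^sup>2)"
          by (simp add: ennreal_plus ennreal_mult)
        finally show "ennreal ((norm (\<phi> n x + \<psi> n x))\<^sup>2) * indicator \<Gamma> x
          \<le> 2 * (ennreal ((norm (\<phi> n x))\<^sup>2) * indicator \<Gamma> x) + 2 * (ennreal ((norm (\<psi> n x))\<^sup>2) * indicator \<Gamma> x)"
          by (simp add: indicator_def)
      qed
      also have "\<dots> = 2 * ?a n + 2 * ?b n"
        using trace_measurable[OF \<phi>(1) \<Gamma>, of n] trace_measurable[OF \<psi>(1) \<Gamma>, of n]
        by (simp add: nn_integral_add nn_integral_cmult borel_measurable_times_ennreal)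
      finally show "(\<integral>\<^sup>+x\<in>\<Gamma>. ennreal ((norm (\<phi> n x + \<psi> n x))\<^sup>2) \<partial>surface_measure) \<le> 2 * ?a n + 2 * ?b n" .
    qed
    show "(\<lambda>n. 2 * ?a n + 2 * ?b n) \<longlonglongrightarrow> 0"
      using tendsto_add[OF ennreal_tendsto_cmult[OF _ \<phi>(3), of 2] ennreal_tendsto_cmult[OF _ \<psi>(3), of 2]] by simp
  qed simp
  ultimately show ?thesis unfolding zero_trace_def
    by (intro exI[of _ "\<lambda>n x. \<phi> n x + \<psi> n x"] conjI allI C1_add \<phi>(1) \<psi>(1))
qed

text \<open>Diagonal selection: for each k one \<open>C1\<close> function that is within 1 / (k + 1)
  of \<open>u k\<close> in \<open>H1\<close> and equally small on the boundary. This gives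
  completeness of \<open>V\<close> without a continuity estimate for traces.\<close>

lemma zero_trace_limit:
  assumes D: "open D" "bounded D" and u: "\<And>k::nat. u k \<in> H1 D" "\<And>k. zero_trace D \<Gamma> (u k)"
    and v: "v \<in> H1 D" "(\<lambda>k. H1_norm D (\<lambda>x. u k x - v x)) \<longlonglongrightarrow> 0"
  shows "zero_trace D \<Gamma> v"
proof -
  define e where "e = (\<lambda>k. inverse (real (Suc k)))"
  have ex: "\<forall>k. \<exists>\<phi>. C1 \<phi> \<and> H1_norm D (\<lambda>x. \<phi> x - u k x) < e k \<and> (\<integral>\<^sup>+x\<in>\<Gamma>. ennreal ((norm (\<phi> x))\<^sup>2) \<partial>surface_measure) < ennreal (e k)"
  proof
    fix k
    have e: "0 < e k" "0 < ennreal (e k)" by (simp_all add: e_def)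
    obtain \<phi> where \<phi>: "\<And>n. C1 (\<phi> n)" "(\<lambda>n. H1_norm D (\<lambda>x. \<phi> n x - u k x)) \<longlonglongrightarrow> 0"
       "(\<lambda>n::nat. \<integral>\<^sup>+x\<in>\<Gamma>. ennreal ((norm (\<phi> n x))\<^sup>2) \<partial>surface_measure) \<longlonglongrightarrow> 0"
      using u(2)[of k] unfolding zero_trace_def by blast
    have "\<forall>\<^sub>F n in sequentially. H1_norm D (\<lambda>x. \<phi> n x - u k x) < e k \<and> (\<integral>\<^sup>+x\<in>\<Gamma>. ennreal ((norm (\<phi> n x))\<^sup>2) \<partial>surface_measure) < ennreal (e k)"
      by (intro eventually_conj order_tendstoD(2)[OF \<phi>(2) e(1)] order_tendstoD(2)[OF \<phi>(3) e(2)])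
    from eventually_happens[OF this] show "\<exists>\<phi>. C1 \<phi> \<and> H1_norm D (\<lambda>x. \<phi> x - u k x) < e k \<and> (\<integral>\<^sup>+x\<in>\<Gamma>. ennreal ((norm (\<phi> x))\<^sup>2) \<partial>surface_measure) < ennreal (e k)"
      using \<phi>(1) by auto
  qed
  from choice[OF ex] obtain \<phi> where *: "\<forall>k. C1 (\<phi> k) \<and> H1_norm D (\<lambda>x. \<phi> k x - u k x) < e k \<and>
      (\<integral>\<^sup>+x\<in>\<Gamma>. ennreal ((norm (\<phi> k x))\<^sup>2) \<partial>surface_measure) < ennreal (e k)" by (elim exE)
  then have \<phi>: "\<And>k. C1 (\<phi> k)" "\<And>k. H1_norm D (\<lambda>x. \<phi> k x - u k x) < e k"
    "\<And>k. (\<integral>\<^sup>+x\<in>\<Gamma>. ennreal ((norm (\<phi> k x))\<^sup>2) \<partial>surface_measure) < ennreal (e k)" by simp_all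
  have e0: "e \<longlonglongrightarrow> 0" unfolding e_def by (rule LIMSEQ_inverse_real_of_nat)
  have "(\<lambda>k. H1_norm D (\<lambda>x. \<phi> k x - v x)) \<longlonglongrightarrow> 0"
  proof (rule Lim_null_comparison)
    have "H1_norm D (\<lambda>x. \<phi> k x - v x) \<le> e k + H1_norm D (\<lambda>x. u k x - v x)" for k
      using H1_triangle_diff[OF D(1) C1_H1[OF \<phi>(1) D(2,1)] v(1) u(1), of k k] \<phi>(2)[of k] by linarith
    then show "\<forall>\<^sub>F k in sequentially. norm (H1_norm D (\<lambda>x. \<phi> k x - v x)) \<le> e k + H1_norm D (\<lambda>x. u k x - v x)"
      by (simp add: H1_norm_nonneg)
    show "(\<lambda>k. e k + H1_norm D (\<lambda>x. u k x - v x)) \<longlonglongrightarrow> 0" using tendsto_add[OF e0 v(2)] by simp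
  qed
  moreover have "(\<lambda>k. \<integral>\<^sup>+x\<in>\<Gamma>. ennreal ((norm (\<phi> k x))\<^sup>2) \<partial>surface_measure) \<longlonglongrightarrow> 0"
  proof (rule tendsto_sandwich[OF _ _ tendsto_const])
    show "(\<lambda>k. ennreal (e k)) \<longlonglongrightarrow> 0" using tendsto_ennrealI[OF e0] by simp
    show "\<forall>\<^sub>F k in sequentially. (\<integral>\<^sup>+x\<in>\<Gamma>. ennreal ((norm (\<phi> k x))\<^sup>2) \<partial>surface_measure) \<le> ennreal (e k)"
      by (intro always_eventually allI less_imp_le \<phi>(3))
  qed simp
  ultimately show ?thesis unfolding zero_trace_def using \<phi>(1) by blast
qed

text \<open>The same approximating sequence serves, as both controlled quantities decrease. Through
  this lemma a function in \<open>V\<close> gets zero trace from every member of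
  \<open>\<D>\<close>.\<close>

lemma zero_trace_mono:
  assumes D: "open D" "bounded D" "open D'" "D' \<subseteq> D" and "\<Gamma>' \<subseteq> \<Gamma>" and u: "u \<in> H1 D" "zero_trace D \<Gamma> u"
  shows "zero_trace D' \<Gamma>' u"
proof -
  obtain \<phi> where \<phi>: "\<And>n. C1 (\<phi> n)" "(\<lambda>n. H1_norm D (\<lambda>x. \<phi> n x - u x)) \<longlonglongrightarrow> 0"
     "(\<lambda>n::nat. \<integral>\<^sup>+x\<in>\<Gamma>. ennreal ((norm (\<phi> n x))\<^sup>2) \<partial>surface_measure) \<longlonglongrightarrow> 0"
    using u(2) unfolding zero_trace_def by blast
  have "(\<lambda>n. H1_norm D' (\<lambda>x. \<phi> n x - u x)) \<longlonglongrightarrow> 0"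
    using H1_norm_mono[OF D(1,3,4) H1_diff[OF D(1) C1_H1[OF \<phi>(1) D(2,1)] u(1)]]
    by (intro Lim_null_comparison[OF _ \<phi>(2)] always_eventually allI) (simp add: H1_norm_nonneg)
  moreover have "(\<lambda>n. \<integral>\<^sup>+x\<in>\<Gamma>'. ennreal ((norm (\<phi> n x))\<^sup>2) \<partial>surface_measure) \<longlonglongrightarrow> 0"
  proof (rule tendsto_sandwich[OF _ _ tendsto_const \<phi>(3)])
    show "\<forall>\<^sub>F n in sequentially. (\<integral>\<^sup>+x\<in>\<Gamma>'. ennreal ((norm (\<phi> n x))\<^sup>2) \<partial>surface_measure)
        \<le> (\<integral>\<^sup>+x\<in>\<Gamma>. ennreal ((norm (\<phi> n x))\<^sup>2) \<partial>surface_measure)"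
      using assms(5) by (intro always_eventually allI nn_integral_mono) (auto simp: indicator_def)
  qed simp
  ultimately show ?thesis unfolding zero_trace_def using \<phi>(1) by blast
qed

lemma H1_norm_zero_AE:
  assumes "open A" "u \<in> H1 A" "v \<in> H1 A" "H1_norm A (\<lambda>x. u x - v x) = 0"
  shows "AE x in lebesgue_on A. v x = u x"
proof -
  have "L2_norm A (\<lambda>x. u x - v x) = 0"
    using H1_norm_ge(1)[of A "\<lambda>x. u x - v x"] L2_norm_nonneg[of A "\<lambda>x. u x - v x"] assms(4) by linarith
  from L2_norm_eq_0_AE[OF L2_diff[OF H1_L2[OF assms(2)] H1_L2[OF assms(3)]] this] show ?thesis
    by eventually_elim simp
qed

section \<open>Elasticity tensors\<close>

lemma tensor_apply_linear:
  "tensor_apply C (A + B) = tensor_apply C A + tensor_apply C B"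
  "tensor_apply C (c *\<^sub>R A) = c *\<^sub>R tensor_apply C A"
  by (simp_all add: tensor_apply_def vec_eq_iff distrib_left sum.distrib scaleR_sum_right sum_distrib_left ac_simps)

lemma bounded_linear_tensor_apply: "bounded_linear (tensor_apply C)"
  by (intro linear_conv_bounded_linear[THEN iffD1] linearI tensor_apply_linear)

lemma tensor_apply_diff_left: "tensor_apply (C - C') A = tensor_apply C A - tensor_apply C' A"
  by (simp add: tensor_apply_def vec_eq_iff left_diff_distrib sum_subtractf)

lemma elasticity_tensor_diff: "elasticity_tensor C \<Longrightarrow> elasticity_tensor C' \<Longrightarrow> elasticity_tensor (C - C')"
  by (simp add: elasticity_tensor_def)

lemma sum_swap_pairs:
  fixes f :: "'a \<Rightarrow> 'a \<Rightarrow> 'a \<Rightarrow> 'a \<Rightarrow> 'b::comm_monoid_add"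
  shows "(\<Sum>i\<in>A. \<Sum>j\<in>A. \<Sum>k\<in>A. \<Sum>l\<in>A. f i j k l) = (\<Sum>k\<in>A. \<Sum>l\<in>A. \<Sum>i\<in>A. \<Sum>j\<in>A. f i j k l)"
proof -
  have rotate: "(\<Sum>j\<in>A. \<Sum>k\<in>A. \<Sum>l\<in>A. g j k l) = (\<Sum>k\<in>A. \<Sum>l\<in>A. \<Sum>j\<in>A. g j k l)" for g :: "'a \<Rightarrow> 'a \<Rightarrow> 'a \<Rightarrow> 'b"
  proof -
    have "(\<Sum>j\<in>A. \<Sum>k\<in>A. \<Sum>l\<in>A. g j k l) = (\<Sum>k\<in>A. \<Sum>j\<in>A. \<Sum>l\<in>A. g j k l)" by (rule sum.swap)
    also have "\<dots> = (\<Sum>k\<in>A. \<Sum>l\<in>A. \<Sum>j\<in>A. g j k l)" by (rule sum.cong[OF refl]) (rule sum.swap)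
    finally show ?thesis .
  qed
  have "(\<Sum>i\<in>A. \<Sum>j\<in>A. \<Sum>k\<in>A. \<Sum>l\<in>A. f i j k l) = (\<Sum>i\<in>A. \<Sum>k\<in>A. \<Sum>l\<in>A. \<Sum>j\<in>A. f i j k l)"
    by (rule sum.cong[OF refl]) (rule rotate)
  also have "\<dots> = (\<Sum>k\<in>A. \<Sum>l\<in>A. \<Sum>i\<in>A. \<Sum>j\<in>A. f i j k l)" by (rule rotate)
  finally show ?thesis .
qed

lemma tensor_apply_symmetric:
  assumes "elasticity_tensor C"
  shows "tensor_apply C A \<bullet> B = tensor_apply C B \<bullet> A"
proof -
  have "tensor_apply C A \<bullet> B = (\<Sum>i\<in>UNIV. \<Sum>j\<in>UNIV. \<Sum>k\<in>UNIV. \<Sum>l\<in>UNIV. C $ i $ j $ k $ l * A $ k $ l * B $ i $ j)"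
    by (simp add: tensor_apply_def inner_vec_def sum_distrib_right)
  also have "\<dots> = (\<Sum>k\<in>UNIV. \<Sum>l\<in>UNIV. \<Sum>i\<in>UNIV. \<Sum>j\<in>UNIV. C $ i $ j $ k $ l * A $ k $ l * B $ i $ j)"
    by (rule sum_swap_pairs)
  also have "\<dots> = (\<Sum>k\<in>UNIV. \<Sum>l\<in>UNIV. \<Sum>i\<in>UNIV. \<Sum>j\<in>UNIV. C $ k $ l $ i $ j * B $ i $ j * A $ k $ l)"
  proof (intro sum.cong refl)
    fix i j k l
    have "C $ i $ j $ k $ l = C $ k $ l $ i $ j" using assms unfolding elasticity_tensor_def by blast
    then show "C $ i $ j $ k $ l * A $ k $ l * B $ i $ j = C $ k $ l $ i $ j * B $ i $ j * A $ k $ l" by (simp only: ac_simps)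
  qed
  also have "\<dots> = tensor_apply C B \<bullet> A"
    by (simp add: tensor_apply_def inner_vec_def sum_distrib_right)
  finally show ?thesis .
qed

text \<open>The minor symmetry in the last two indices makes the tensor ignore the antisymmetric
  part of its argument; the major symmetry transfers this to the second factor.\<close>

lemma tensor_apply_sym_part:
  assumes "elasticity_tensor C"
  shows "tensor_apply C A \<bullet> A = tensor_apply C (sym_part A) \<bullet> sym_part A"
proof -
  have t: "tensor_apply C (transpose B) = tensor_apply C B" for B
  proof -
    have "(\<Sum>k\<in>UNIV. \<Sum>l\<in>UNIV. C $ i $ j $ k $ l * B $ l $ k) = (\<Sum>k\<in>UNIV. \<Sum>l\<in>UNIV. C $ i $ j $ k $ l * B $ k $ l)" for i j
    proof -
      have "(\<Sum>k\<in>UNIV. \<Sum>l\<in>UNIV. C $ i $ j $ k $ l * B $ l $ k) = (\<Sum>k\<in>UNIV. \<Sum>l\<in>UNIV. C $ i $ j $ l $ k * B $ l $ k)"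
      proof (intro sum.cong refl)
        fix k l
        have "C $ i $ j $ k $ l = C $ i $ j $ l $ k" using assms unfolding elasticity_tensor_def by blast
        then show "C $ i $ j $ k $ l * B $ l $ k = C $ i $ j $ l $ k * B $ l $ k" by (simp only:)
      qed
      also have "\<dots> = (\<Sum>k\<in>UNIV. \<Sum>l\<in>UNIV. C $ i $ j $ k $ l * B $ k $ l)" by (rule sum.swap)
      finally show ?thesis .
    qed
    then show ?thesis by (simp add: tensor_apply_def transpose_def)
  qed
  have "tensor_apply C (sym_part B) = tensor_apply C B" for B
    by (simp add: sym_part_def tensor_apply_linear t flip: scaleR_2)
  then have *: "tensor_apply C (sym_part A) \<bullet> B = tensor_apply C A \<bullet> B" for B by simp
  show ?thesis
    unfolding * tensor_apply_symmetric[OF assms, of A "sym_part A"] by (rule refl)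
qed

lemma strongly_elliptic_sym_part:
  assumes "elasticity_tensor C" "strongly_elliptic C c"
  shows "c * (norm (sym_part A))\<^sup>2 \<le> tensor_apply C A \<bullet> A"
proof -
  have "transpose (sym_part A) = sym_part A"
    by (simp add: sym_part_def transpose_def vec_eq_iff add.commute)
  then show ?thesis using assms(2) unfolding tensor_apply_sym_part[OF assms(1), of A]
    by (simp add: strongly_elliptic_def)
qed

section \<open>The energy form\<close>

definition energy :: "(real^3) set \<Rightarrow> tensor4 \<Rightarrow> (real^3 \<Rightarrow> real^3) \<Rightarrow> (real^3 \<Rightarrow> real^3) \<Rightarrow> real" where
  "energy A C u v = L2_inner A (\<lambda>x. tensor_apply C (wgrad A u x)) (wgrad A v)"

lemma tensor_wgrad_L2: "u \<in> H1 A \<Longrightarrow> (\<lambda>x. tensor_apply C (wgrad A u x)) \<in> L2 A"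
  by (rule L2_bounded_linear[OF wgrad_L2 bounded_linear_tensor_apply])

lemma energy_sym: "elasticity_tensor C \<Longrightarrow> energy A C u v = energy A C v u"
  by (simp add: energy_def L2_inner_def tensor_apply_symmetric[of C "wgrad A u x" "wgrad A v x" for x])

text \<open>\<open>energy_sym\<close> moves the sum into the slot without the tensor, where the
  almost everywhere linearity of \<open>wgrad\<close> is available as
  \<open>wgrad_add_L2\<close>.\<close>

lemma energy_add:
  assumes "open A" "elasticity_tensor C" "u \<in> H1 A" "u' \<in> H1 A" "v \<in> H1 A"
  shows "energy A C (\<lambda>x. u x + u' x) v = energy A C u v + energy A C u' v"
proof -
  note s = energy_sym[OF assms(2), of A _ v]
  show ?thesis unfolding s unfolding energy_def
    using wgrad_add_L2[OF assms(1,3,4) tensor_wgrad_L2[OF assms(5)]] assms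
    by (simp add: L2.form_sym[OF tensor_wgrad_L2[OF assms(5)]] wgrad_L2 H1_add)
qed

lemma energy_scale:
  assumes "open A" "elasticity_tensor C" "u \<in> H1 A" "v \<in> H1 A"
  shows "energy A C (\<lambda>x. c *\<^sub>R u x) v = c * energy A C u v"
proof -
  note s = energy_sym[OF assms(2), of A _ v]
  show ?thesis unfolding s unfolding energy_def
    using wgrad_scale_L2[OF assms(1,3) tensor_wgrad_L2[OF assms(4)]] assms
    by (simp add: L2.form_sym[OF tensor_wgrad_L2[OF assms(4)]] wgrad_L2 H1_scale)
qed

lemma energy_diff:
  assumes "open A" "elasticity_tensor C" "u \<in> H1 A" "u' \<in> H1 A" "v \<in> H1 A"
  shows "energy A C (\<lambda>x. u x - u' x) v = energy A C u v - energy A C u' v"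
  using energy_add[OF assms(1,2,3) H1_scale[OF assms(1,4)] assms(5), of "-1"] energy_scale[OF assms(1,2,4,5), of "-1"] by simp

text \<open>The constant depends on the tensor alone, so one \<open>K\<close> serves every set and
  every pair of functions.\<close>

lemma energy_bound:
  obtains K where "0 \<le> K" "\<And>A u v. u \<in> H1 A \<Longrightarrow> v \<in> H1 A \<Longrightarrow> \<bar>energy A C u v\<bar> \<le> K * H1_norm A u * H1_norm A v"
proof -
  obtain K where K: "0 < K" "\<And>B. norm (tensor_apply C B) \<le> norm B * K"
    using bounded_linear.pos_bounded[OF bounded_linear_tensor_apply] by blast
  have "\<bar>energy A C u v\<bar> \<le> K * H1_norm A u * H1_norm A v" if "u \<in> H1 A" "v \<in> H1 A" for A u v
  proof -
    note Lu = wgrad_L2[OF that(1)] and Lv = wgrad_L2[OF that(2)] and Lt = tensor_wgrad_L2[OF that(1), of C]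
    have "(LINT x|lebesgue_on A. (norm (tensor_apply C (wgrad A u x)))\<^sup>2) \<le> (LINT x|lebesgue_on A. K\<^sup>2 * (norm (wgrad A u x))\<^sup>2)"
    proof (rule integral_mono)
      show "(norm (tensor_apply C (wgrad A u x)))\<^sup>2 \<le> K\<^sup>2 * (norm (wgrad A u x))\<^sup>2" for x
        using power_mono[OF K(2), of "wgrad A u x" 2] by (simp add: power_mult_distrib mult.commute)
    qed (use L2_integrable[OF Lt] L2_integrable[OF Lu] in auto)
    then have "L2_norm A (\<lambda>x. tensor_apply C (wgrad A u x)) \<le> sqrt (K\<^sup>2 * (LINT x|lebesgue_on A. (norm (wgrad A u x))\<^sup>2))"
      by (simp add: L2_norm_def)
    also have "\<dots> = K * L2_norm A (wgrad A u)" using K(1) by (simp add: L2_norm_def real_sqrt_mult)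
    also have "\<dots> \<le> K * H1_norm A u" using K(1) by (intro mult_left_mono H1_norm_ge) auto
    finally have "L2_norm A (\<lambda>x. tensor_apply C (wgrad A u x)) * L2_norm A (wgrad A v) \<le> (K * H1_norm A u) * H1_norm A v"
      by (intro mult_mono H1_norm_ge) (use K(1) in \<open>auto simp: L2_norm_nonneg H1_norm_nonneg\<close>)
    then show ?thesis unfolding energy_def using L2_Cauchy_Schwarz[OF Lt Lv] by linarith
  qed
  then show ?thesis using that[of K] K(1) by simp
qed

section \<open>The coupled problem\<close>

locale fiber_problem =
  fixes \<Omega> :: "(real^3) set" and \<D> :: "(real^3) set set"
    and C\<^sub>\<Omega> C\<^sub>f :: tensor4 and c\<^sub>\<Omega> c\<^sub>f :: real
  assumes lip: "lipschitz_domain \<Omega>" and bdd: "bounded \<Omega>"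
    and open_D: "\<And>D. D \<in> \<D> \<Longrightarrow> open D" and sub: "\<Union>\<D> \<subseteq> \<Omega>"
    and el\<Omega>: "elasticity_tensor C\<^sub>\<Omega>" and elf: "elasticity_tensor C\<^sub>f"
    and se\<Omega>: "strongly_elliptic C\<^sub>\<Omega> c\<^sub>\<Omega>" and sef: "strongly_elliptic C\<^sub>f c\<^sub>f"
    and less: "c\<^sub>\<Omega> < c\<^sub>f" and pos: "0 < c\<^sub>\<Omega>"
begin

abbreviation F :: "(real^3) set" where "F \<equiv> \<Union>\<D>"
abbreviation V :: "(real^3 \<Rightarrow> real^3) set" where "V \<equiv> V_space \<Omega>"
abbreviation W :: "(real^3 \<Rightarrow> real^3) set" where "W \<equiv> W_space \<Omega> \<D>"
abbreviation \<delta>C :: tensor4 where "\<delta>C \<equiv> C\<^sub>f - C\<^sub>\<Omega>"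

lemma open_\<Omega>: "open \<Omega>"
  using lip by (simp add: lipschitz_domain_def)

lemma open_F: "open F"
  using open_D by auto

lemma el\<delta>: "elasticity_tensor \<delta>C"
  by (intro elasticity_tensor_diff el\<Omega> elf)

lemma sets_\<Omega>: "\<Omega> \<in> sets lebesgue" and sets_F: "F \<in> sets lebesgue"
  using open_\<Omega> open_F by (auto simp del: sets_lborel intro: lborelD borel_open)

lemma bounded_member: "D \<in> \<D> \<Longrightarrow> bounded D"
  using bdd sub by (meson Union_upper bounded_subset subset_trans)

lemma V_iff: "v \<in> V \<longleftrightarrow> v \<in> H1 \<Omega> \<and> zero_trace \<Omega> (frontier \<Omega>) v"
  by (simp add: V_space_def has_trace_zero_iff)

lemma W_iff: "w \<in> W \<longleftrightarrow> w \<in> H1 F \<and> (\<forall>D\<in>\<D>. zero_trace D (B_ext \<Omega> \<D> \<inter> frontier D) w)"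
  by (simp add: W_space_def has_trace_zero_iff)

lemma V_H1: "v \<in> V \<Longrightarrow> v \<in> H1 \<Omega>" and W_H1: "w \<in> W \<Longrightarrow> w \<in> H1 F"
  by (simp_all add: V_iff W_iff)

lemma W_H1_member: "w \<in> W \<Longrightarrow> D \<in> \<D> \<Longrightarrow> w \<in> H1 D"
  using H1_mono[OF open_F open_D _ W_H1] by auto

lemma borel_frontier: "frontier S \<in> sets borel" "B_ext \<Omega> \<D> \<inter> frontier S \<in> sets borel"
  by (auto simp: B_ext_def intro!: borel_closed closed_Int)

lemma V_zero: "(\<lambda>x. 0) \<in> V" and W_zero: "(\<lambda>x. 0) \<in> W"
  by (auto simp: V_iff W_iff H1_zero intro!: zero_trace_zero open_\<Omega> open_D)

lemma V_add: "u \<in> V \<Longrightarrow> v \<in> V \<Longrightarrow> (\<lambda>x. u x + v x) \<in> V"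
  by (auto simp: V_iff intro!: H1_add open_\<Omega> zero_trace_add bdd borel_frontier)

lemma V_scale: "u \<in> V \<Longrightarrow> (\<lambda>x. c *\<^sub>R u x) \<in> V"
  by (auto simp: V_iff intro!: H1_scale open_\<Omega> zero_trace_scale bdd borel_frontier)

lemma W_add:
  assumes "u \<in> W" "v \<in> W"
  shows "(\<lambda>x. u x + v x) \<in> W"
  unfolding W_iff
proof (intro conjI ballI H1_add[OF open_F W_H1[OF assms(1)] W_H1[OF assms(2)]])
  fix D assume D: "D \<in> \<D>"
  show "zero_trace D (B_ext \<Omega> \<D> \<inter> frontier D) (\<lambda>x. u x + v x)"
    using assms D
    by (intro zero_trace_add open_D bounded_member borel_frontier W_H1_member) (auto simp: W_iff)
qed

lemma W_scale:
  assumes "u \<in> W"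
  shows "(\<lambda>x. c *\<^sub>R u x) \<in> W"
  unfolding W_iff
proof (intro conjI ballI H1_scale[OF open_F W_H1[OF assms(1)]])
  fix D assume D: "D \<in> \<D>"
  show "zero_trace D (B_ext \<Omega> \<D> \<inter> frontier D) (\<lambda>x. c *\<^sub>R u x)"
    using assms D
    by (intro zero_trace_scale open_D bounded_member borel_frontier W_H1_member) (auto simp: W_iff)
qed

text \<open>Restriction is the identity on representatives, and the external boundary of the fibers
  is part of the frontier of \<Omega>.\<close>

lemma V_subset_W: "v \<in> V \<Longrightarrow> v \<in> W"
  unfolding W_iff
proof (intro conjI ballI)
  assume v: "v \<in> V"
  show "v \<in> H1 F" by (rule H1_mono[OF open_\<Omega> open_F sub V_H1[OF v]])
  fix D assume D: "D \<in> \<D>"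
  show "zero_trace D (B_ext \<Omega> \<D> \<inter> frontier D) v"
    by (rule zero_trace_mono[where \<Gamma>="frontier \<Omega>", OF open_\<Omega> bdd open_D[OF D]]) (use v D sub in \<open>auto simp: V_iff B_ext_def\<close>)
qed

lemma W_diff: "u \<in> W \<Longrightarrow> v \<in> W \<Longrightarrow> (\<lambda>x. u x - v x) \<in> W"
  using W_add[of u "\<lambda>x. (-1) *\<^sub>R v x"] W_scale[of v "-1"] by simp

lemma V_diff: "u \<in> V \<Longrightarrow> v \<in> V \<Longrightarrow> (\<lambda>x. u x - v x) \<in> V"
  using V_add[of u "\<lambda>x. (-1) *\<^sub>R v x"] V_scale[of v "-1"] by simp

lemma H1_norm_F_le: "v \<in> H1 \<Omega> \<Longrightarrow> H1_norm F v \<le> H1_norm \<Omega> v"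
  by (rule H1_norm_mono[OF open_\<Omega> open_F sub])

definition a :: "(real^3 \<Rightarrow> real^3) \<Rightarrow> (real^3 \<Rightarrow> real^3) \<Rightarrow> real" where
  "a u v = energy \<Omega> C\<^sub>\<Omega> u v + energy F \<delta>C u v"

text \<open>On the fibers the two contributions add up to the form with tensor \<open>C\<^sub>f\<close>, so \<open>\<delta>C\<close> itself need
  not be positive.\<close>

lemma a_ge_sym_part:
  assumes u: "u \<in> H1 \<Omega>"
  shows "c\<^sub>\<Omega> * (L2_norm \<Omega> (\<lambda>x. sym_part (wgrad \<Omega> u x)))\<^sup>2 \<le> a u u"
proof -
  define G where "G = wgrad \<Omega> u"
  have G: "G \<in> L2 \<Omega>" unfolding G_def by (rule wgrad_L2[OF u])
  have GF: "G \<in> L2 F" by (rule L2_mono(1)[OF sets_\<Omega> sets_F sub G])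
  have uF: "u \<in> H1 F" by (rule H1_mono[OF open_\<Omega> open_F sub u])
  \<comment> \<open>The gradients on the fibers and on \<Omega> are independent choices; they have
    to be identified before the two integrals can be merged.\<close>
  have AE: "AE x in lebesgue_on F. wgrad F u x = G x" unfolding G_def by (rule wgrad_mono[OF open_\<Omega> open_F sub u])
  have LT: "(\<lambda>x. tensor_apply C (G x)) \<in> L2 \<Omega>" "(\<lambda>x. tensor_apply C (G x)) \<in> L2 F" for C
    by (rule L2_bounded_linear[OF G bounded_linear_tensor_apply] L2_bounded_linear[OF GF bounded_linear_tensor_apply])+
  have "energy F \<delta>C u u = L2_inner F (\<lambda>x. tensor_apply \<delta>C (G x)) G"
    unfolding energy_def
  proof (rule L2_inner_cong_AE[OF tensor_wgrad_L2[OF uF] LT(2) wgrad_L2[OF uF] GF _ AE])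
    show "AE x in lebesgue_on F. tensor_apply \<delta>C (wgrad F u x) = tensor_apply \<delta>C (G x)"
      using AE by eventually_elim simp
  qed
  also have "\<dots> = (LINT x|lebesgue_on \<Omega>. indicator F x *\<^sub>R (tensor_apply \<delta>C (G x) \<bullet> G x))"
    unfolding L2_inner_def by (rule lebesgue_on_integral_indicator(1)[OF sets_\<Omega> sets_F sub])
  finally have 1: "energy F \<delta>C u u = (LINT x|lebesgue_on \<Omega>. indicator F x *\<^sub>R (tensor_apply \<delta>C (G x) \<bullet> G x))" .
  have i1: "integrable (lebesgue_on \<Omega>) (\<lambda>x. tensor_apply C\<^sub>\<Omega> (G x) \<bullet> G x)" by (rule L2_inner_integrable[OF LT(1) G])
  have i2: "integrable (lebesgue_on \<Omega>) (\<lambda>x. indicator F x *\<^sub>R (tensor_apply \<delta>C (G x) \<bullet> G x))"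
    using lebesgue_on_integral_indicator(2)[OF sets_\<Omega> sets_F sub, of "\<lambda>x. tensor_apply \<delta>C (G x) \<bullet> G x"]
      L2_inner_integrable[OF LT(2) GF] by blast
  have "a u u = (LINT x|lebesgue_on \<Omega>. tensor_apply C\<^sub>\<Omega> (G x) \<bullet> G x + indicator F x *\<^sub>R (tensor_apply \<delta>C (G x) \<bullet> G x))"
    unfolding a_def 1 Bochner_Integration.integral_add[OF i1 i2] by (simp add: energy_def L2_inner_def G_def)
  moreover have "(LINT x|lebesgue_on \<Omega>. c\<^sub>\<Omega> * (norm (sym_part (G x)))\<^sup>2)
      \<le> (LINT x|lebesgue_on \<Omega>. tensor_apply C\<^sub>\<Omega> (G x) \<bullet> G x + indicator F x *\<^sub>R (tensor_apply \<delta>C (G x) \<bullet> G x))"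
  proof (rule integral_mono)
    show "integrable (lebesgue_on \<Omega>) (\<lambda>x. c\<^sub>\<Omega> * (norm (sym_part (G x)))\<^sup>2)"
      using L2_integrable[OF L2_bounded_linear[OF G bounded_linear_sym_part]] by simp
    show "integrable (lebesgue_on \<Omega>) (\<lambda>x. tensor_apply C\<^sub>\<Omega> (G x) \<bullet> G x + indicator F x *\<^sub>R (tensor_apply \<delta>C (G x) \<bullet> G x))"
      by (rule Bochner_Integration.integrable_add[OF i1 i2])
    fix x
    show "c\<^sub>\<Omega> * (norm (sym_part (G x)))\<^sup>2 \<le> tensor_apply C\<^sub>\<Omega> (G x) \<bullet> G x + indicator F x *\<^sub>R (tensor_apply \<delta>C (G x) \<bullet> G x)"
    proof (cases "x \<in> F")
      case True
      have "c\<^sub>\<Omega> * (norm (sym_part (G x)))\<^sup>2 \<le> c\<^sub>f * (norm (sym_part (G x)))\<^sup>2"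
        using less by (intro mult_right_mono) auto
      also have "\<dots> \<le> tensor_apply C\<^sub>f (G x) \<bullet> G x" by (rule strongly_elliptic_sym_part[OF elf sef])
      finally show ?thesis using True by (simp add: tensor_apply_diff_left inner_diff_left)
    qed (use strongly_elliptic_sym_part[OF el\<Omega> se\<Omega>] in auto)
  qed
  ultimately show ?thesis by (simp add: L2_norm_def G_def)
qed

lemma a_coercive:
  obtains c where "0 < c" "\<And>u. u \<in> V \<Longrightarrow> c * (H1_norm \<Omega> u)\<^sup>2 \<le> a u u"
proof -
  obtain P where P: "0 < P" "\<And>v. v \<in> V \<Longrightarrow> L2_norm \<Omega> v \<le> P * L2_norm \<Omega> (wgrad \<Omega> v)"
    using poincare_V[OF lip bdd] by blast
  \<comment> \<open>Poincare bounds the squared \<open>H1\<close> norm by P^2 + 1 times that of the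
    gradient, and Korn adds the factor 2.\<close>
  define c where "c = c\<^sub>\<Omega> / (2 * (P\<^sup>2 + 1))"
  have P1: "0 < P\<^sup>2 + 1" using zero_le_power2[of P] by linarith
  have "c * (H1_norm \<Omega> u)\<^sup>2 \<le> a u u" if u: "u \<in> V" for u
  proof -
    have "(L2_norm \<Omega> u)\<^sup>2 \<le> (P * L2_norm \<Omega> (wgrad \<Omega> u))\<^sup>2"
      using P(2)[OF u] by (intro power_mono L2_norm_nonneg)
    then have "(H1_norm \<Omega> u)\<^sup>2 \<le> (P\<^sup>2 + 1) * (L2_norm \<Omega> (wgrad \<Omega> u))\<^sup>2"
      unfolding H1_norm_power2 by (simp add: power_mult_distrib distrib_right)
    also have "\<dots> \<le> (P\<^sup>2 + 1) * (2 * (L2_norm \<Omega> (\<lambda>x. sym_part (wgrad \<Omega> u x)))\<^sup>2)"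
      using P1 by (intro mult_left_mono korn_V[OF lip bdd u]) auto
    finally have "c * (H1_norm \<Omega> u)\<^sup>2 \<le> c * ((P\<^sup>2 + 1) * (2 * (L2_norm \<Omega> (\<lambda>x. sym_part (wgrad \<Omega> u x)))\<^sup>2))"
      using pos P1 by (intro mult_left_mono) (auto simp: c_def)
    also have "\<dots> = c\<^sub>\<Omega> * (L2_norm \<Omega> (\<lambda>x. sym_part (wgrad \<Omega> u x)))\<^sup>2"
      using P1 unfolding c_def by (simp add: field_simps)
    also have "\<dots> \<le> a u u" by (rule a_ge_sym_part[OF V_H1[OF u]])
    finally show ?thesis .
  qed
  moreover have "0 < c" using pos P1 by (simp add: c_def)
  ultimately show ?thesis using that by blast
qed

lemma a_add:
  assumes "u \<in> V" "u' \<in> V" "v \<in> V"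
  shows "a (\<lambda>x. u x + u' x) v = a u v + a u' v"
  using assms by (simp add: a_def energy_add open_\<Omega> open_F el\<Omega> el\<delta> V_H1 W_H1 V_subset_W)

lemma a_scale: "u \<in> V \<Longrightarrow> v \<in> V \<Longrightarrow> a (\<lambda>x. c *\<^sub>R u x) v = c * a u v"
  by (simp add: a_def energy_scale open_\<Omega> open_F el\<Omega> el\<delta> V_H1 W_H1 V_subset_W distrib_left)

lemma a_sym: "a u v = a v u"
  by (simp add: a_def energy_sym[OF el\<Omega>, of \<Omega> u v] energy_sym[OF el\<delta>, of F u v])

lemma a_form_space: "form_space V a"
proof
  fix u assume "u \<in> V"
  then show "0 \<le> a u u" using a_coercive by (metis less_imp_le mult_nonneg_nonneg order_trans zero_le_power2)
qed (auto intro: V_zero V_add V_scale a_add a_scale a_sym)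

lemma a_bound:
  obtains K where "0 \<le> K" "\<And>u v. u \<in> V \<Longrightarrow> v \<in> V \<Longrightarrow> \<bar>a u v\<bar> \<le> K * H1_norm \<Omega> u * H1_norm \<Omega> v"
proof -
  obtain K1 where K1: "0 \<le> K1" "\<And>A u v. u \<in> H1 A \<Longrightarrow> v \<in> H1 A \<Longrightarrow> \<bar>energy A C\<^sub>\<Omega> u v\<bar> \<le> K1 * H1_norm A u * H1_norm A v"
    by (rule energy_bound[of C\<^sub>\<Omega>]) (rule that)
  obtain K2 where K2: "0 \<le> K2" "\<And>A u v. u \<in> H1 A \<Longrightarrow> v \<in> H1 A \<Longrightarrow> \<bar>energy A \<delta>C u v\<bar> \<le> K2 * H1_norm A u * H1_norm A v"
    by (rule energy_bound[of \<delta>C]) (rule that)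
  have "\<bar>a u v\<bar> \<le> (K1 + K2) * H1_norm \<Omega> u * H1_norm \<Omega> v" if "u \<in> V" "v \<in> V" for u v
  proof -
    note H = V_H1[OF that(1)] V_H1[OF that(2)] W_H1[OF V_subset_W[OF that(1)]] W_H1[OF V_subset_W[OF that(2)]]
    have "K2 * H1_norm F u * H1_norm F v \<le> K2 * H1_norm \<Omega> u * H1_norm \<Omega> v"
      using K2(1) by (intro mult_mono mult_left_mono H1_norm_F_le H) (auto simp: H1_norm_nonneg)
    then show ?thesis
      using K1(2)[OF H(1,2)] K2(2)[OF H(3,4)] by (simp add: a_def distrib_right)
  qed
  then show ?thesis using that[of "K1 + K2"] K1(1) K2(1) by simp
qed

section \<open>Solvability of the reduced problem on V\<close>

lemma V_complete:
  assumes U: "\<And>n. U n \<in> V" and cauchy: "\<And>e. e > 0 \<Longrightarrow> \<exists>N. \<forall>m\<ge>N. \<forall>n\<ge>N. H1_norm \<Omega> (\<lambda>x. U m x - U n x) < e"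
  shows "\<exists>u\<in>V. (\<lambda>n. H1_norm \<Omega> (\<lambda>x. U n x - u x)) \<longlonglongrightarrow> 0"
proof -
  obtain u where u: "u \<in> H1 \<Omega>" "(\<lambda>n. H1_norm \<Omega> (\<lambda>x. U n x - u x)) \<longlonglongrightarrow> 0"
    using H1_complete[OF open_\<Omega> bdd V_H1[OF U] cauchy] by blast
  have "zero_trace \<Omega> (frontier \<Omega>) u"
    by (rule zero_trace_limit[OF open_\<Omega> bdd V_H1[OF U] _ u]) (use U in \<open>auto simp: V_iff\<close>)
  then show ?thesis using u by (auto simp: V_iff)
qed

text \<open>On \<open>V\<close> the energy norm is equivalent to the \<open>H1\<close> norm: the
  lower bound turns energy Cauchy sequences into \<open>H1\<close> ones and bounds the load, the
  upper bound turns \<open>H1\<close> limits back into energy limits.\<close>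

lemma a_representation:
  assumes b: "b \<in> L2 \<Omega>"
  shows "\<exists>u\<in>V. \<forall>v\<in>V. a u v = L2_inner \<Omega> b v"
proof -
  interpret form_space V a by (rule a_form_space)
  obtain c where c: "0 < c" "\<And>u. u \<in> V \<Longrightarrow> c * (H1_norm \<Omega> u)\<^sup>2 \<le> a u u" using a_coercive by blast
  obtain K where K: "0 \<le> K" "\<And>u v. u \<in> V \<Longrightarrow> v \<in> V \<Longrightarrow> \<bar>a u v\<bar> \<le> K * H1_norm \<Omega> u * H1_norm \<Omega> v" using a_bound by blast
  have lower: "sqrt c * H1_norm \<Omega> u \<le> nrm u" if "u \<in> V" for u
  proof -
    have "sqrt (c * (H1_norm \<Omega> u)\<^sup>2) \<le> sqrt (a u u)" by (rule real_sqrt_le_mono[OF c(2)[OF that]])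
    then show ?thesis by (simp add: nrm_def real_sqrt_mult H1_norm_nonneg)
  qed
  have upper: "nrm u \<le> sqrt K * H1_norm \<Omega> u" if "u \<in> V" for u
  proof -
    have "sqrt (a u u) \<le> sqrt (K * (H1_norm \<Omega> u)\<^sup>2)"
      using K(2)[OF that that] by (intro real_sqrt_le_mono) (simp add: power2_eq_square mult.assoc)
    then show ?thesis by (simp add: nrm_def real_sqrt_mult H1_norm_nonneg)
  qed
  show ?thesis
  proof (rule riesz_representation[where K="L2_norm \<Omega> b / sqrt c"])
    fix U :: "nat \<Rightarrow> real^3 \<Rightarrow> real^3"
    assume U: "\<And>n. U n \<in> V" and cauchy: "\<And>e. e > 0 \<Longrightarrow> \<exists>N. \<forall>m\<ge>N. \<forall>n\<ge>N. nrm (\<lambda>x. U m x - U n x) < e"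
    have "\<exists>u\<in>V. (\<lambda>n. H1_norm \<Omega> (\<lambda>x. U n x - u x)) \<longlonglongrightarrow> 0"
    proof (rule V_complete[OF U])
      fix e :: real assume "0 < e"
      then obtain N where N: "\<And>m n. m \<ge> N \<Longrightarrow> n \<ge> N \<Longrightarrow> nrm (\<lambda>x. U m x - U n x) < sqrt c * e"
        using cauchy[of "sqrt c * e"] c(1) by auto
      have "H1_norm \<Omega> (\<lambda>x. U m x - U n x) < e" if "m \<ge> N" "n \<ge> N" for m n
      proof -
        have "sqrt c * H1_norm \<Omega> (\<lambda>x. U m x - U n x) < sqrt c * e"
          using lower[OF V_diff[OF U U]] N[OF that] by (rule order_le_less_trans)
        then show ?thesis using c(1) by simp
      qed
      then show "\<exists>N. \<forall>m\<ge>N. \<forall>n\<ge>N. H1_norm \<Omega> (\<lambda>x. U m x - U n x) < e" by blast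
    qed
    then obtain u where u: "u \<in> V" "(\<lambda>n. H1_norm \<Omega> (\<lambda>x. U n x - u x)) \<longlonglongrightarrow> 0" by blast
    have "(\<lambda>n. nrm (\<lambda>x. U n x - u x)) \<longlonglongrightarrow> 0"
    proof (rule Lim_null_comparison)
      show "\<forall>\<^sub>F n in sequentially. norm (nrm (\<lambda>x. U n x - u x)) \<le> sqrt K * H1_norm \<Omega> (\<lambda>x. U n x - u x)"
        using upper[OF V_diff[OF U u(1)]] nrm_nonneg[OF V_diff[OF U u(1)]] by simp
      show "(\<lambda>n. sqrt K * H1_norm \<Omega> (\<lambda>x. U n x - u x)) \<longlonglongrightarrow> 0" using tendsto_mult_left[OF u(2), of "sqrt K"] by simp
    qed
    then show "\<exists>f\<in>V. (\<lambda>n. nrm (\<lambda>x. U n x - f x)) \<longlonglongrightarrow> 0" using u(1) by blast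
  next
    show "L2_inner \<Omega> b (\<lambda>x. f x + g x) = L2_inner \<Omega> b f + L2_inner \<Omega> b g" if "f \<in> V" "g \<in> V" for f g
      by (rule L2.form_add_right[OF H1_L2[OF V_H1[OF that(1)]] H1_L2[OF V_H1[OF that(2)]] b])
    show "L2_inner \<Omega> b (\<lambda>x. c *\<^sub>R f x) = c * L2_inner \<Omega> b f" if "f \<in> V" for f c
      by (rule L2.form_scale_right[OF H1_L2[OF V_H1[OF that(1)]] b])
    show "\<bar>L2_inner \<Omega> b f\<bar> \<le> L2_norm \<Omega> b / sqrt c * nrm f" if "f \<in> V" for f
    proof -
      have "\<bar>L2_inner \<Omega> b f\<bar> \<le> L2_norm \<Omega> b * L2_norm \<Omega> f" by (rule L2_Cauchy_Schwarz[OF b H1_L2[OF V_H1[OF that]]])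
      also have "\<dots> \<le> L2_norm \<Omega> b * (nrm f / sqrt c)"
      proof (intro mult_left_mono L2_norm_nonneg)
        have "sqrt c * L2_norm \<Omega> f \<le> sqrt c * H1_norm \<Omega> f" using c(1) by (intro mult_left_mono H1_norm_ge) auto
        also note lower[OF that]
        finally show "L2_norm \<Omega> f \<le> nrm f / sqrt c" using c(1) by (simp add: le_divide_eq mult.commute)
      qed
      finally show ?thesis by simp
    qed
  qed
qed

section \<open>The coupled system: existence, reduction and stability\<close>

abbreviation solution :: "(real^3 \<Rightarrow> real^3) \<Rightarrow> (real^3 \<Rightarrow> real^3) \<Rightarrow> (real^3 \<Rightarrow> real^3) \<Rightarrow> ((real^3 \<Rightarrow> real^3) \<Rightarrow> real) \<Rightarrow> bool" where
  "solution \<equiv> is_solution \<Omega> \<D> C\<^sub>\<Omega> \<delta>C"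

lemma solution_iff:
  "solution b u w l \<longleftrightarrow> u \<in> V \<and> w \<in> W \<and> l \<in> Q_space \<Omega> \<D> \<and>
     (\<forall>v\<in>V. energy \<Omega> C\<^sub>\<Omega> u v + l v = L2_inner \<Omega> b v) \<and> (\<forall>y\<in>W. energy F \<delta>C w y = l y) \<and>
     (\<forall>q\<in>Q_space \<Omega> \<D>. q (\<lambda>x. u x - w x) = 0)"
  by (simp add: is_solution_def energy_def)

text \<open>Admits as a multiplier the only functional that the second equation allows.\<close>

lemma energy_in_Q:
  assumes "u \<in> W"
  shows "energy F \<delta>C u \<in> Q_space \<Omega> \<D>"
proof -
  obtain K where "0 \<le> K" and K: "\<And>A u v. u \<in> H1 A \<Longrightarrow> v \<in> H1 A \<Longrightarrow> \<bar>energy A \<delta>C u v\<bar> \<le> K * H1_norm A u * H1_norm A v"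
    by (rule energy_bound[of \<delta>C]) (rule that)
  have "\<exists>K. \<forall>w\<in>W. \<bar>energy F \<delta>C u w\<bar> \<le> K * H1_norm F w"
    using K[OF W_H1[OF assms] W_H1] by blast
  moreover have "energy F \<delta>C u (\<lambda>x. v x + v' x) = energy F \<delta>C u v + energy F \<delta>C u v'" if "v \<in> W" "v' \<in> W" for v v'
    using energy_add[OF open_F el\<delta> W_H1[OF that(1)] W_H1[OF that(2)] W_H1[OF assms]]
    by (simp add: energy_sym[OF el\<delta>, of F u])
  moreover have "energy F \<delta>C u (\<lambda>x. c *\<^sub>R v x) = c * energy F \<delta>C u v" if "v \<in> W" for c v
    using energy_scale[OF open_F el\<delta> W_H1[OF that(1)] W_H1[OF assms]] by (simp add: energy_sym[OF el\<delta>, of F u])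
  ultimately show ?thesis by (simp add: Q_space_def)
qed

lemma H1_inner_in_Q:
  assumes "u \<in> W"
  shows "H1_inner F u \<in> Q_space \<Omega> \<D>"
proof -
  interpret form_space "H1 F" "H1_inner F" by (rule H1_form_space[OF open_F])
  note H = W_H1[OF assms] W_H1
  have "\<exists>K. \<forall>w\<in>W. \<bar>H1_inner F u w\<bar> \<le> K * H1_norm F w"
    using form_Cauchy_Schwarz[OF H] by (auto simp: H1_norm_eq[OF open_F])
  then show ?thesis using H by (simp add: Q_space_def form_add_right form_scale_right)
qed

lemma solution_exists:
  assumes "b \<in> L2 \<Omega>"
  shows "\<exists>u w l. solution b u w l"
proof -
  obtain u where u: "u \<in> V" "\<And>v. v \<in> V \<Longrightarrow> a u v = L2_inner \<Omega> b v" using a_representation[OF assms] by blast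
  \<comment> \<open>With \<open>w\<close> represented by \<open>u\<close> itself, the third equation
    says that \<open>q\<close> vanishes at 0, which is its homogeneity with factor 0.\<close>
  have "q (\<lambda>x. u x - u x) = 0" if "q \<in> Q_space \<Omega> \<D>" for q
  proof -
    have "q (\<lambda>x. 0 *\<^sub>R u x) = 0 * q u" using that V_subset_W[OF u(1)] by (simp only: Q_space_def mem_Collect_eq)
    then show ?thesis by simp
  qed
  then have "solution b u u (energy F \<delta>C u)"
    unfolding solution_iff using u V_subset_W[OF u(1)] energy_in_Q by (simp add: a_def)
  then show ?thesis by blast
qed

lemma solution_coupling:
  assumes "solution b u w l"
  shows "H1_norm F (\<lambda>x. u x - w x) = 0"
proof -
  have d: "(\<lambda>x. u x - w x) \<in> W" using assms V_subset_W W_diff by (simp add: solution_iff)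
  have "H1_inner F (\<lambda>x. u x - w x) (\<lambda>x. u x - w x) = 0"
    using assms H1_inner_in_Q[OF d] by (simp add: solution_iff)
  then show ?thesis
    unfolding H1_norm_eq[OF open_F, symmetric] form_space.nrm_def[OF H1_form_space[OF open_F]] by simp
qed

text \<open>\<open>w\<close> agrees with \<open>u\<close> only up to \<open>H1\<close> norm 0 on the
  fibers, so it is exchanged for \<open>u\<close> inside the energy by boundedness of the
  form.\<close>

lemma solution_a:
  assumes s: "solution b u w l" and v: "v \<in> V"
  shows "a u v = L2_inner \<Omega> b v"
proof -
  have u: "u \<in> V" "u \<in> W" and w: "w \<in> W" using s V_subset_W by (simp_all add: solution_iff)
  note vW = V_subset_W[OF v]
  obtain K where "0 \<le> K" and K: "\<And>A u v. u \<in> H1 A \<Longrightarrow> v \<in> H1 A \<Longrightarrow> \<bar>energy A \<delta>C u v\<bar> \<le> K * H1_norm A u * H1_norm A v"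
    by (rule energy_bound[of \<delta>C]) (rule that)
  have "energy F \<delta>C (\<lambda>x. u x - w x) v = 0"
    using K[OF W_H1[OF W_diff[OF u(2) w]] W_H1[OF vW]] by (simp add: solution_coupling[OF s])
  then have "energy F \<delta>C u v = energy F \<delta>C w v"
    using energy_diff[OF open_F el\<delta> W_H1[OF u(2)] W_H1[OF w] W_H1[OF vW]] by simp
  then show ?thesis using s v vW by (simp add: a_def solution_iff)
qed

text \<open>The difference d of two displacements solves the reduced problem with the difference of
  the loads, and coercivity bounds it by \<beta> / c. Equal loads yield uniqueness, so the same
  estimate serves both purposes.\<close>

lemma solution_stability:
  obtains M where "0 \<le> M" "\<And>b b' u w l u' w' l'. \<lbrakk>b \<in> L2 \<Omega>; b' \<in> L2 \<Omega>; solution b u w l; solution b' u' w' l'\<rbrakk> \<Longrightarrow>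
     H1_norm \<Omega> (\<lambda>x. u' x - u x) \<le> M * L2_norm \<Omega> (\<lambda>x. b' x - b x) \<and>
     H1_norm F (\<lambda>x. w' x - w x) \<le> M * L2_norm \<Omega> (\<lambda>x. b' x - b x) \<and>
     (\<forall>y\<in>W. \<bar>l' y - l y\<bar> \<le> M * L2_norm \<Omega> (\<lambda>x. b' x - b x) * H1_norm F y)"
proof -
  interpret a: form_space V a by (rule a_form_space)
  obtain c where c: "0 < c" "\<And>u. u \<in> V \<Longrightarrow> c * (H1_norm \<Omega> u)\<^sup>2 \<le> a u u" using a_coercive by blast
  obtain K where K: "0 \<le> K" "\<And>A u v. u \<in> H1 A \<Longrightarrow> v \<in> H1 A \<Longrightarrow> \<bar>energy A \<delta>C u v\<bar> \<le> K * H1_norm A u * H1_norm A v"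
    by (rule energy_bound[of \<delta>C]) (rule that)
  \<comment> \<open>Dominates both 1 / c, needed for the displacements, and K / c, needed for the
    multiplier, which is an energy of the fiber displacement.\<close>
  define M where "M = (1 + K) / c"
  have "H1_norm \<Omega> (\<lambda>x. u' x - u x) \<le> M * \<beta> \<and> H1_norm F (\<lambda>x. w' x - w x) \<le> M * \<beta> \<and>
      (\<forall>y\<in>W. \<bar>l' y - l y\<bar> \<le> M * \<beta> * H1_norm F y)"
    if b: "b \<in> L2 \<Omega>" "b' \<in> L2 \<Omega>" and s: "solution b u w l" "solution b' u' w' l'"
      and \<beta>: "\<beta> = L2_norm \<Omega> (\<lambda>x. b' x - b x)"
    for b b' u w l u' w' l' \<beta>
  proof -
    have u: "u \<in> V" "u' \<in> V" and w: "w \<in> W" "w' \<in> W" using s by (simp_all add: solution_iff)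
    define d where "d = (\<lambda>x. u' x - u x)"
    have d: "d \<in> V" unfolding d_def by (rule V_diff[OF u(2,1)])
    have \<beta>0: "0 \<le> \<beta>" by (simp add: \<beta> L2_norm_nonneg)
    have "a d d = L2_inner \<Omega> (\<lambda>x. b' x - b x) d"
      using a.form_diff[OF u(2,1) d] solution_a[OF s(1) d] solution_a[OF s(2) d] L2.form_diff[OF b(2,1) H1_L2[OF V_H1[OF d]]]
      by (simp add: d_def)
    also have "\<dots> \<le> \<beta> * H1_norm \<Omega> d"
      using L2_Cauchy_Schwarz[OF L2_diff[OF b(2,1)] H1_L2[OF V_H1[OF d]]] mult_left_mono[OF H1_norm_ge(1)[of \<Omega> d] \<beta>0]
      by (simp add: \<beta>)
    finally have "c * (H1_norm \<Omega> d)\<^sup>2 \<le> \<beta> * H1_norm \<Omega> d" using c(2)[OF d] by linarith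
    then have "(c * H1_norm \<Omega> d) * H1_norm \<Omega> d \<le> \<beta> * H1_norm \<Omega> d" by (simp add: power2_eq_square mult.assoc)
    \<comment> \<open>Cancelling one factor of the norm; if that norm is 0 the claim is 0 \<le>
      \<beta>.\<close>
    then have "c * H1_norm \<Omega> d \<le> \<beta>"
      using H1_norm_nonneg[of \<Omega> d] \<beta>0 mult_right_le_imp_le[of "c * H1_norm \<Omega> d" "H1_norm \<Omega> d" \<beta>] by (cases "H1_norm \<Omega> d = 0") auto
    then have d_le: "H1_norm \<Omega> d \<le> \<beta> / c" using c(1) by (simp add: le_divide_eq mult.commute)
    note uH = W_H1[OF V_subset_W[OF u(1)]] W_H1[OF V_subset_W[OF u(2)]] and wH = W_H1[OF w(1)] W_H1[OF w(2)]
    have "H1_norm F (\<lambda>x. w' x - w x) \<le> H1_norm F (\<lambda>x. w' x - u' x) + (H1_norm F (\<lambda>x. u' x - u x) + H1_norm F (\<lambda>x. u x - w x))"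
      using H1_triangle_diff[OF open_F wH(2,1) uH(2)] H1_triangle_diff[OF open_F uH(2) wH(1) uH(1)] by linarith
    also have "H1_norm F (\<lambda>x. w' x - u' x) = H1_norm F (\<lambda>x. u' x - w' x)"
      using form_space.nrm_minus_commute[OF H1_form_space[OF open_F] wH(2) uH(2)] by (simp add: H1_norm_eq[OF open_F])
    finally have "H1_norm F (\<lambda>x. w' x - w x) \<le> H1_norm F d"
      using solution_coupling[OF s(1)] solution_coupling[OF s(2)] by (simp add: d_def)
    then have w_le: "H1_norm F (\<lambda>x. w' x - w x) \<le> \<beta> / c" using H1_norm_F_le[OF V_H1[OF d]] d_le by linarith
    have M: "\<beta> / c \<le> M * \<beta>" "K * (\<beta> / c) \<le> M * \<beta>"
    proof -
      have "0 \<le> \<beta> / c" "0 \<le> K * (\<beta> / c)" using c(1) \<beta>0 K(1) by simp_all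
      moreover have "M * \<beta> = \<beta> / c + K * (\<beta> / c)" by (simp add: M_def add_divide_distrib distrib_right)
      ultimately show "\<beta> / c \<le> M * \<beta>" "K * (\<beta> / c) \<le> M * \<beta>" by linarith+
    qed
    have "\<bar>l' y - l y\<bar> \<le> M * \<beta> * H1_norm F y" if y: "y \<in> W" for y
    proof -
      have "l' y - l y = energy F \<delta>C (\<lambda>x. w' x - w x) y"
        using s y energy_diff[OF open_F el\<delta> wH(2,1) W_H1[OF y]] by (simp add: solution_iff)
      then have "\<bar>l' y - l y\<bar> \<le> K * H1_norm F (\<lambda>x. w' x - w x) * H1_norm F y"
        using K(2)[OF W_H1[OF W_diff[OF w(2,1)]] W_H1[OF y]] by simp
      also have "\<dots> \<le> K * (\<beta> / c) * H1_norm F y"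
        using K(1) w_le by (intro mult_right_mono mult_left_mono) (auto simp: H1_norm_nonneg)
      also have "\<dots> \<le> M * \<beta> * H1_norm F y" using M(2) by (intro mult_right_mono H1_norm_nonneg)
      finally show ?thesis .
    qed
    then show ?thesis using d_le w_le M(1) by (auto simp: d_def)
  qed
  moreover have "0 \<le> M" using c(1) K(1) by (simp add: M_def)
  ultimately show ?thesis using that[of M] by blast
qed

lemma well_posed_fiber_problem: "well_posed \<Omega> \<D> C\<^sub>\<Omega> \<delta>C"
proof -
  obtain M where M: "0 \<le> M" and stab: "\<And>b b' u w l u' w' l'. \<lbrakk>b \<in> L2 \<Omega>; b' \<in> L2 \<Omega>; solution b u w l; solution b' u' w' l'\<rbrakk> \<Longrightarrow>
     H1_norm \<Omega> (\<lambda>x. u' x - u x) \<le> M * L2_norm \<Omega> (\<lambda>x. b' x - b x) \<and>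
     H1_norm F (\<lambda>x. w' x - w x) \<le> M * L2_norm \<Omega> (\<lambda>x. b' x - b x) \<and>
     (\<forall>y\<in>W. \<bar>l' y - l y\<bar> \<le> M * L2_norm \<Omega> (\<lambda>x. b' x - b x) * H1_norm F y)"
    by (rule solution_stability) blast
  have unique: "(AE x in lebesgue_on \<Omega>. u x = u' x) \<and> (AE x in lebesgue_on F. w x = w' x) \<and> (\<forall>y\<in>W. l y = l' y)"
    if b: "b \<in> L2 \<Omega>" and s: "solution b u w l" "solution b u' w' l'" for b u w l u' w' l'
  proof -
    have uw: "u \<in> H1 \<Omega>" "u' \<in> H1 \<Omega>" "w \<in> H1 F" "w' \<in> H1 F" using s by (auto simp: solution_iff V_H1 W_H1)
    have "L2_norm \<Omega> (\<lambda>x. b x - b x) = 0" by (simp add: L2_norm_def)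
    note st = stab[OF b b s, unfolded this]
    have "H1_norm \<Omega> (\<lambda>x. u' x - u x) = 0" "H1_norm F (\<lambda>x. w' x - w x) = 0"
      using st H1_norm_nonneg[of \<Omega> "\<lambda>x. u' x - u x"] H1_norm_nonneg[of F "\<lambda>x. w' x - w x"] by auto
    then show ?thesis
      using H1_norm_zero_AE[OF open_\<Omega> uw(2,1)] H1_norm_zero_AE[OF open_F uw(4,3)] st by auto
  qed
  have continuous: "\<exists>\<delta>>0. \<forall>b'\<in>L2 \<Omega>. L2_norm \<Omega> (\<lambda>x. b' x - b x) < \<delta> \<longrightarrow> (\<forall>u w l u' w' l'.
      solution b u w l \<and> solution b' u' w' l' \<longrightarrow> H1_norm \<Omega> (\<lambda>x. u' x - u x) < \<epsilon> \<and>
      H1_norm F (\<lambda>x. w' x - w x) < \<epsilon> \<and> Q_norm \<Omega> \<D> (\<lambda>y. l' y - l y) < \<epsilon>)"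
    if b: "b \<in> L2 \<Omega>" and \<epsilon>: "0 < \<epsilon>" for b and \<epsilon> :: real
  \<comment> \<open>The summand 1 covers M = 0.\<close>
  proof (intro exI[of _ "\<epsilon> / (M + 1)"] conjI ballI impI allI; (elim conjE)?)
    show "0 < \<epsilon> / (M + 1)" using M \<epsilon> by simp
    fix b' u w l u' w' l'
    assume b': "b' \<in> L2 \<Omega>" and less: "L2_norm \<Omega> (\<lambda>x. b' x - b x) < \<epsilon> / (M + 1)"
      and s: "solution b u w l" "solution b' u' w' l'"
    define \<beta> where "\<beta> = L2_norm \<Omega> (\<lambda>x. b' x - b x)"
    have \<beta>0: "0 \<le> \<beta>" by (simp add: \<beta>_def L2_norm_nonneg)
    have "(M + 1) * \<beta> < \<epsilon>" using less M by (simp add: \<beta>_def less_divide_eq mult.commute)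
    then have M\<beta>: "M * \<beta> < \<epsilon>" using \<beta>0 by (simp add: distrib_right)
    note st = stab[OF b b' s, folded \<beta>_def]
    show "H1_norm \<Omega> (\<lambda>x. u' x - u x) < \<epsilon>" "H1_norm F (\<lambda>x. w' x - w x) < \<epsilon>" using st M\<beta> by auto
    have "Q_norm \<Omega> \<D> (\<lambda>y. l' y - l y) \<le> M * \<beta>"
      unfolding Q_norm_def
    proof (rule cSUP_least)
      \<comment> \<open>The real supremum in \<open>Q_norm\<close> is bounded by its terms only over
        a nonempty set; the zero function is a member.\<close>
      show "{w \<in> W. H1_norm F w \<le> 1} \<noteq> {}" using W_zero H1_norm_zero[OF open_F] by force
      fix y assume y: "y \<in> {w \<in> W. H1_norm F w \<le> 1}"
      then have "\<bar>l' y - l y\<bar> \<le> M * \<beta> * H1_norm F y" using st by auto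
      also have "\<dots> \<le> M * \<beta> * 1" using y M \<beta>0 by (intro mult_left_mono) auto
      finally show "\<bar>l' y - l y\<bar> \<le> M * \<beta>" by simp
    qed
    then show "Q_norm \<Omega> \<D> (\<lambda>y. l' y - l y) < \<epsilon>" using M\<beta> by simp
  qed
  show ?thesis
    unfolding well_posed_def using solution_exists unique continuous by blast
qed

end

theorem mainTheorem3:
  fixes \<Omega> :: "(real^3) set" and \<D> :: "(real^3) set set"
    and C\<^sub>\<Omega> C\<^sub>f :: tensor4 and c\<^sub>\<Omega> c\<^sub>f :: real
  assumes "lipschitz_domain \<Omega>" and "bounded \<Omega>"
    and "finite \<D>" and "\<forall>D\<in>\<D>. lipschitz_domain D" and "\<Union>\<D> \<subseteq> \<Omega>"
    and "lipschitz_domain (interior (\<Omega> - \<Union>\<D>))"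
    and "elasticity_tensor C\<^sub>\<Omega>" and "elasticity_tensor C\<^sub>f"
    and "strongly_elliptic C\<^sub>\<Omega> c\<^sub>\<Omega>" and "strongly_elliptic C\<^sub>f c\<^sub>f"
    and "c\<^sub>f > c\<^sub>\<Omega>" and "c\<^sub>\<Omega> > 0"
  shows "well_posed \<Omega> \<D> C\<^sub>\<Omega> (C\<^sub>f - C\<^sub>\<Omega>)"
proof -
  interpret fiber_problem \<Omega> \<D> C\<^sub>\<Omega> C\<^sub>f c\<^sub>\<Omega> c\<^sub>f
    by unfold_locales (use assms in \<open>auto simp: lipschitz_domain_def\<close>)
  show ?thesis by (rule well_posed_fiber_problem)
qed

end
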